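(* Let $s,t\ge 1$ and let $G$ be an OT-like Lie group of type $(s,t)$. If $G$ admits a lattice of simple type, then $G$ is associated to some OT manifold $X(K,U)$ of type $(s,t)$ and of simple type.
   Context: A lattice in a connected solvable Lie group $G$ is a discrete subgroup $\Gamma$ with $\Gamma\backslash G$ compact. OT-like Lie groups. Let $C=(c_{ij})\in \mathrm{Mat}_{t\times s}(\mathbb{C})$ satisfy $\mathrm{Re}\,c_{1j}+\cdots+\mathrm{Re}\,c_{tj}=-\tfrac12$ for all $1\le j\le s$. Define $\phi_C:\mathbb{R}^s\to \mathrm{GL}(\mathbb{R}^s\oplus\mathbb{C}^t)$ by $\phi_C(t_1,\dots,t_s)=\exp\big(\mathrm{diag}(t_1,\dots,t_s,(\sum_{j=1}^s c_{ij}t_j)_{i=1}^t)\big)$, and $G_C=\mathbb{R}^s\ltimes_{\phi_C}(\mathbb{R}^s\oplus\mathbb{C}^t)$ with product $(x_1,y_1)(x_2,y_2)=(x_1+x_2,\,y_1+\phi_C(x_1)y_2)$. A Lie group is OT-like of type $(s,t)$ if it is isomorphic to $G_C$ for some such $C$. Lattices of simple type. The nilradical (largest connected nilpotent normal subgroup) of $G_C$ is $N=\mathbb{R}^s\oplus\mathbb{C}^t$. For a lattice $\Gamma$ in $G_C$, $\Gamma_0=\Gamma\cap N$ is a lattice in $N$, and $\Gamma$ acts on $\Gamma_0$ by conjugation. $\Gamma$ is of simple type if the induced representation of $\Gamma$ on the $\mathbb{Q}$-vector space $\Gamma_0\otimes_{\mathbb{Z}}\mathbb{Q}$ is irreducible.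 For a Lie group isomorphic to $G_C$ the same definition is used with $N$ its nilradical. OT manifolds. Let $K$ be a number field of degree $n=s+2t$ over $\mathbb{Q}$ with exactly $s$ real embeddings $\sigma_1,\dots,\sigma_s$ and $2t$ complex (non-real) embeddings $\sigma_{s+1},\dots,\sigma_{s+2t}$, labelled so that $\sigma_{s+i}=\overline{\sigma_{s+t+i}}$ for $1\le i\le t$. Let $\mathcal{O}_K$ be its ring of integers and $\mathcal{O}_K^{\times,+}=\{u\in\mathcal{O}_K^\times: \sigma_i(u)>0,\ 1\le i\le s\}$. A subgroup $U\subset\mathcal{O}_K^{\times,+}$ is admissible if it has rank $s$ and $\{(\log\sigma_1(u),\dots,\log\sigma_s(u)):u\in U\}$ is a lattice in $\mathbb{R}^s$. For admissible $U$, the OT manifold of type $(s,t)$ is $X(K,U)=(\mathbb{H}^s\times\mathbb{C}^t)/(U\ltimes\mathcal{O}_K)$, where $\mathbb{H}$ is the upper half-plane, $a\in\mathcal{O}_K$ acts by translation by $(\sigma_1(a),\dots,\sigma_{s+t}(a))$ and $u\in U$ acts by coordinatewise multiplication by $(\sigma_1(u),\dots,\sigma_{s+t}(u))$. It is of simple type if $\mathbb{Q}(U)=K$. Associated groups. A Lie group $G$ is associated to $X(K,U)$ if, for some labelling $\sigma_1,\dots,\sigma_{s+2t}$ of the embeddings of $K$ with $\sigma_1,\dots,\sigma_s$ real and $\sigma_{s+1},\dots,\sigma_{s+2t}$ non-real satisfying $\sigma_{s+i}=\overline{\sigma_{s+t+i}}$ for $1\le i\le t$, some $\mathbb{Z}$-basis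 $(a_k)_{k=1}^s$ of $U$ and some $C=(c_{ij})\in\mathrm{Mat}_{t\times s}(\mathbb{C})$ satisfying $\sigma_{s+i}(a_k)=\exp\big(\sum_{j=1}^s c_{ij}\log\sigma_j(a_k)\big)$ for all $1\le i\le t$, $1\le k\le s$, one has $G\cong G_C$ (such a $C$ automatically satisfies $\sum_i\mathrm{Re}\,c_{ij}=-\tfrac12$ for all $j$). *)

theory Defs
  imports "HOL-Analysis.Analysis" "HOL-Algebra.Generated_Groups" "HOL-Algebra.Module"
    "HOL-Algebra.Free_Abelian_Groups" "HOL-Computational_Algebra.Polynomial"
begin

section \<open>Smooth manifolds and Lie groups\<close>

text \<open>\<open>Ck_on k S f\<close> is meant for open \<open>S\<close> only: \<open>f\<close> is of class \<open>C\<^sup>k\<close> on \<open>S\<close>.\<close>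

primrec Ck_on ::
  "nat \<Rightarrow> 'a::euclidean_space set \<Rightarrow> ('a \<Rightarrow> 'b::euclidean_space) \<Rightarrow> bool" where
  "Ck_on 0 S f \<longleftrightarrow> continuous_on S f"
| "Ck_on (Suc k) S f \<longleftrightarrow> f differentiable_on S \<and>
     (\<forall>v. Ck_on k S (\<lambda>x. frechet_derivative f (at x) v))"

definition smooth_on :: "'a::euclidean_space set \<Rightarrow> ('a \<Rightarrow> 'b::euclidean_space) \<Rightarrow> bool" where
  "smooth_on S f \<longleftrightarrow> (\<forall>k. Ck_on k S f)"

text \<open>Charts are pairs of a domain and a coordinate map with values in the model space \<open>'e\<close>;
  the atlas need not be maximal.\<close>

record ('p, 'e) manifold =
  mtop :: "'p topology"
  atlas :: "('p set \<times> ('p \<Rightarrow> 'e)) set"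

definition smooth_manifold :: "('p, 'e::euclidean_space) manifold \<Rightarrow> bool" where
  "smooth_manifold M \<longleftrightarrow>
     Hausdorff_space (mtop M) \<and> second_countable (mtop M) \<and>
     (\<forall>(U, \<phi>) \<in> atlas M. openin (mtop M) U \<and> open (\<phi> ` U) \<and>
        homeomorphic_map (subtopology (mtop M) U) (top_of_set (\<phi> ` U)) \<phi>) \<and>
     (\<Union>(U, \<phi>) \<in> atlas M. U) = topspace (mtop M) \<and>
     (\<forall>(U, \<phi>) \<in> atlas M. \<forall>(V, \<psi>) \<in> atlas M.
        smooth_on (\<phi> ` (U \<inter> V)) (\<psi> \<circ> inv_into U \<phi>))"

definition smooth_map ::
  "('p, 'd::euclidean_space) manifold \<Rightarrow> ('q, 'e::euclidean_space) manifold \<Rightarrow> ('p \<Rightarrow> 'q) \<Rightarrow> bool"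
  where
  "smooth_map M N f \<longleftrightarrow> continuous_map (mtop M) (mtop N) f \<and>
     (\<forall>(U, \<phi>) \<in> atlas M. \<forall>(V, \<psi>) \<in> atlas N.
        smooth_on (\<phi> ` {x \<in> U. f x \<in> V}) (\<psi> \<circ> f \<circ> inv_into U \<phi>))"

definition prod_manifold ::
  "('p, 'd) manifold \<Rightarrow> ('q, 'e) manifold \<Rightarrow> ('p \<times> 'q, 'd \<times> 'e) manifold" where
  "prod_manifold M N =
     \<lparr>mtop = prod_topology (mtop M) (mtop N),
      atlas = {(U \<times> V, map_prod \<phi> \<psi>) | U \<phi> V \<psi>. (U, \<phi>) \<in> atlas M \<and> (V, \<psi>) \<in> atlas N}\<rparr>"

definition euclidean_manifold :: "('e::euclidean_space, 'e) manifold" where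
  "euclidean_manifold = \<lparr>mtop = euclidean, atlas = {(UNIV, id)}\<rparr>"

record ('g, 'e) lie_group = "'g monoid" +
  mfd :: "('g, 'e) manifold"

definition is_lie_group :: "('g, 'e::euclidean_space) lie_group \<Rightarrow> bool" where
  "is_lie_group G \<longleftrightarrow>
     group G \<and> smooth_manifold (mfd G) \<and> topspace (mtop (mfd G)) = carrier G \<and>
     smooth_map (prod_manifold (mfd G) (mfd G)) (mfd G) (\<lambda>(x, y). x \<otimes>\<^bsub>G\<^esub> y) \<and>
     smooth_map (mfd G) (mfd G) (\<lambda>x. inv\<^bsub>G\<^esub> x)"

definition lie_isomorphic ::
  "('g, 'd::euclidean_space) lie_group \<Rightarrow> ('h, 'e::euclidean_space) lie_group \<Rightarrow> bool" where
  "lie_isomorphic G H \<longleftrightarrow>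
     (\<exists>f \<in> iso G H. smooth_map (mfd G) (mfd H) f \<and>
        smooth_map (mfd H) (mfd G) (inv_into (carrier G) f))"


section \<open>Lattices\<close>

definition quotient_topology :: "'a topology \<Rightarrow> ('a \<Rightarrow> 'b) \<Rightarrow> 'b topology" where
  "quotient_topology X f =
     topology (\<lambda>V. V \<subseteq> f ` topspace X \<and> openin X {x \<in> topspace X. f x \<in> V})"

lemma openin_quotient_topology:
  "openin (quotient_topology X f) V \<longleftrightarrow>
     V \<subseteq> f ` topspace X \<and> openin X {x \<in> topspace X. f x \<in> V}"
proof -
  let ?P = "\<lambda>V. V \<subseteq> f ` topspace X \<and> openin X {x \<in> topspace X. f x \<in> V}"
  have "istopology ?P"
  proof (unfold istopology_def, intro conjI allI impI)
    fix S T assume S: "?P S" and T: "?P T"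
    have "{x \<in> topspace X. f x \<in> S \<inter> T} =
        {x \<in> topspace X. f x \<in> S} \<inter> {x \<in> topspace X. f x \<in> T}" by auto
    with S T show "openin X {x \<in> topspace X. f x \<in> S \<inter> T}" by auto
    from S show "S \<inter> T \<subseteq> f ` topspace X" by blast
  next
    fix K assume K: "\<forall>S\<in>K. ?P S"
    have "{x \<in> topspace X. f x \<in> \<Union>K} = (\<Union>S\<in>K. {x \<in> topspace X. f x \<in> S})" by auto
    with K show "openin X {x \<in> topspace X. f x \<in> \<Union>K}" by auto
    from K show "\<Union>K \<subseteq> f ` topspace X" by blast
  qed
  then show ?thesis
    by (simp add: quotient_topology_def)
qed

lemma topspace_quotient_topology: "topspace (quotient_topology X f) = f ` topspace X"
proof -
  have "{x \<in> topspace X. f x \<in> f ` topspace X} = topspace X" by auto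
  then have "openin (quotient_topology X f) (f ` topspace X)"
    by (simp add: openin_quotient_topology)
  then show ?thesis
    by (meson openin_quotient_topology openin_subset openin_topspace subset_antisym)
qed

lemma quotient_map_quotient_topology: "quotient_map X (quotient_topology X f) f"
  by (auto simp: quotient_map_def topspace_quotient_topology openin_quotient_topology)

definition is_lattice :: "('a, 'b) monoid_scheme \<Rightarrow> 'a topology \<Rightarrow> 'a set \<Rightarrow> bool" where
  "is_lattice G T \<Gamma> \<longleftrightarrow>
     subgroup \<Gamma> G \<and> subtopology T \<Gamma> = discrete_topology \<Gamma> \<and>
     compact_space (quotient_topology T (\<lambda>g. \<Gamma> #>\<^bsub>G\<^esub> g))"


section \<open>The nilradical\<close>

primrec lower_central :: "('a, 'b) monoid_scheme \<Rightarrow> nat \<Rightarrow> 'a set" where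
  "lower_central G 0 = carrier G"
| "lower_central G (Suc n) =
     generate G {g \<otimes>\<^bsub>G\<^esub> h \<otimes>\<^bsub>G\<^esub> inv\<^bsub>G\<^esub> g \<otimes>\<^bsub>G\<^esub> inv\<^bsub>G\<^esub> h | g h.
       g \<in> carrier G \<and> h \<in> lower_central G n}"

definition nilpotent :: "('a, 'b) monoid_scheme \<Rightarrow> bool" where
  "nilpotent G \<longleftrightarrow> group G \<and> (\<exists>n. lower_central G n = {\<one>\<^bsub>G\<^esub>})"

definition nilradical :: "('g, 'e) lie_group \<Rightarrow> 'g set" where
  "nilradical G = (GREATEST M. M \<lhd> G \<and> connectedin (mtop (mfd G)) M \<and> nilpotent (G\<lparr>carrier := M\<rparr>))"


section \<open>The rational vector space of an abelian group\<close>

text \<open>The tensor product over the integers of an abelian group \<open>A\<close> (written multiplicatively)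
  with the rationals: the free abelian group on the pairs \<open>(a, q)\<close> modulo the
  subgroup generated by the biadditivity relations. Its elements are cosets.\<close>

definition tensor_free :: "('a, 'b) monoid_scheme \<Rightarrow> (('a \<times> rat) \<Rightarrow>\<^sub>0 int) monoid" where
  "tensor_free A = free_Abelian_group (carrier A \<times> UNIV)"

definition tensor_relations :: "('a, 'b) monoid_scheme \<Rightarrow> (('a \<times> rat) \<Rightarrow>\<^sub>0 int) set" where
  "tensor_relations A = generate (tensor_free A)
     ({frag_of (a \<otimes>\<^bsub>A\<^esub> b, q) - frag_of (a, q) - frag_of (b, q) | a b q.
         a \<in> carrier A \<and> b \<in> carrier A} \<union>
      {frag_of (a, q + r) - frag_of (a, q) - frag_of (a, r) | a q r. a \<in> carrier A})"

text \<open>The map of the tensor product induced by a map \<open>f\<close> of pairs, which is meant to be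
  additive in each component.\<close>

definition tensor_map ::
  "('a, 'b) monoid_scheme \<Rightarrow> ('a \<times> rat \<Rightarrow> 'a \<times> rat) \<Rightarrow>
     (('a \<times> rat) \<Rightarrow>\<^sub>0 int) set \<Rightarrow> (('a \<times> rat) \<Rightarrow>\<^sub>0 int) set" where
  "tensor_map A f X =
     (\<Union>c \<in> X. tensor_relations A #>\<^bsub>tensor_free A\<^esub> frag_extend (frag_of \<circ> f) c)"

text \<open>The multiplicative part of the record type of modules is unused.\<close>

definition tensor_rat :: "('a, 'b) monoid_scheme \<Rightarrow> (rat, (('a \<times> rat) \<Rightarrow>\<^sub>0 int) set) module" where
  "tensor_rat A =
     \<lparr>carrier = carrier (tensor_free A Mod tensor_relations A),
      monoid.mult = undefined, one = undefined,
      ring.zero = \<one>\<^bsub>tensor_free A Mod tensor_relations A\<^esub>,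
      ring.add = monoid.mult (tensor_free A Mod tensor_relations A),
      smult = (\<lambda>q. tensor_map A (\<lambda>(a, r). (a, q * r)))\<rparr>"

definition rat_ring :: "rat ring" where
  "rat_ring = \<lparr>carrier = UNIV, monoid.mult = (*), one = 1, ring.zero = 0, ring.add = (+)\<rparr>"

definition irreducible_rep ::
  "('r, 'm) ring_scheme \<Rightarrow> ('r, 'v, 'n) module_scheme \<Rightarrow> 'g set \<Rightarrow> ('g \<Rightarrow> 'v \<Rightarrow> 'v) \<Rightarrow> bool" where
  "irreducible_rep R V \<Gamma> \<rho> \<longleftrightarrow>
     carrier V \<noteq> {\<zero>\<^bsub>V\<^esub>} \<and>
     (\<forall>W. submodule W R V \<and> (\<forall>\<gamma>\<in>\<Gamma>. \<rho> \<gamma> ` W \<subseteq> W) \<longrightarrow> W = {\<zero>\<^bsub>V\<^esub>} \<or> W = carrier V)"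

definition lattice_of_simple_type :: "('g, 'e) lie_group \<Rightarrow> 'g set \<Rightarrow> bool" where
  "lattice_of_simple_type G \<Gamma> \<longleftrightarrow>
     is_lattice G (mtop (mfd G)) \<Gamma> \<and>
     (let \<Gamma>\<^sub>0 = G\<lparr>carrier := \<Gamma> \<inter> nilradical G\<rparr> in
        irreducible_rep rat_ring (tensor_rat \<Gamma>\<^sub>0) \<Gamma>
          (\<lambda>\<gamma>. tensor_map \<Gamma>\<^sub>0 (\<lambda>(a, q). (\<gamma> \<otimes>\<^bsub>G\<^esub> a \<otimes>\<^bsub>G\<^esub> inv\<^bsub>G\<^esub> \<gamma>, q))))"


section \<open>OT-like Lie groups\<close>

text \<open>The numbers \<open>s\<close> and \<open>t\<close> are the (positive) cardinalities of the finite index types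
  \<open>'s\<close> and \<open>'t\<close>; \<open>C $ i $ j\<close> is the entry in row \<open>i :: 't\<close> and column \<open>j :: 's\<close>.\<close>

definition OT_matrix :: "complex^'s::finite^'t::finite \<Rightarrow> bool" where
  "OT_matrix C \<longleftrightarrow> (\<forall>j. (\<Sum>i\<in>UNIV. Re (C $ i $ j)) = - 1 / 2)"

definition operator_exp :: "('v::real_normed_vector \<Rightarrow> 'v) \<Rightarrow> 'v \<Rightarrow> 'v" where
  "operator_exp A v = suminf (\<lambda>k. (A ^^ k) v /\<^sub>R fact k)"

definition OT_diag ::
  "complex^'s::finite^'t::finite \<Rightarrow> real^'s \<Rightarrow> (real^'s) \<times> (complex^'t) \<Rightarrow> (real^'s) \<times> (complex^'t)"
  where
  "OT_diag C x = (\<lambda>(v, w).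
     (\<chi> j. x $ j * v $ j, \<chi> i. (\<Sum>j\<in>UNIV. C $ i $ j * of_real (x $ j)) * w $ i))"

definition OT_phi ::
  "complex^'s::finite^'t::finite \<Rightarrow> real^'s \<Rightarrow> (real^'s) \<times> (complex^'t) \<Rightarrow> (real^'s) \<times> (complex^'t)"
  where
  "OT_phi C x = operator_exp (OT_diag C x)"

lemma OT_phi_apply:
  fixes C :: "complex^'s::finite^'t::finite"
  shows "OT_phi C x (v, w) =
    (\<chi> j. exp (x $ j) * v $ j, \<chi> i. exp (\<Sum>j\<in>UNIV. C $ i $ j * of_real (x $ j)) * w $ i)"
proof -
  define c where "c = (\<lambda>i. \<Sum>j\<in>UNIV. C $ i $ j * of_real (x $ j))"
  have pow: "(OT_diag C x ^^ k) (v, w) = (\<chi> j. (x $ j) ^ k * v $ j, \<chi> i. c i ^ k * w $ i)" for k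
    by (induction k) (simp_all add: OT_diag_def c_def mult.assoc vec_eq_iff)
  have r: "(\<lambda>k. ((x $ j) ^ k * v $ j) /\<^sub>R fact k) sums (exp (x $ j) * v $ j)" for j
    using sums_mult2[OF exp_converges[of "x $ j"], of "v $ j"] by (simp add: mult.assoc)
  have z: "(\<lambda>k. (c i ^ k * w $ i) /\<^sub>R fact k) sums (exp (c i) * w $ i)" for i
    using sums_mult2[OF exp_converges[of "c i"], of "w $ i"] by simp
  have r': "(\<lambda>k. (\<chi> j. (x $ j) ^ k * v $ j) /\<^sub>R fact k) sums (\<chi> j. exp (x $ j) * v $ j)"
    unfolding sums_def by (rule vec_tendstoI) (use r in \<open>simp add: sums_def\<close>)
  have z': "(\<lambda>k. (\<chi> i. c i ^ k * w $ i) /\<^sub>R fact k) sums (\<chi> i. exp (c i) * w $ i)"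
    unfolding sums_def by (rule vec_tendstoI) (use z in \<open>simp add: sums_def\<close>)
  have "(\<lambda>k. (OT_diag C x ^^ k) (v, w) /\<^sub>R fact k) sums
      (\<chi> j. exp (x $ j) * v $ j, \<chi> i. exp (c i) * w $ i)"
    using tendsto_Pair[OF r'[unfolded sums_def] z'[unfolded sums_def]]
    by (simp add: sums_def pow scaleR_prod_def sum_prod)
  then show ?thesis
    by (simp add: OT_phi_def operator_exp_def sums_iff c_def)
qed

definition OT_group ::
  "complex^'s::finite^'t::finite \<Rightarrow>
     ((real^'s) \<times> (real^'s) \<times> (complex^'t), (real^'s) \<times> (real^'s) \<times> (complex^'t)) lie_group" where
  "OT_group C =
     \<lparr>carrier = UNIV,
      monoid.mult = (\<lambda>(x\<^sub>1, y\<^sub>1) (x\<^sub>2, y\<^sub>2). (x\<^sub>1 + x\<^sub>2, y\<^sub>1 + OT_phi C x\<^sub>1 y\<^sub>2)),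
      one = 0,
      mfd = euclidean_manifold\<rparr>"

text \<open>A class of functions on Euclidean spaces that contains the group operations and is closed
  under directional derivatives.\<close>

inductive exp_affine :: "('a::euclidean_space \<Rightarrow> 'b::euclidean_space) \<Rightarrow> bool" where
  affineI: "bounded_linear l \<Longrightarrow> exp_affine (\<lambda>p. l p + c)"
| expI: "\<lbrakk>bounded_linear h; bounded_linear g; bounded_linear l\<rbrakk> \<Longrightarrow>
    exp_affine (\<lambda>p. l (exp (h p) * (g p + c) :: complex))"
| addI: "\<lbrakk>exp_affine f; exp_affine g\<rbrakk> \<Longrightarrow> exp_affine (\<lambda>p. f p + g p)"

lemma exp_affine_deriv:
  assumes "exp_affine f"
  shows "\<exists>f'. (\<forall>x. (f has_derivative f' x) (at x)) \<and> (\<forall>v. exp_affine (\<lambda>x. f' x v))"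
  using assms
proof induction
  case (affineI l c)
  have "exp_affine (\<lambda>_ :: 'a. l v)" for v
    using exp_affine.affineI[OF bounded_linear_zero, of "l v"] by simp
  moreover have "((\<lambda>p. l p + c) has_derivative l) (at x)" for x
    using affineI by (auto intro!: derivative_eq_intros bounded_linear_imp_has_derivative)
  ultimately show ?case
    by (intro exI[of _ "\<lambda>_. l"]) simp
next
  case (expI h g l c)
  have "((\<lambda>p. l (exp (h p) * (g p + c))) has_derivative
      (\<lambda>v. l (exp (h x) * (h v * g x + (g v + h v * c))))) (at x)" for x
  proof -
    have "((\<lambda>p. exp (h p)) has_derivative (\<lambda>v. exp (h x) * h v)) (at x)"
      using has_derivative_compose[OF bounded_linear_imp_has_derivative[OF expI(1)]
          DERIV_exp[THEN has_field_derivative_imp_has_derivative]] .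
    moreover have "((\<lambda>p. g p + c) has_derivative g) (at x)"
      by (rule has_derivative_add_const[OF bounded_linear_imp_has_derivative[OF expI(2)]])
    ultimately have "((\<lambda>p. exp (h p) * (g p + c)) has_derivative
        (\<lambda>v. exp (h x) * g v + exp (h x) * h v * (g x + c))) (at x)"
      by (rule has_derivative_mult)
    from bounded_linear.has_derivative[OF expI(3) this] show ?thesis
      by (simp add: algebra_simps)
  qed
  moreover have "exp_affine (\<lambda>x. l (exp (h x) * (h v * g x + (g v + h v * c))))" for v
    by (rule exp_affine.expI[OF expI(1) bounded_linear_const_mult[OF expI(2)] expI(3)])
  ultimately show ?case
    by (intro exI[of _ "\<lambda>x v. l (exp (h x) * (h v * g x + (g v + h v * c)))"]) simp
next
  case (addI f g)
  then obtain f' g' where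
    "\<And>x. (f has_derivative f' x) (at x)" "\<And>v. exp_affine (\<lambda>x. f' x v)"
    "\<And>x. (g has_derivative g' x) (at x)" "\<And>v. exp_affine (\<lambda>x. g' x v)" by blast
  then show ?case
    by (intro exI[of _ "\<lambda>x v. f' x v + g' x v"])
      (auto intro: has_derivative_add exp_affine.addI)
qed

lemma exp_affine_smooth_on:
  fixes f :: "'a::euclidean_space \<Rightarrow> 'b::euclidean_space"
  assumes "exp_affine f"
  shows "smooth_on UNIV f"
proof -
  have "Ck_on k UNIV f" for k
    using assms
  proof (induction k arbitrary: f)
    case 0
    then obtain f' where "\<And>x. (f has_derivative f' x) (at x)"
      using exp_affine_deriv by blast
    then show ?case
      by (auto intro!: continuous_at_imp_continuous_on has_derivative_continuous)
  next
    case (Suc k)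
    then obtain f' where f': "\<And>x. (f has_derivative f' x) (at x)" "\<And>v. exp_affine (\<lambda>x. f' x v)"
      using exp_affine_deriv by blast
    then have "frechet_derivative f (at x) = f' x" for x
      by (metis frechet_derivative_at)
    with f' Suc.IH show ?case
      by (auto simp: differentiable_on_def differentiable_def)
  qed
  then show ?thesis by (simp add: smooth_on_def)
qed

lemma exp_affine_sum: "finite A \<Longrightarrow> (\<And>i. i \<in> A \<Longrightarrow> exp_affine (f i)) \<Longrightarrow> exp_affine (\<lambda>p. \<Sum>i\<in>A. f i p)"
proof (induction rule: finite_induct)
  case empty
  show ?case using exp_affine.affineI[OF bounded_linear_zero, of 0] by simp
next
  case (insert a A)
  then show ?case by (simp add: exp_affine.addI)
qed

lemma sum_axis:
  fixes a :: "'i::finite \<Rightarrow> 'b::comm_monoid_add"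
  shows "(\<Sum>j\<in>UNIV. axis j (a j)) = (\<chi> j. a j)"
  by (simp add: vec_eq_iff axis_def if_distrib cong: if_cong)

lemma exp_affine_OT_phi:
  fixes C :: "complex^'s::finite^'t::finite"
  assumes f: "bounded_linear f" and g: "bounded_linear g" and l: "bounded_linear l"
  shows "exp_affine (\<lambda>p. l (OT_phi C (f p) (g p)))"
proof -
  define h1 where "h1 = (\<lambda>j p. complex_of_real (f p $ j))"
  define g1 where "g1 = (\<lambda>j p. complex_of_real (fst (g p) $ j))"
  define l1 where "l1 = (\<lambda>(j::'s) z. l (axis j (Re z), 0 :: complex^'t))"
  define h2 where "h2 = (\<lambda>i p. \<Sum>j\<in>UNIV. C $ i $ j * of_real (f p $ j))"
  define g2 where "g2 = (\<lambda>i p. snd (g p) $ i)"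
  define l2 where "l2 = (\<lambda>(i::'t) z. l (0 :: real^'s, axis i z))"
  have ax: "bounded_linear (axis j :: 'x::euclidean_space \<Rightarrow> 'x^'i::finite)" for j
    by (intro linear_conv_bounded_linear[THEN iffD1] linearI)
      (simp_all add: vec_eq_iff axis_def)
  have "bounded_linear (h1 j)" "bounded_linear (g1 j)" for j
    unfolding h1_def g1_def
    by (intro bounded_linear_compose[OF bounded_linear_of_real]
        bounded_linear_compose[OF bounded_linear_vec_nth]
        bounded_linear_compose[OF bounded_linear_fst] f g)+
  moreover have "bounded_linear (l1 j)" for j
    unfolding l1_def
    by (intro bounded_linear_compose[OF l] bounded_linear_Pair bounded_linear_zero
        bounded_linear_compose[OF ax] bounded_linear_Re)
  ultimately have 1: "exp_affine (\<lambda>p. l1 j (exp (h1 j p) * (g1 j p + 0)))" for j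
    by (intro exp_affine.expI)
  have "bounded_linear (h2 i)" "bounded_linear (g2 i)" for i
    unfolding h2_def g2_def
    by (intro bounded_linear_sum bounded_linear_const_mult
        bounded_linear_compose[OF bounded_linear_of_real]
        bounded_linear_compose[OF bounded_linear_vec_nth]
        bounded_linear_compose[OF bounded_linear_snd] f g)+
  moreover have "bounded_linear (l2 i)" for i
    unfolding l2_def
    by (intro bounded_linear_compose[OF l] bounded_linear_Pair bounded_linear_zero ax)
  ultimately have 2: "exp_affine (\<lambda>p. l2 i (exp (h2 i p) * (g2 i p + 0)))" for i
    by (intro exp_affine.expI)
  have "l (OT_phi C (f p) (g p)) =
      (\<Sum>j\<in>UNIV. l1 j (exp (h1 j p) * (g1 j p + 0))) + (\<Sum>i\<in>UNIV. l2 i (exp (h2 i p) * (g2 i p + 0)))"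
    for p
  proof -
    have "Re (exp (h1 j p) * g1 j p) = exp (f p $ j) * fst (g p) $ j" for j
      by (simp add: h1_def g1_def exp_of_real)
    then have "OT_phi C (f p) (g p) =
        (\<Sum>j\<in>UNIV. (axis j (Re (exp (h1 j p) * g1 j p)), 0)) +
        (\<Sum>i\<in>UNIV. (0, axis i (exp (h2 i p) * g2 i p)))"
      using OT_phi_apply[of C "f p" "fst (g p)" "snd (g p)"]
      by (simp add: sum_prod h2_def g2_def sum_axis del: Re_complex_of_real times_complex.sel)
    then show ?thesis
      by (simp add: l1_def l2_def linear_add linear_sum bounded_linear.linear[OF l])
  qed
  then show ?thesis
    by (simp only:) (intro exp_affine.addI exp_affine_sum finite 1 2)
qed

lemma OT_phi_0: "OT_phi C 0 y = y"
  by (cases y) (simp add: OT_phi_apply)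

lemma OT_phi_add: "OT_phi C (x + x') y = OT_phi C x (OT_phi C x' y)"
  by (cases y) (simp add: OT_phi_apply exp_add distrib_left sum.distrib mult.assoc)

lemma OT_phi_add_right: "OT_phi C x (y + y') = OT_phi C x y + OT_phi C x y'"
  by (cases y; cases y') (simp add: OT_phi_apply distrib_left vec_eq_iff)

lemma group_OT_group: "group (OT_group C)"
proof (rule groupI)
  fix g assume "g \<in> carrier (OT_group C)"
  obtain x y where g: "g = (x, y)" by (cases g)
  have "(- x, OT_phi C (- x) (- y)) \<otimes>\<^bsub>OT_group C\<^esub> g = \<one>\<^bsub>OT_group C\<^esub>"
    using OT_phi_add_right[of C "- x" "- y" y] OT_phi_add_right[of C "- x" 0 0]
    by (simp add: g OT_group_def zero_prod_def)
  then show "\<exists>h\<in>carrier (OT_group C). h \<otimes>\<^bsub>OT_group C\<^esub> g = \<one>\<^bsub>OT_group C\<^esub>"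
    by (rule bexI) (simp add: OT_group_def)
qed (auto simp: OT_group_def OT_phi_0 OT_phi_add OT_phi_add_right zero_prod_def add.assoc)

lemma inv_OT_group: "inv\<^bsub>OT_group C\<^esub> (x, y) = (- x, OT_phi C (- x) (- y))"
proof (rule group.inv_equality[OF group_OT_group])
  show "(- x, OT_phi C (- x) (- y)) \<otimes>\<^bsub>OT_group C\<^esub> (x, y) = \<one>\<^bsub>OT_group C\<^esub>"
    using OT_phi_add_right[of C "- x" "- y" y] OT_phi_add_right[of C "- x" 0 0]
    by (simp add: OT_group_def zero_prod_def)
qed (simp_all add: OT_group_def)

lemma prod_euclidean_manifold:
  "prod_manifold euclidean_manifold euclidean_manifold = euclidean_manifold"
  by (auto simp: prod_manifold_def euclidean_manifold_def euclidean_product_topology)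

lemma smooth_manifold_euclidean: "smooth_manifold (euclidean_manifold :: ('e::euclidean_space, 'e) manifold)"
proof -
  have "smooth_on UNIV (\<lambda>x :: 'e. x)"
    using exp_affine_smooth_on[OF exp_affine.affineI[OF bounded_linear_ident, of 0]] by simp
  moreover have "second_countable (euclidean :: 'e topology)"
  proof -
    obtain B :: "'e set set" where "countable B" "\<And>S. S \<in> B \<Longrightarrow> open S"
      and B: "\<And>S. open S \<Longrightarrow> \<exists>U. U \<subseteq> B \<and> S = \<Union>U"
      using univ_second_countable by blast
    moreover have "\<exists>V\<in>B. x \<in> V \<and> V \<subseteq> S" if "open S" "x \<in> S" for S x
      using B[OF that(1)] that(2) by blast
    ultimately show ?thesis
      unfolding second_countable_def by (intro exI[of _ B]) simp
  qed
  moreover have "inv_into UNIV (id :: 'e \<Rightarrow> 'e) = id"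
    by (simp add: inv_id)
  moreover have "homeomorphic_map euclidean euclidean (\<lambda>x :: 'e. x)"
    by (simp add: homeomorphic_map_def quotient_map_def)
  ultimately show ?thesis
    by (simp add: smooth_manifold_def euclidean_manifold_def id_def o_def)
qed

lemma smooth_map_euclidean: "smooth_map euclidean_manifold euclidean_manifold f" if "smooth_on UNIV f"
proof -
  have "continuous_on UNIV f"
    using that by (metis Ck_on.simps(1) smooth_on_def)
  with that show ?thesis
    by (simp add: smooth_map_def euclidean_manifold_def inv_id)
qed

lemma is_lie_group_OT_group:
  fixes C :: "complex^'s::finite^'t::finite"
  shows "is_lie_group (OT_group C)"
proof -
  let ?G = "OT_group C"
  have bl: "bounded_linear (\<lambda>y :: (real^'s) \<times> (complex^'t). (0 :: real^'s, y))"
    by (intro bounded_linear_Pair bounded_linear_zero bounded_linear_ident)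
  have "exp_affine (\<lambda>p. l p + 0 + (0, OT_phi C (f p) (g p)))"
    if "bounded_linear l" "bounded_linear f" "bounded_linear g"
    for l :: "'e::euclidean_space \<Rightarrow> (real^'s) \<times> (real^'s) \<times> (complex^'t)" and f g
    using exp_affine.addI[OF exp_affine.affineI[OF that(1)] exp_affine_OT_phi[OF that(2,3) bl]] .
  note smooth = exp_affine_smooth_on[OF this]
  have "smooth_on UNIV (\<lambda>p. (fst (fst p) + fst (snd p), snd (fst p)) + 0 +
      (0, OT_phi C (fst (fst p)) (snd (snd p))))"
    by (intro smooth bounded_linear_Pair bounded_linear_add bounded_linear_compose[OF bounded_linear_fst]
        bounded_linear_compose[OF bounded_linear_snd] bounded_linear_fst bounded_linear_snd)
  moreover have "(\<lambda>p. (fst (fst p) + fst (snd p), snd (fst p)) + 0 +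
      (0, OT_phi C (fst (fst p)) (snd (snd p)))) = (\<lambda>(x, y). x \<otimes>\<^bsub>?G\<^esub> y)"
    by (auto simp: OT_group_def fun_eq_iff)
  ultimately have mult: "smooth_on UNIV (\<lambda>(x, y). x \<otimes>\<^bsub>?G\<^esub> y)"
    by (simp only:)
  have "smooth_on UNIV (\<lambda>p. (- fst p, 0) + 0 + (0, OT_phi C (- fst p) (- snd p)))"
    by (intro smooth bounded_linear_Pair bounded_linear_minus bounded_linear_zero
        bounded_linear_fst bounded_linear_snd)
  moreover have "(\<lambda>p. (- fst p, 0) + 0 + (0, OT_phi C (- fst p) (- snd p))) =
      (\<lambda>x. inv\<^bsub>?G\<^esub> x)"
    by (auto simp: inv_OT_group fun_eq_iff)
  ultimately have inv: "smooth_on UNIV (\<lambda>x. inv\<^bsub>?G\<^esub> x)"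
    by (simp only:)
  have "carrier ?G = UNIV" "mfd ?G = euclidean_manifold"
    "topspace (mtop (euclidean_manifold :: ('e::euclidean_space, 'e) manifold)) = UNIV"
    by (simp_all add: OT_group_def euclidean_manifold_def)
  then show ?thesis
    unfolding is_lie_group_def
    using group_OT_group[of C] smooth_manifold_euclidean smooth_map_euclidean[OF mult]
      smooth_map_euclidean[OF inv]
    by (simp only: prod_euclidean_manifold simp_thms)
qed

definition OT_like ::
  "'s::finite itself \<Rightarrow> 't::finite itself \<Rightarrow> ('g, 'e::euclidean_space) lie_group \<Rightarrow> bool" where
  "OT_like _ _ G \<longleftrightarrow> is_lie_group G \<and>
     (\<exists>C :: complex^'s^'t. OT_matrix C \<and> lie_isomorphic G (OT_group C))"


section \<open>Number fields\<close>

text \<open>Every number field is isomorphic to a subfield of the complex numbers, so number fields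
  are taken to be subfields of the complex numbers of finite degree over the rationals.
  The embeddings of \<open>K\<close> are abstract field homomorphisms, unrelated to the inclusion.\<close>

interpretation rat_complex: vector_space "\<lambda>(q::rat) (z::complex). of_rat q * z"
  by unfold_locales (simp_all add: algebra_simps of_rat_add of_rat_mult)

definition complex_subfield :: "complex set \<Rightarrow> bool" where
  "complex_subfield K \<longleftrightarrow> 0 \<in> K \<and> 1 \<in> K \<and>
     (\<forall>x\<in>K. \<forall>y\<in>K. x + y \<in> K \<and> x * y \<in> K) \<and> (\<forall>x\<in>K. - x \<in> K \<and> inverse x \<in> K)"

definition number_field :: "complex set \<Rightarrow> bool" where
  "number_field K \<longleftrightarrow> complex_subfield K \<and> (\<exists>B. finite B \<and> K \<subseteq> rat_complex.span B)"

definition field_adjoin_rat :: "complex set \<Rightarrow> complex set" where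
  "field_adjoin_rat U = \<Inter>{L. complex_subfield L \<and> U \<subseteq> L}"

definition embeddings :: "complex set \<Rightarrow> (complex \<Rightarrow> complex) set" where
  "embeddings K = {\<sigma> \<in> extensional K. \<sigma> 1 = 1 \<and>
     (\<forall>x\<in>K. \<forall>y\<in>K. \<sigma> (x + y) = \<sigma> x + \<sigma> y \<and> \<sigma> (x * y) = \<sigma> x * \<sigma> y)}"

text \<open>A labelling of the embeddings: \<open>\<sigma> (Inl j)\<close> is the \<open>j\<close>-th real embedding,
  \<open>\<sigma> (Inr (Inl i))\<close> is \<open>\<sigma>\<^sub>s\<^sub>+\<^sub>i\<close> and \<open>\<sigma> (Inr (Inr i))\<close> is \<open>\<sigma>\<^sub>s\<^sub>+\<^sub>t\<^sub>+\<^sub>i\<close>. As \<open>\<sigma>\<close> exhausts the embeddings,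
  there are exactly \<open>s\<close> real and \<open>2t\<close> non-real ones.\<close>

definition embedding_labelling ::
  "complex set \<Rightarrow> ('s::finite + 't::finite + 't \<Rightarrow> complex \<Rightarrow> complex) \<Rightarrow> bool" where
  "embedding_labelling K \<sigma> \<longleftrightarrow> bij_betw \<sigma> UNIV (embeddings K) \<and>
     (\<forall>j. \<sigma> (Inl j) ` K \<subseteq> \<real>) \<and>
     (\<forall>i. \<not> \<sigma> (Inr i) ` K \<subseteq> \<real>) \<and>
     (\<forall>i. \<forall>x\<in>K. \<sigma> (Inr (Inl i)) x = cnj (\<sigma> (Inr (Inr i)) x))"

definition ring_of_integers :: "complex set \<Rightarrow> complex set" where
  "ring_of_integers K = {x \<in> K. algebraic_int x}"

definition positive_units ::
  "complex set \<Rightarrow> ('s::finite + 't::finite + 't \<Rightarrow> complex \<Rightarrow> complex) \<Rightarrow> complex set" where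
  "positive_units K \<sigma> =
     {u \<in> ring_of_integers K. u \<noteq> 0 \<and> inverse u \<in> ring_of_integers K \<and> (\<forall>j. Re (\<sigma> (Inl j) u) > 0)}"

definition mult_subgroup :: "complex set \<Rightarrow> bool" where
  "mult_subgroup U \<longleftrightarrow> 0 \<notin> U \<and> 1 \<in> U \<and> (\<forall>x\<in>U. \<forall>y\<in>U. x * y \<in> U) \<and> (\<forall>x\<in>U. inverse x \<in> U)"

definition mult_independent :: "complex set \<Rightarrow> bool" where
  "mult_independent A \<longleftrightarrow> (\<forall>F e. finite F \<and> F \<subseteq> A \<and> (\<Prod>a\<in>F. a powi e a) = 1 \<longrightarrow> (\<forall>a\<in>F. e a = 0))"

definition has_rank :: "complex set \<Rightarrow> nat \<Rightarrow> bool" where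
  "has_rank U r \<longleftrightarrow> (\<exists>A\<subseteq>U. finite A \<and> card A = r \<and> mult_independent A \<and>
     (\<forall>B\<subseteq>U. A \<subseteq> B \<and> mult_independent B \<longrightarrow> B = A))"

definition mult_basis :: "complex set \<Rightarrow> ('s::finite \<Rightarrow> complex) \<Rightarrow> bool" where
  "mult_basis U a \<longleftrightarrow> bij_betw (\<lambda>e :: 's \<Rightarrow> int. \<Prod>k\<in>UNIV. a k powi e k) UNIV U"


section \<open>OT manifolds\<close>

definition additive_group :: "'a::ab_group_add monoid" where
  "additive_group = \<lparr>carrier = UNIV, monoid.mult = (+), one = 0\<rparr>"

definition admissible ::
  "complex set \<Rightarrow> ('s::finite + 't::finite + 't \<Rightarrow> complex \<Rightarrow> complex) \<Rightarrow> complex set \<Rightarrow> bool" where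
  "admissible K \<sigma> U \<longleftrightarrow>
     mult_subgroup U \<and> U \<subseteq> positive_units K \<sigma> \<and> has_rank U CARD('s) \<and>
     is_lattice additive_group euclidean
       ((\<lambda>u. \<chi> j. ln (Re (\<sigma> (Inl j) u))) ` U :: (real^'s) set)"

definition half_plane_space :: "((complex^'s::finite) \<times> (complex^'t::finite)) set" where
  "half_plane_space = {(z, w). \<forall>j. Im (z $ j) > 0}"

text \<open>\<open>OT_act \<sigma> u a\<close> is multiplication by \<open>u\<close> followed by translation by \<open>a\<close>; these are the
  transformations by the elements of the semidirect product of \<open>U\<close> and the integers of \<open>K\<close>.\<close>

definition OT_act ::
  "('s::finite + 't::finite + 't \<Rightarrow> complex \<Rightarrow> complex) \<Rightarrow> complex \<Rightarrow> complex \<Rightarrow>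
     (complex^'s) \<times> (complex^'t) \<Rightarrow> (complex^'s) \<times> (complex^'t)" where
  "OT_act \<sigma> u a = (\<lambda>(z, w).
     (\<chi> j. \<sigma> (Inl j) u * z $ j + \<sigma> (Inl j) a,
      \<chi> i. \<sigma> (Inr (Inl i)) u * w $ i + \<sigma> (Inr (Inl i)) a))"

text \<open>The points of the OT manifold are the orbits. Only the topology is recorded: the
  complex structure descends from the ambient one and is not referred to below.\<close>

definition OT_quotient ::
  "complex set \<Rightarrow> ('s::finite + 't::finite + 't \<Rightarrow> complex \<Rightarrow> complex) \<Rightarrow> complex set \<Rightarrow>
     ((complex^'s) \<times> (complex^'t)) set topology" where
  "OT_quotient K \<sigma> U = quotient_topology (top_of_set half_plane_space)
     (\<lambda>p. {OT_act \<sigma> u a p | u a. u \<in> U \<and> a \<in> ring_of_integers K})"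

text \<open>\<open>OT_manifold K U X\<close>: \<open>U\<close> is admissible and \<open>X\<close> is the OT manifold \<open>X(K,U)\<close> of type \<open>(s,t)\<close>.\<close>

definition OT_manifold ::
  "complex set \<Rightarrow> complex set \<Rightarrow> ((complex^'s::finite) \<times> (complex^'t::finite)) set topology \<Rightarrow> bool"
  where
  "OT_manifold K U X \<longleftrightarrow> number_field K \<and> rat_complex.dim K = CARD('s) + 2 * CARD('t) \<and>
     (\<exists>\<sigma> :: 's + 't + 't \<Rightarrow> complex \<Rightarrow> complex.
        embedding_labelling K \<sigma> \<and> admissible K \<sigma> U \<and> X = OT_quotient K \<sigma> U)"

definition OT_simple_type :: "complex set \<Rightarrow> complex set \<Rightarrow> bool" where
  "OT_simple_type K U \<longleftrightarrow> field_adjoin_rat U = K"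

definition associated_to_OT ::
  "'s::finite itself \<Rightarrow> 't::finite itself \<Rightarrow> ('g, 'e::euclidean_space) lie_group \<Rightarrow>
     complex set \<Rightarrow> complex set \<Rightarrow> bool" where
  "associated_to_OT _ _ G K U \<longleftrightarrow>
     (\<exists>(\<sigma> :: 's + 't + 't \<Rightarrow> complex \<Rightarrow> complex) (a :: 's \<Rightarrow> complex) (C :: complex^'s^'t).
        embedding_labelling K \<sigma> \<and> mult_basis U a \<and>
        (\<forall>i k. \<sigma> (Inr (Inl i)) (a k) =
           exp (\<Sum>j\<in>UNIV. C $ i $ j * of_real (ln (Re (\<sigma> (Inl j) (a k)))))) \<and>
        lie_isomorphic G (OT_group C))"

end

theory Submission
  imports Defs
begin

text \<open>Transport the lattice to \<open>G\<^sub>C\<close>; let \<open>P\<close> be its projection to the base \<open>\<real>\<^sup>s\<close> and \<open>\<Gamma>\<^sub>0\<close> its intersection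
  with the nilradical \<open>N\<close>. A commutator estimate shows \<open>(\<phi>(x) - 1) N \<subseteq> V\<close> for \<open>x \<in> P\<close>, where \<open>V\<close> is the real
  span of \<open>\<Gamma>\<^sub>0\<close>. Hence \<open>V\<close> contains the summand \<open>\<real>\<^sup>s\<close> of \<open>N\<close>, on which \<open>P\<close> acts faithfully; as \<open>P\<close> preserves
  the discrete group \<open>\<Gamma>\<^sub>0\<close>, it is itself discrete, so \<open>P\<close> and \<open>\<Gamma>\<^sub>0\<close> are lattices in \<open>\<real>\<^sup>s\<close> and \<open>N\<close>.

  In the \<open>s + 2t\<close> complex coordinates \<open>(v, w, cnj w)\<close> of \<open>N\<close> the base acts by characters. The rational
  span \<open>R\<close> of the characters of the elements of \<open>P\<close> is a ring under the coordinatewise product, and by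
  irreducibility \<open>R * e\<close> is the whole rational span of \<open>\<Gamma>\<^sub>0\<close> for each of its nonzero elements \<open>e\<close>. So \<open>R\<close>
  is a field of degree \<open>s + 2t\<close>, and its coordinates are its complex embeddings. The characters of the
  elements of \<open>P\<close> generate \<open>R\<close> and are units, because they are eigenvalues on the lattice \<open>\<Gamma>\<^sub>0\<close>.\<close>

section \<open>Discrete subgroups of Euclidean spaces\<close>

text \<open>The obstacle is that a discrete group may have a non-discrete image in a quotient, so a
  priori \<open>base\<close> could be dense. Commutators get around this because they lie in the
  fibre whatever the size of their factors. At that stage a complex eigenvalue of the action might
  still equal 1, so only the real axes are known to lie in the span. They suffice, because
  \<open>exp (x $ j) = 1\<close> forces \<open>x $ j = 0\<close>. Full rank of the fibre is obtained
  only once \<open>base\<close> is known to be discrete. The field is Schur's lemma made explicit.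
  The action is diagonal in the complex coordinates, so its operators commute, and a fixed nonzero
  vector \<open>gen\<close> identifies the ring of operators with the module. The degree of the
  field is then the rank of the fibre lattice, and the matrix \<open>C\<close> of the group itself
  serves as the exponent matrix for the OT manifold.\<close>

locale discrete_subgroup =
  fixes S :: "'a::euclidean_space set"
  assumes zero: "0 \<in> S"
    and diff: "x \<in> S \<Longrightarrow> y \<in> S \<Longrightarrow> x - y \<in> S"
    and discrete: "\<exists>e>0. \<forall>x\<in>S. norm x < e \<longrightarrow> x = 0"
begin

lemma minus: "x \<in> S \<Longrightarrow> - x \<in> S"
  using diff[OF zero] by force

lemma add: "x \<in> S \<Longrightarrow> y \<in> S \<Longrightarrow> x + y \<in> S"
  using diff[of x "- y"] minus by force

lemma of_int_scaleR: "x \<in> S \<Longrightarrow> of_int k *\<^sub>R x \<in> S"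
proof (induction k)
  case (nonneg n) then show ?case
    by (induction n) (auto simp: zero scaleR_left_distrib intro: add)
next
  case (neg n)
  have "of_nat m *\<^sub>R x \<in> S" for m :: nat
    using neg by (induction m) (auto simp: zero scaleR_left_distrib intro: add)
  then have "- (of_nat (Suc n) *\<^sub>R x) \<in> S" by (rule minus)
  then show ?case by (simp add: algebra_simps)
qed

lemma int_comb: "finite B \<Longrightarrow> B \<subseteq> S \<Longrightarrow> (\<Sum>b\<in>B. of_int (n b) *\<^sub>R b) \<in> S"
  by (induction B rule: finite_induct) (auto simp: zero intro: add of_int_scaleR)

text \<open>Differences turn the gap around 0 into a uniform gap between any two points, and a
  bounded uniformly discrete set in a Euclidean space is finite.\<close>

lemma finite_cball: "finite (S \<inter> cball 0 r)"
proof -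
  obtain e where "e > 0" "\<And>x. x \<in> S \<Longrightarrow> norm x < e \<Longrightarrow> x = 0"
    using discrete by blast
  then have "uniform_discrete S"
    unfolding uniform_discrete_def using diff by (metis dist_norm right_minus_eq)
  then have "uniform_discrete (S \<inter> cball 0 r)"
    by (rule uniform_discrete_subset) simp
  then show ?thesis
    using uniform_discrete_finite_iff by blast
qed

text \<open>Rounding coordinates down leaves a vector with coordinates in [0, 1) with respect to
  \<open>B\<close>, hence in a fixed bounded region.\<close>

lemma reduce:
  assumes "finite B" "independent B" "B \<subseteq> S" "v \<in> S" "v \<in> span B"
  shows "\<exists>n::'a \<Rightarrow> int. v - (\<Sum>b\<in>B. of_int (n b) *\<^sub>R b) \<in> S \<inter> cball 0 (\<Sum>b\<in>B. norm b)"
proof -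
  define r where "r = representation B v"
  have v: "v = (\<Sum>b\<in>B. r b *\<^sub>R b)"
    using assms by (simp add: r_def real_vector.sum_representation_eq)
  have "v - (\<Sum>b\<in>B. of_int \<lfloor>r b\<rfloor> *\<^sub>R b) = (\<Sum>b\<in>B. frac (r b) *\<^sub>R b)"
    by (subst v) (simp add: frac_def scaleR_left_diff_distrib sum_subtractf)
  also have "norm \<dots> \<le> (\<Sum>b\<in>B. norm b)"
    by (intro order_trans[OF norm_sum] sum_mono)
      (simp add: mult_left_le_one_le less_imp_le[OF frac_lt_1])
  finally show ?thesis
    using assms by (intro exI[of _ "\<lambda>b. \<lfloor>r b\<rfloor>"]) (simp add: diff int_comb)
qed

text \<open>The reduced vectors lie in a finite set, so two of them with index above
  \<open>m\<close> coincide. The free bound \<open>m\<close> is what later makes the resulting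
  relation monic in its largest index.\<close>

lemma pigeonhole:
  assumes B: "finite B" "independent B" "B \<subseteq> S" and v: "\<And>k::nat. v k \<in> S" "\<And>k. v k \<in> span B"
  shows "\<exists>k l n. m < l \<and> l < k \<and> v k - v l = (\<Sum>b\<in>B. of_int (n b :: int) *\<^sub>R b)"
proof -
  let ?F = "S \<inter> cball 0 (\<Sum>b\<in>B. norm b)"
  obtain n :: "nat \<Rightarrow> 'a \<Rightarrow> int" where n: "\<And>k. v k - (\<Sum>b\<in>B. of_int (n k b) *\<^sub>R b) \<in> ?F"
    using choice[of "\<lambda>k n. v k - (\<Sum>b\<in>B. of_int (n b) *\<^sub>R b) \<in> ?F"] reduce[OF B v] by blast
  define h where "h k = v k - (\<Sum>b\<in>B. of_int (n k b) *\<^sub>R b)" for k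
  have "h ` {m<..} \<subseteq> ?F" using n by (auto simp: h_def)
  then have "finite (h ` {m<..})" using finite_cball finite_subset by blast
  then have "\<not> inj_on h {m<..}" using finite_imageD infinite_Ioi by blast
  then obtain k l where "m < k" "m < l" "k \<noteq> l" "h k = h l"
    by (auto simp: inj_on_def)
  then obtain k l where kl: "m < l" "l < k" "h k = h l" by (metis linorder_neqE_nat)
  then have "v k - v l = (\<Sum>b\<in>B. of_int (n k b - n l b) *\<^sub>R b)"
    by (simp add: h_def scaleR_left_diff_distrib sum_subtractf algebra_simps)
  then show ?thesis
    using kl by (intro exI[of _ k] exI[of _ l] exI[of _ "\<lambda>b. n k b - n l b"]) blast
qed

text \<open>The pigeonhole is applied to the multiples of \<open>s\<close>; the difference of the
  two indices is the denominator.\<close>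

lemma multiple_int_comb:
  assumes B: "finite B" "independent B" "B \<subseteq> S" and s: "s \<in> S" "s \<in> span B"
  shows "\<exists>(m::nat) n. 0 < m \<and> of_nat m *\<^sub>R s = (\<Sum>b\<in>B. of_int (n b :: int) *\<^sub>R b)"
proof -
  have "of_nat k *\<^sub>R s \<in> S" "of_nat k *\<^sub>R s \<in> span B" for k
    using of_int_scaleR[OF s(1), of "int k"] s(2) by (auto intro: span_scale)
  from pigeonhole[OF B this, of 0] obtain k l and n :: "'a \<Rightarrow> int" where
    "l < k" "of_nat k *\<^sub>R s - of_nat l *\<^sub>R s = (\<Sum>b\<in>B. of_int (n b) *\<^sub>R b)" by blast
  then show ?thesis
    by (intro exI[of _ "k - l"] exI[of _ n]) (simp add: of_nat_diff scaleR_left_diff_distrib)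
qed

text \<open>Modulo integer combinations of \<open>B\<close> only the finitely many points of
  \<open>F\<close> occur, so the product of their denominators works uniformly.\<close>

lemma common_denominator:
  assumes B: "finite B" "independent B" "B \<subseteq> S" "S \<subseteq> span B"
  shows "\<exists>m::nat. 0 < m \<and> (\<forall>s\<in>S. \<exists>n. of_nat m *\<^sub>R s = (\<Sum>b\<in>B. of_int (n b :: int) *\<^sub>R b))"
proof -
  define F where "F = S \<inter> cball 0 (\<Sum>b\<in>B. norm b)"
  have "\<forall>f\<in>F. \<exists>m. 0 < m \<and> (\<exists>n. of_nat m *\<^sub>R f = (\<Sum>b\<in>B. of_int (n b :: int) *\<^sub>R b))"
    using multiple_int_comb[OF B(1-3)] B(4) unfolding F_def by blast
  from bchoice[OF this] obtain m :: "'a \<Rightarrow> nat" where m: "\<And>f. f \<in> F \<Longrightarrow> 0 < m f"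
      "\<And>f. f \<in> F \<Longrightarrow> \<exists>n. of_nat (m f) *\<^sub>R f = (\<Sum>b\<in>B. of_int (n b :: int) *\<^sub>R b)"
    by blast
  have fin: "finite F" unfolding F_def by (rule finite_cball)
  define M where "M = (\<Prod>f\<in>F. m f)"
  have "\<exists>n. of_nat M *\<^sub>R s = (\<Sum>b\<in>B. of_int (n b :: int) *\<^sub>R b)" if "s \<in> S" for s
  proof -
    obtain k :: "'a \<Rightarrow> int" where k: "s - (\<Sum>b\<in>B. of_int (k b) *\<^sub>R b) \<in> F"
      using reduce[OF B(1-3) \<open>s \<in> S\<close>] B(4) \<open>s \<in> S\<close> unfolding F_def by blast
    define f where "f = s - (\<Sum>b\<in>B. of_int (k b) *\<^sub>R b)"
    have "m f dvd M"
      unfolding M_def using k fin by (intro dvd_prodI) (auto simp: f_def)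
    then obtain q where q: "M = m f * q" by (elim dvdE)
    obtain n :: "'a \<Rightarrow> int" where n: "of_nat (m f) *\<^sub>R f = (\<Sum>b\<in>B. of_int (n b) *\<^sub>R b)"
      using m(2)[of f] k unfolding f_def by blast
    have "of_nat M *\<^sub>R s = of_nat q *\<^sub>R (of_nat (m f) *\<^sub>R f) + of_nat M *\<^sub>R (\<Sum>b\<in>B. of_int (k b) *\<^sub>R b)"
      by (simp add: q f_def algebra_simps)
    also have "\<dots> = (\<Sum>b\<in>B. of_int (int q * n b + int M * k b) *\<^sub>R b)"
      by (simp add: n scaleR_sum_right scaleR_left_distrib sum.distrib)
    finally show ?thesis by (intro exI[of _ "\<lambda>b. int q * n b + int M * k b"])
  qed
  moreover have "0 < M" using m(1) by (auto simp: M_def intro: prod_pos)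
  ultimately show ?thesis by blast
qed

end

section \<open>Integral bases of discrete subgroups of full rank\<close>

lemma vector_matrix_mult_rows:
  fixes c :: "'n::finite \<Rightarrow> real^'n"
  shows "r v* (\<chi> k. c k) = (\<Sum>k\<in>UNIV. r $ k *\<^sub>R c k)"
  by (simp add: vec_eq_iff vector_matrix_mult_def mult.commute)

lemma combinations_of_rows_det_neq_0:
  fixes c :: "'n::finite \<Rightarrow> real^'n"
  assumes "det (\<chi> k. c k) \<noteq> 0"
  shows "\<exists>r. v = (\<Sum>k\<in>UNIV. r k *\<^sub>R c k)"
    and "(\<Sum>k\<in>UNIV. r k *\<^sub>R c k) = 0 \<Longrightarrow> r k = 0"
proof -
  obtain B where B: "(\<chi> k. c k) ** B = mat 1" "B ** (\<chi> k. c k) = mat 1"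
    using assms by (auto simp: invertible_det_nz[symmetric] invertible_def)
  have "v = (v v* B) v* (\<chi> k. c k)"
    by (simp add: B vector_matrix_mul_assoc)
  then show "\<exists>r. v = (\<Sum>k\<in>UNIV. r k *\<^sub>R c k)"
    unfolding vector_matrix_mult_rows by blast
  assume "(\<Sum>k\<in>UNIV. r k *\<^sub>R c k) = 0"
  then have "(\<chi> k. r k) v* (\<chi> k. c k) = 0"
    by (simp add: vector_matrix_mult_rows)
  then have "((\<chi> k. r k) v* (\<chi> k. c k)) v* B = 0" by simp
  then have "(\<chi> k. r k) = 0"
    by (simp add: B vector_matrix_mul_assoc)
  then show "r k = 0" by (simp add: vec_eq_iff)
qed

lemma det_in_Ints:
  fixes A :: "real^'n::finite^'n"
  assumes "\<And>i j. A $ i $ j \<in> \<int>"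
  shows "det A \<in> \<int>"
  unfolding det_def by (intro Ints_sum Ints_mult Ints_prod assms) auto

text \<open>A family in \<open>S\<close> with nonzero determinant of minimal absolute value is a basis: otherwise
  exchanging a member would multiply the determinant by a fractional part.\<close>

lemma lattice_basis_exists:
  fixes S :: "(real^'n::finite) set"
  assumes "discrete_subgroup S" and span: "span S = UNIV"
  shows "\<exists>c :: 'n \<Rightarrow> real^'n. range c \<subseteq> S \<and> det (\<chi> k. c k) \<noteq> 0 \<and>
    (\<forall>x\<in>S. \<exists>e :: 'n \<Rightarrow> int. x = (\<Sum>k\<in>UNIV. of_int (e k) *\<^sub>R c k))"
proof -
  interpret discrete_subgroup S by fact
  obtain B where B: "B \<subseteq> S" "independent B" "S \<subseteq> span B"
    using maximal_independent_subset by blast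
  have fin: "finite B" using B(2) independent_imp_finite by blast
  have spanB: "span B = UNIV"
    using B(1,3) span by (metis span_mono span_span top.extremum_uniqueI)
  then have "card B = CARD('n)"
    using B(2) by (metis basis_card_eq_dim dim_UNIV DIM_cart DIM_real mult.right_neutral subset_UNIV)
  then obtain b where b: "bij_betw b (UNIV :: 'n set) B"
    using fin finite_same_card_bij[of "UNIV :: 'n set" B] by auto
  define A where "A = (\<chi> k. b k)"
  have sumB: "(\<Sum>x\<in>B. g x *\<^sub>R x) = (\<Sum>k\<in>UNIV. g (b k) *\<^sub>R b k)" for g :: "real^'n \<Rightarrow> real"
    using sum.reindex_bij_betw[OF b, of "\<lambda>x. g x *\<^sub>R x"] by simp
  have "surj (\<lambda>r. transpose A *v r)"
  proof -
    have "\<exists>r. transpose A *v r = v" for v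
    proof -
      have "v = (\<Sum>k\<in>UNIV. representation B v (b k) *\<^sub>R b k)"
        using fin B(2) spanB by (simp add: real_vector.sum_representation_eq flip: sumB)
      then show ?thesis
        using vector_matrix_mult_rows[of "\<chi> k. representation B v (b k)" b]
        by (intro exI[of _ "\<chi> k. representation B v (b k)"]) (simp add: A_def)
    qed
    then show ?thesis by (metis surjI)
  qed
  then have detA: "det A \<noteq> 0"
    by (metis det_transpose invertible_det_nz invertible_right_inverse matrix_right_invertible_surjective)
  obtain M where M: "0 < M" "\<And>s. s \<in> S \<Longrightarrow> \<exists>n. of_nat M *\<^sub>R s = (\<Sum>b\<in>B. of_int (n b :: int) *\<^sub>R b)"
    using common_denominator[OF fin B(2,1,3)] by blast
  \<comment> \<open>After scaling by the common denominator \<open>M\<close> each row has integer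
    coordinates in \<open>B\<close>. So the determinants of families in \<open>S\<close> take values
    in a discrete set, and a minimal nonzero absolute value exists.\<close>
  have int: "real M ^ CARD('n) * det (\<chi> k. c k) / det A \<in> \<int>" if "range c \<subseteq> S" for c
  proof -
    have "\<forall>k. \<exists>n. of_nat M *\<^sub>R c k = (\<Sum>b\<in>B. of_int (n b :: int) *\<^sub>R b)"
      using M(2) that by blast
    from choice[OF this]
    obtain n :: "'n \<Rightarrow> real^'n \<Rightarrow> int" where n: "\<And>k. of_nat M *\<^sub>R c k = (\<Sum>b\<in>B. of_int (n k b) *\<^sub>R b)"
      by blast
    define R :: "real^'n^'n" where "R = (\<chi> i k. of_int (n i (b k)))"
    have "(\<chi> i. of_nat M *s c i) = R ** A"
      by (simp add: vec_eq_iff scalar_mult_eq_scaleR n sumB matrix_matrix_mult_def R_def A_def)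
    then have "real M ^ CARD('n) * det (\<chi> k. c k) = det R * det A"
      using det_rows_mul[of "\<lambda>_. real M" c] by (simp add: det_mul)
    moreover have "det R \<in> \<int>"
      by (rule det_in_Ints) (simp add: R_def)
    ultimately show ?thesis using detA by simp
  qed
  define \<mu> where "\<mu> c = nat \<lfloor>\<bar>real M ^ CARD('n) * det (\<chi> k. c k) / det A\<bar>\<rfloor>" for c :: "'n \<Rightarrow> real^'n"
  have \<mu>: "real (\<mu> c) = \<bar>real M ^ CARD('n) * det (\<chi> k. c k) / det A\<bar>" if "range c \<subseteq> S" for c
    using int[OF that] unfolding \<mu>_def
    by (metis Ints_abs Ints_cases abs_ge_zero floor_of_int of_int_0_le_iff of_nat_nat)
  have "range b \<subseteq> S \<and> det (\<chi> k. b k) \<noteq> 0"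
    using b B(1) detA by (auto simp: bij_betw_def A_def)
  then obtain c where c: "range c \<subseteq> S" "det (\<chi> k. c k) \<noteq> 0"
    and min: "\<And>d. range d \<subseteq> S \<Longrightarrow> det (\<chi> k. d k) \<noteq> 0 \<Longrightarrow> \<mu> c \<le> \<mu> d"
    using ex_has_least_nat[of "\<lambda>c. range c \<subseteq> S \<and> det (\<chi> k. c k) \<noteq> 0" b \<mu>] by metis
  have "\<exists>e :: 'n \<Rightarrow> int. x = (\<Sum>k\<in>UNIV. of_int (e k) *\<^sub>R c k)" if x: "x \<in> S" for x
  proof -
    obtain r where r: "x = (\<Sum>k\<in>UNIV. r k *\<^sub>R c k)"
      using combinations_of_rows_det_neq_0(1)[OF c(2)] by blast
    have "r k \<in> \<int>" for k
    proof (rule ccontr)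
      assume nint: "r k \<notin> \<int>"
      define y where "y = x - of_int \<lfloor>r k\<rfloor> *\<^sub>R c k"
      define d where "d = c(k := y)"
      \<comment> \<open>\<open>q\<close> lists the coordinates of \<open>y\<close> with respect to
        \<open>c\<close>: those of \<open>x\<close> except at \<open>k\<close>. Replacing row
        \<open>k\<close> by a combination of the rows multiplies the determinant by the coefficient
        at \<open>k\<close>.\<close>
      define q :: "real^'n" where "q = (\<chi> i. if i = k then frac (r k) else r i)"
      have "y = (\<Sum>i\<in>UNIV. q $ i *\<^sub>R c i)"
        unfolding y_def q_def r
        by (subst (1 2) sum.remove[of _ k]) (auto simp: frac_def algebra_simps)
      then have "(\<chi> i. d i) = (\<chi> i. if i = k then sum (\<lambda>i. q $ i *s row i (\<chi> k. c k)) UNIV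
          else row i (\<chi> k. c k))"
        by (simp add: d_def vec_eq_iff row_def scalar_mult_eq_scaleR vec_lambda_eta)
      then have det: "det (\<chi> i. d i) = frac (r k) * det (\<chi> k. c k)"
        by (simp add: cramer_lemma_transpose) (simp add: q_def)
      have "range d \<subseteq> S"
        using c(1) x by (auto simp: d_def y_def intro!: diff of_int_scaleR)
      moreover have "frac (r k) > 0" "frac (r k) < 1"
        using nint frac_gt_0_iff frac_lt_1 by auto
      ultimately have "real (\<mu> d) = frac (r k) * real (\<mu> c)" "\<mu> c \<le> \<mu> d"
        using \<mu>[of d] \<mu>[OF c(1)] min[of d] c(2) by (auto simp: det abs_mult)
      moreover have "real (\<mu> c) > 0" using \<mu>[OF c(1)] c(2) M(1) detA by simp
      ultimately show False
        using \<open>frac (r k) < 1\<close> by (metis mult_less_cancel_right_pos mult_1 not_less of_nat_le_iff)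
    qed
    then have "of_int \<lfloor>r k\<rfloor> = r k" for k by (auto simp: Ints_def)
    then have "x = (\<Sum>k\<in>UNIV. of_int \<lfloor>r k\<rfloor> *\<^sub>R c k)"
      by (simp only: r)
    then show ?thesis by (rule exI[of _ "\<lambda>k. \<lfloor>r k\<rfloor>"])
  qed
  then show ?thesis using c by blast
qed

section \<open>The action of the base on the fibre\<close>

lemma linear_OT_phi: "linear (OT_phi C x)"
  by (rule linearI) (auto simp: OT_phi_apply vec_eq_iff scaleR_prod_def algebra_simps split: prod.splits)

lemma continuous_on_OT_phi:
  fixes C :: "complex^'s::finite^'t::finite"
  assumes "continuous_on A f" "continuous_on A g"
  shows "continuous_on A (\<lambda>p. OT_phi C (f p) (g p))"
proof -
  have "smooth_on UNIV (\<lambda>p. OT_phi C (fst p) (snd p))"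
    by (intro exp_affine_smooth_on exp_affine_OT_phi bounded_linear_fst bounded_linear_snd bounded_linear_ident)
  then have "Ck_on 0 UNIV (\<lambda>p. OT_phi C (fst p) (snd p))"
    unfolding smooth_on_def by blast
  then have "continuous_on UNIV (\<lambda>p. OT_phi C (fst p) (snd p))"
    by simp
  from continuous_on_compose2[OF this continuous_on_Pair[OF assms]] show ?thesis by simp
qed

lemma OT_phi_bounded:
  fixes C :: "complex^'s::finite^'t::finite"
  shows "\<exists>B. \<forall>x y. norm x \<le> r \<longrightarrow> norm y \<le> r \<longrightarrow> norm (OT_phi C x y) \<le> B"
proof -
  have "compact ((\<lambda>p. OT_phi C (fst p) (snd p)) ` (cball 0 r \<times> cball 0 r))"
    by (intro compact_continuous_image continuous_on_OT_phi continuous_intros compact_Times compact_cball)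
  then have "bounded ((\<lambda>p. OT_phi C (fst p) (snd p)) ` (cball 0 r \<times> cball 0 r))"
    by (rule compact_imp_bounded)
  then obtain B where B: "\<And>z. z \<in> (\<lambda>p. OT_phi C (fst p) (snd p)) ` (cball 0 r \<times> cball 0 r) \<Longrightarrow> norm z \<le> B"
    unfolding bounded_iff by blast
  have "norm (OT_phi C x y) \<le> B" if "norm x \<le> r" "norm y \<le> r" for x y
    by (rule B) (use that in \<open>force intro: image_eqI[of _ _ "(x, y)"]\<close>)
  then show ?thesis by blast
qed

text \<open>The bound at the \<open>n\<close>-fold multiple of \<open>v\<close>, divided by
  \<open>n\<close>, brings \<open>T v\<close> within \<open>B / n\<close> of \<open>V\<close> for
  every \<open>n\<close>, and a subspace of a Euclidean space is closed.\<close>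

lemma linear_bounded_mod_subspace:
  fixes T :: "'a::real_normed_vector \<Rightarrow> 'b::euclidean_space"
  assumes "linear T" "subspace V" and B: "\<And>v. \<exists>w\<in>V. norm (T v - w) \<le> B"
  shows "T v \<in> V"
proof -
  have "\<exists>w\<in>V. dist w (T v) < e" if "e > 0" for e
  proof -
    obtain m :: nat where "B < real m * e"
      using reals_Archimedean3 \<open>e > 0\<close> by blast
    also have "\<dots> \<le> real (Suc m) * e" using \<open>e > 0\<close> by simp
    finally obtain n :: nat where n: "n > 0" "B < real n * e" by blast
    obtain w where w: "w \<in> V" "norm (T (real n *\<^sub>R v) - w) \<le> B" using B by blast
    have "dist (w /\<^sub>R real n) (T v) = norm (T (real n *\<^sub>R v) - w) / real n"
    proof -
      have "T (real n *\<^sub>R v) - w = real n *\<^sub>R (T v - w /\<^sub>R real n)"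
        using n by (simp add: linear_scale[OF assms(1)] scaleR_diff_right)
      then show ?thesis using n by (simp add: dist_norm norm_minus_commute)
    qed
    also have "\<dots> < e"
      using w n by (simp add: field_simps)
    finally show ?thesis
      using assms(2) w(1) by (meson subspace_scale)
  qed
  then show ?thesis
    using closed_approachable closed_subspace[OF assms(2)] by metis
qed

text \<open>Compactness of the quotient enters as a bounded set of representatives, and discreteness
  as a gap around the identity, which is the vector \<open>0\<close>.\<close>

locale OT_lattice =
  fixes C :: "complex^'s::finite^'t::finite"
    and \<Gamma> :: "((real^'s) \<times> (real^'s) \<times> (complex^'t)) set"
  assumes subgroup: "subgroup \<Gamma> (OT_group C)"
    and discrete: "\<exists>e>0. \<forall>g\<in>\<Gamma>. norm g < e \<longrightarrow> g = 0"
    and cocompact: "\<exists>r. \<forall>g. \<exists>\<gamma>\<in>\<Gamma>. \<exists>k. norm k \<le> r \<and> g = \<gamma> \<otimes>\<^bsub>OT_group C\<^esub> k"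
begin

definition base :: "(real^'s) set" where "base = fst ` \<Gamma>"

definition fibre :: "((real^'s) \<times> (complex^'t)) set" where "fibre = {y. (0, y) \<in> \<Gamma>}"

lemma mult: "(x, y) \<in> \<Gamma> \<Longrightarrow> (x', y') \<in> \<Gamma> \<Longrightarrow> (x + x', y + OT_phi C x y') \<in> \<Gamma>"
  using subgroup.m_closed[OF subgroup, of "(x, y)" "(x', y')"] by (simp add: OT_group_def)

lemma inverse: "(x, y) \<in> \<Gamma> \<Longrightarrow> (- x, OT_phi C (- x) (- y)) \<in> \<Gamma>"
  using subgroup.m_inv_closed[OF subgroup, of "(x, y)"] by (simp add: inv_OT_group)

lemma one: "(0, 0) \<in> \<Gamma>"
  using subgroup.one_closed[OF subgroup] by (simp add: OT_group_def zero_prod_def)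

lemma baseE:
  assumes "x \<in> base"
  obtains y where "(x, y) \<in> \<Gamma>"
  using assms by (auto simp: base_def)

lemma baseI: "(x, y) \<in> \<Gamma> \<Longrightarrow> x \<in> base"
  by (force simp: base_def)

text \<open>The product of \<open>(x, y)\<close> with the inverse of \<open>(x, y')\<close>: over
  equal base components the twist by \<open>OT_phi\<close> cancels.\<close>

lemma diff_in_fibre: "(x, y) \<in> \<Gamma> \<Longrightarrow> (x, y') \<in> \<Gamma> \<Longrightarrow> y - y' \<in> fibre"
  using mult[of x y "- x" "OT_phi C (- x) (- y')"] inverse[of x y']
  by (simp add: fibre_def OT_phi_add[symmetric] OT_phi_0)

lemma base_diff:
  assumes "x \<in> base" "x' \<in> base"
  shows "x - x' \<in> base"
proof -
  obtain y y' where "(x, y) \<in> \<Gamma>" "(x', y') \<in> \<Gamma>" using assms by (meson baseE)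
  from mult[OF this(1) inverse[OF this(2)]] show ?thesis by (auto intro: baseI)
qed

lemma phi_fibre:
  assumes "x \<in> base" "y \<in> fibre"
  shows "OT_phi C x y \<in> fibre"
proof -
  obtain v where v: "(x, v) \<in> \<Gamma>" using assms(1) by (rule baseE)
  then have "(x, v + OT_phi C x y) \<in> \<Gamma>"
    using mult[of x v 0 y] assms(2) by (simp add: fibre_def)
  from diff_in_fibre[OF this v] show ?thesis by simp
qed

sublocale fibre: discrete_subgroup fibre
proof
  show "0 \<in> fibre" using one by (simp add: fibre_def)
  show "x - y \<in> fibre" if "x \<in> fibre" "y \<in> fibre" for x y
    using that by (auto simp: fibre_def dest: diff_in_fibre)
  show "\<exists>e>0. \<forall>x\<in>fibre. norm x < e \<longrightarrow> x = 0"
    using discrete by (fastforce simp: fibre_def norm_Pair zero_prod_def)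
qed

text \<open>The remainder \<open>l\<close> enters twisted by \<open>OT_phi C x\<close> and is
  controlled only while \<open>x\<close> is bounded. Later uses therefore take \<open>u = 0\<close>
  whenever the size of the fibre component matters.\<close>

lemma bounded_remainder:
  obtains r where "\<And>u v. \<exists>x y k l. (x, y) \<in> \<Gamma> \<and> norm k \<le> r \<and> norm l \<le> r \<and> u = x + k \<and> v = y + OT_phi C x l"
proof -
  obtain r where r: "\<And>g. \<exists>\<gamma>\<in>\<Gamma>. \<exists>k. norm k \<le> r \<and> g = \<gamma> \<otimes>\<^bsub>OT_group C\<^esub> k"
    using cocompact by blast
  have "\<exists>x y k l. (x, y) \<in> \<Gamma> \<and> norm k \<le> r \<and> norm l \<le> r \<and> u = x + k \<and> v = y + OT_phi C x l" for u v
  proof -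
    obtain \<gamma> k where g: "\<gamma> \<in> \<Gamma>" "norm k \<le> r" "(u, v) = \<gamma> \<otimes>\<^bsub>OT_group C\<^esub> k" using r by blast
    obtain x y where "\<gamma> = (x, y)" by (cases \<gamma>)
    moreover obtain a b where "k = (a, b)" by (cases k)
    moreover have "norm (fst k) \<le> r" "norm (snd k) \<le> r"
      using g(2) norm_fst_le[of "fst k" "snd k"] norm_snd_le[of "snd k" "fst k"] by simp_all
    ultimately show ?thesis
      using g by (intro exI[of _ x] exI[of _ y] exI[of _ a] exI[of _ b]) (simp add: OT_group_def)
  qed
  then show ?thesis using that by blast
qed

text \<open>The commutator of \<open>(x, y)\<close> with a lattice element \<open>(x', y')\<close> at bounded distance from \<open>(0, v)\<close> lies in the
  fibre and differs from \<open>OT_phi C x v - v\<close> by a bounded amount.\<close>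

lemma phi_minus_id_in_span:
  assumes "x \<in> base"
  shows "OT_phi C x v - v \<in> span fibre"
proof -
  obtain y where y: "(x, y) \<in> \<Gamma>" using assms by (rule baseE)
  obtain r where r: "\<And>u v. \<exists>x y k l. (x, y) \<in> \<Gamma> \<and> norm k \<le> r \<and> norm l \<le> r \<and> u = x + k \<and> v = y + OT_phi C x l"
    using bounded_remainder by blast
  \<comment> \<open>\<open>R\<close> covers the norms of \<open>x'\<close>, \<open>y\<close> and
    \<open>l\<close>, so \<open>B1\<close> bounds \<open>OT_phi C x'\<close> on \<open>y\<close> and
    on \<open>l\<close>; \<open>B2\<close> then bounds \<open>OT_phi C x\<close> on the second of
    these values.\<close>
  define R where "R = max r (norm y)"
  obtain B1 where B1: "\<And>z v. norm z \<le> R \<Longrightarrow> norm v \<le> R \<Longrightarrow> norm (OT_phi C z v) \<le> B1"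
    using OT_phi_bounded[of R C] by blast
  obtain B2 where B2: "\<And>z v. norm z \<le> max (norm x) B1 \<Longrightarrow> norm v \<le> max (norm x) B1 \<Longrightarrow> norm (OT_phi C z v) \<le> B2"
    using OT_phi_bounded[of "max (norm x) B1" C] by blast
  define T where "T v = OT_phi C x v - v" for v
  have lin: "linear T"
    unfolding T_def by (intro linear_compose_sub linear_OT_phi linear_ident)
  have "\<exists>w\<in>span fibre. norm (T v - w) \<le> B1 + norm y + (B2 + B1)" for v
  proof -
    obtain x' y' k l where g: "(x', y') \<in> \<Gamma>" "norm k \<le> r" "norm l \<le> r" "0 = x' + k"
        "v = y' + OT_phi C x' l" using r[of 0 v] by blast
    define w where "w = (y + OT_phi C x y') - (y' + OT_phi C x' y)"
    have "w \<in> fibre"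
      unfolding w_def using mult[OF y g(1)] mult[OF g(1) y] by (intro diff_in_fibre) (simp_all add: add.commute)
    moreover have eq: "T v - w = (OT_phi C x' y - y) + (OT_phi C x (OT_phi C x' l) - OT_phi C x' l)"
      by (simp add: T_def w_def g(5) OT_phi_add_right)
    moreover have "x' = - k" using g(4) by (metis add_eq_0_iff2)
    then have x': "norm x' \<le> R" using g(2) by (simp add: R_def)
    then have "norm (OT_phi C x' y) \<le> B1" "norm (OT_phi C x' l) \<le> B1"
      using g(3) by (auto intro!: B1 simp: R_def)
    moreover from this(2) have "norm (OT_phi C x (OT_phi C x' l)) \<le> B2"
      by (intro B2) auto
    ultimately have "norm (T v - w) \<le> B1 + norm y + (B2 + B1)"
      unfolding eq using norm_triangle_ineq[of "OT_phi C x' y - y" "OT_phi C x (OT_phi C x' l) - OT_phi C x' l"]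
        norm_triangle_ineq4[of "OT_phi C x' y" y] norm_triangle_ineq4[of "OT_phi C x (OT_phi C x' l)" "OT_phi C x' l"]
      by linarith
    then show ?thesis using \<open>w \<in> fibre\<close> by (meson span_base)
  qed
  from linear_bounded_mod_subspace[OF lin subspace_span this, of v] show ?thesis
    by (simp add: T_def)
qed

lemma base_component_nonzero: "\<exists>x\<in>base. x $ j \<noteq> 0"
proof -
  obtain r where r: "\<And>u v. \<exists>x y k l. (x, y) \<in> \<Gamma> \<and> norm k \<le> r \<and> norm l \<le> r \<and> u = x + k \<and> v = y + OT_phi C x l"
    using bounded_remainder by blast
  \<comment> \<open>The target lies at distance \<open>r + 1\<close> along axis \<open>j\<close>,
    farther than a remainder of norm at most \<open>r\<close> can reach.\<close>
  obtain x y k where x: "(x, y) \<in> \<Gamma>" "norm k \<le> r" "axis j (r + 1) = x + k"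
    using r[of "axis j (r + 1)" 0] by blast
  have "x $ j = r + 1 - k $ j"
    using arg_cong[OF x(3), of "\<lambda>v. v $ j"] by (simp add: axis_def)
  moreover have "\<bar>k $ j\<bar> \<le> r"
    using component_le_norm_cart x(2) order_trans by blast
  ultimately have "x $ j \<noteq> 0" by linarith
  then show ?thesis using baseI[OF x(1)] by blast
qed

text \<open>The axis is an eigenvector whose eigenvalue \<open>exp (x $ j)\<close> is not 1, so
  subtracting the identity merely rescales it by a nonzero factor.\<close>

lemma axis_in_span: "(axis j 1, 0) \<in> span fibre"
proof -
  obtain x where x: "x \<in> base" "x $ j \<noteq> 0" using base_component_nonzero by blast
  have "OT_phi C x (axis j 1, 0) - (axis j 1, 0) = (exp (x $ j) - 1) *\<^sub>R (axis j 1, 0)"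
    by (simp add: OT_phi_apply vec_eq_iff axis_def scaleR_prod_def zero_prod_def algebra_simps)
  then have "(exp (x $ j) - 1) *\<^sub>R (axis j 1, 0) \<in> span fibre"
    using phi_minus_id_in_span[OF x(1), of "(axis j 1, 0)"] by simp
  from span_scale[OF this, of "inverse (exp (x $ j) - 1)"] show ?thesis
    using x(2) by simp
qed

text \<open>A small \<open>x\<close> in \<open>base\<close> moves each of the finitely many vectors
  of \<open>B\<close> by an element of \<open>fibre\<close> shorter than \<open>e\<close>, hence not
  at all. It then fixes the real axes, so all its components vanish.\<close>

sublocale base: discrete_subgroup base
proof
  show "0 \<in> base" using one by (rule baseI)
  show "x - y \<in> base" if "x \<in> base" "y \<in> base" for x y
    using that by (rule base_diff)
  obtain B where B: "B \<subseteq> fibre" "independent B" "fibre \<subseteq> span B"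
    using maximal_independent_subset by blast
  have fin: "finite B" using B(2) independent_imp_finite by blast
  obtain e where e: "e > 0" "\<And>y. y \<in> fibre \<Longrightarrow> norm y < e \<Longrightarrow> y = 0"
    using fibre.discrete by blast
  have "\<exists>d>0. \<forall>x. norm x < d \<longrightarrow> norm (OT_phi C x b - b) < e" for b
  proof -
    have "isCont (\<lambda>x. OT_phi C x b) 0"
      using continuous_on_OT_phi[of UNIV "\<lambda>x. x" "\<lambda>_. b" C] by (simp add: continuous_on_eq_continuous_at)
    then show ?thesis
      using e(1) by (auto simp: continuous_at_eps_delta dist_norm OT_phi_0)
  qed
  then obtain d where d: "\<And>b. d b > 0" "\<And>b x. norm x < d b \<Longrightarrow> norm (OT_phi C x b - b) < e"
    by metis
  define D where "D = Min (insert 1 (d ` B))"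
  have "D > 0" using fin d(1) by (auto simp: D_def)
  moreover have "x = 0" if x: "x \<in> base" "norm x < D" for x
  proof -
    have "OT_phi C x b = b" if "b \<in> B" for b
    proof -
      have "D \<le> d b" using that fin by (auto simp: D_def)
      then have "norm (OT_phi C x b - b) < e" using x d(2) by auto
      moreover have "OT_phi C x b - b \<in> fibre"
        using B(1) that x(1) by (intro fibre.diff phi_fibre) auto
      ultimately show ?thesis using e(2)[of "OT_phi C x b - b"] by simp
    qed
    then have eq: "OT_phi C x v = v" if "v \<in> span B" for v
      using linear_eq_on_span[OF linear_OT_phi linear_ident] that by blast
    have "x $ j = 0" for j
    proof -
      have "(axis j 1, 0) \<in> span B"
        using axis_in_span B(3) by (metis span_mono span_span subsetD)
      from eq[OF this] show ?thesis
        by (simp add: OT_phi_apply vec_eq_iff axis_def) (erule allE[of _ j], simp)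
    qed
    then show "x = 0" by (simp add: vec_eq_iff)
  qed
  ultimately show "\<exists>e>0. \<forall>x\<in>base. norm x < e \<longrightarrow> x = 0" by blast
qed

lemma base_cocompact: "\<exists>r. \<forall>v. \<exists>x\<in>base. norm (v - x) \<le> r"
proof -
  obtain r where r: "\<And>u v. \<exists>x y k l. (x, y) \<in> \<Gamma> \<and> norm k \<le> r \<and> norm l \<le> r \<and> u = x + k \<and> v = y + OT_phi C x l"
    using bounded_remainder by blast
  have "\<exists>x\<in>base. norm (v - x) \<le> r" for v
  proof -
    obtain x y k where "(x, y) \<in> \<Gamma>" "norm k \<le> r" "v = x + k" using r[of v 0] by blast
    then show ?thesis by (intro bexI[of _ x]) (auto intro: baseI)
  qed
  then show ?thesis by blast
qed

lemma span_base_eq: "span base = UNIV"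
proof -
  obtain r where "\<And>v. \<exists>x\<in>base. norm (v - x) \<le> r" using base_cocompact by blast
  then have "\<exists>w\<in>span base. norm (v - w) \<le> r" for v by (meson span_base)
  then show ?thesis
    using linear_bounded_mod_subspace[OF linear_ident subspace_span] by blast
qed

text \<open>Since \<open>base\<close> is discrete, only finitely many base components can occur over
  \<open>u = 0\<close>. Subtracting fixed lifts \<open>s x\<close> of them brings every
  \<open>v\<close> within a uniform distance of \<open>fibre\<close>.\<close>

lemma span_fibre_eq: "span fibre = UNIV"
proof -
  obtain r where r: "\<And>u v. \<exists>x y k l. (x, y) \<in> \<Gamma> \<and> norm k \<le> r \<and> norm l \<le> r \<and> u = x + k \<and> v = y + OT_phi C x l"
    using bounded_remainder by blast
  obtain B where B: "\<And>x v. norm x \<le> r \<Longrightarrow> norm v \<le> r \<Longrightarrow> norm (OT_phi C x v) \<le> B"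
    using OT_phi_bounded[of r C] by blast
  have "\<forall>x\<in>base. \<exists>y. (x, y) \<in> \<Gamma>" by (meson baseE)
  from bchoice[OF this] obtain s where s: "\<And>x. x \<in> base \<Longrightarrow> (x, s x) \<in> \<Gamma>" by blast
  let ?F = "base \<inter> cball 0 r"
  have fin: "finite ?F" by (rule base.finite_cball)
  define M where "M = (\<Sum>x\<in>?F. norm (s x))"
  have "\<exists>w\<in>span fibre. norm (v - w) \<le> M + B" for v
  proof -
    obtain x y k l where g: "(x, y) \<in> \<Gamma>" "norm k \<le> r" "norm l \<le> r" "0 = x + k" "v = y + OT_phi C x l"
      using r[of 0 v] by blast
    have "x = - k" using g(4) by (metis add_eq_0_iff2)
    then have x: "norm x \<le> r" using g(2) by simp
    have w: "y - s x \<in> fibre"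
      using g(1) s baseI by (blast intro: diff_in_fibre)
    have "norm (s x) \<le> M"
      unfolding M_def using g(1) x fin by (intro member_le_sum) (auto intro: baseI)
    moreover have "norm (OT_phi C x l) \<le> B" using x g(3) by (rule B)
    moreover have eq: "v - (y - s x) = s x + OT_phi C x l" using g(5) by simp
    ultimately have "norm (v - (y - s x)) \<le> M + B"
      unfolding eq using norm_triangle_ineq[of "s x" "OT_phi C x l"] by simp
    then show ?thesis using w by (meson span_base)
  qed
  then show ?thesis
    using linear_bounded_mod_subspace[OF linear_ident subspace_span] by blast
qed

end

section \<open>The coordinates of the fibre\<close>

text \<open>Rational scalars act through real ones, so one interpretation serves the fibre and its
  complex coordinate vectors alike, and real and rational spans live in the same space.\<close>

interpretation rat_real: vector_space "\<lambda>(q::rat) (v::'a::real_vector). (of_rat q :: real) *\<^sub>R v"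
  by unfold_locales (simp_all add: algebra_simps of_rat_add of_rat_mult)

lemma scaleR_of_rat_complex: "(of_rat q :: real) *\<^sub>R (z :: complex) = of_rat q * z"
  by (cases q) (simp add: of_rat_rat scaleR_conv_of_real)

text \<open>With the conjugates listed as coordinates of their own, every real-linear complex-valued
  map is a complex combination of coordinates, and the index type is that of a labelling of
  embeddings.\<close>

definition OT_coord ::
  "(real^'s::finite) \<times> (complex^'t::finite) \<Rightarrow> complex^('s + 't + 't)" where
  "OT_coord y = (\<chi> a. case a of Inl j \<Rightarrow> of_real (fst y $ j)
     | Inr (Inl i) \<Rightarrow> snd y $ i | Inr (Inr i) \<Rightarrow> cnj (snd y $ i))"

definition OT_character ::
  "complex^'s::finite^'t::finite \<Rightarrow> real^'s \<Rightarrow> complex^('s + 't + 't)" where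
  "OT_character C x = (\<chi> a. case a of Inl j \<Rightarrow> of_real (exp (x $ j))
     | Inr (Inl i) \<Rightarrow> exp (\<Sum>j\<in>UNIV. C $ i $ j * of_real (x $ j))
     | Inr (Inr i) \<Rightarrow> cnj (exp (\<Sum>j\<in>UNIV. C $ i $ j * of_real (x $ j))))"

lemma OT_coord_nth [simp]:
  "OT_coord y $ Inl j = of_real (fst y $ j)"
  "OT_coord y $ Inr (Inl i) = snd y $ i"
  "OT_coord y $ Inr (Inr i) = cnj (snd y $ i)"
  by (simp_all add: OT_coord_def)

lemma OT_character_nth [simp]:
  "OT_character C x $ Inl j = of_real (exp (x $ j))"
  "OT_character C x $ Inr (Inl i) = exp (\<Sum>j\<in>UNIV. C $ i $ j * of_real (x $ j))"
  "OT_character C x $ Inr (Inr i) = cnj (exp (\<Sum>j\<in>UNIV. C $ i $ j * of_real (x $ j)))"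
  by (simp_all add: OT_character_def)

lemma vec_sum_eq_iff:
  fixes v w :: "'a^('s::finite + 't::finite + 'u::finite)"
  shows "v = w \<longleftrightarrow> (\<forall>j. v $ Inl j = w $ Inl j) \<and> (\<forall>i. v $ Inr (Inl i) = w $ Inr (Inl i)) \<and>
    (\<forall>i. v $ Inr (Inr i) = w $ Inr (Inr i))"
  unfolding vec_eq_iff by (auto simp: split_sum_all)

lemma linear_OT_coord: "linear OT_coord"
  by (rule linearI) (simp_all add: vec_sum_eq_iff scaleR_conv_of_real[where 'a = complex])

lemma inj_OT_coord: "OT_coord y = OT_coord y' \<longleftrightarrow> y = y'"
  by (auto simp: vec_sum_eq_iff prod_eq_iff vec_eq_iff)

lemma OT_coord_phi: "OT_coord (OT_phi C x y) = OT_character C x * OT_coord y"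
  by (cases y) (simp add: vec_sum_eq_iff OT_phi_apply)

lemma OT_character_add: "OT_character C (x + x') = OT_character C x * OT_character C x'"
  by (simp add: vec_sum_eq_iff exp_add distrib_left sum.distrib)

lemma OT_character_0: "OT_character C 0 = 1"
  by (simp add: vec_sum_eq_iff)

lemma sum_UNIV_Plus:
  fixes f :: "'s::finite + 't::finite + 'u::finite \<Rightarrow> 'a::comm_monoid_add"
  shows "(\<Sum>a\<in>UNIV. f a) = (\<Sum>j\<in>UNIV. f (Inl j)) + ((\<Sum>i\<in>UNIV. f (Inr (Inl i))) + (\<Sum>i\<in>UNIV. f (Inr (Inr i))))"
  using sum.Plus[of "UNIV :: 's set" "UNIV :: ('t + 'u) set" f]
    sum.Plus[of "UNIV :: 't set" "UNIV :: 'u set" "\<lambda>x. f (Inr x)"]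
  by (simp add: o_def)

text \<open>A unit vector in a complex slot and its multiple by \<open>\<i>\<close> yield the sum
  and the difference of the coefficients of \<open>w\<close> and \<open>cnj w\<close>. So the
  coordinates stay independent over the complex numbers on a real spanning set.\<close>

lemma OT_coord_functional_eq_0:
  fixes d :: "'s::finite + 't::finite + 't \<Rightarrow> complex"
  assumes "span F = UNIV" and 0: "\<And>y. y \<in> F \<Longrightarrow> (\<Sum>a\<in>UNIV. d a * OT_coord y $ a) = 0"
  shows "d a = 0"
proof -
  let ?f = "\<lambda>y :: (real^'s) \<times> (complex^'t). \<Sum>a\<in>UNIV. d a * OT_coord y $ a"
  have lin: "linear ?f"
    by (rule linearI)
      (simp_all add: linear_add[OF linear_OT_coord] linear_scale[OF linear_OT_coord] distrib_left sum.distrib scaleR_sum_right)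
  have f: "?f y = 0" for y
    using linear_eq_0_on_span[OF lin 0] assms(1) by blast
  have ax: "(if P then x else 0) * z = (if P then x * z else 0)" "z * (if P then x else 0) = (if P then z * x else 0)" 
    for P and x z :: complex by simp_all
  have 1: "d (Inl j) = 0" for j
    using f[of "(axis j 1, 0)"] by (simp add: sum_UNIV_Plus axis_def if_distrib ax cong: if_cong)
  have 2: "d (Inr (Inl i)) + d (Inr (Inr i)) = 0" for i
    using f[of "(0, axis i 1)"] by (simp add: sum_UNIV_Plus axis_def if_distrib ax cong: if_cong)
  have 3: "d (Inr (Inl i)) = d (Inr (Inr i))" for i
    using f[of "(0, axis i \<i>)"] by (simp add: sum_UNIV_Plus axis_def if_distrib ax cong: if_cong)
  have "d (Inr (Inr i)) = 0" for i using 2[of i] 3[of i] by simp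
  then show ?thesis
    using 1 3 by (metis sumE)
qed

lemma real_linear_in_OT_coord:
  fixes T :: "(real^'s::finite) \<times> (complex^'t::finite) \<Rightarrow> complex"
  assumes "linear T"
  shows "\<exists>c. \<forall>y. T y = (\<Sum>a\<in>UNIV. c a * OT_coord y $ a)"
proof -
  \<comment> \<open>These lead to the Wirtinger coefficients of \<open>T\<close>: half of
    \<open>c1 - c2\<close> belongs to \<open>w\<close>, half of \<open>c1 + c2\<close> to
    \<open>cnj w\<close>.\<close>
  define c1 where "c1 i = T (0, axis i 1)" for i
  define c2 where "c2 i = \<i> * T (0, axis i \<i>)" for i
  define c where "c a = (case a of Inl j \<Rightarrow> T (axis j 1, 0) | Inr (Inl i) \<Rightarrow> (c1 i - c2 i) / 2
      | Inr (Inr i) \<Rightarrow> (c1 i + c2 i) / 2)" for a :: "'s + 't + 't"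
  have "T y = (\<Sum>a\<in>UNIV. c a * OT_coord y $ a)" for y
  proof -
    obtain v w where y: "y = (v, w)" by (cases y)
    have r: "T (axis j (v $ j), 0) = of_real (v $ j) * T (axis j 1, 0)" for j
    proof -
      have "(axis j (v $ j), 0 :: complex^'t) = (v $ j) *\<^sub>R (axis j 1, 0)"
        by (simp add: scaleR_prod_def vec_eq_iff axis_def)
      then show ?thesis by (simp only: linear_scale[OF assms] scaleR_conv_of_real[where 'a = complex])
    qed
    have z: "T (0, axis i (w $ i)) = (c1 i - c2 i) / 2 * w $ i + (c1 i + c2 i) / 2 * cnj (w $ i)" for i
    proof -
      have "(0 :: real^'s, axis i (w $ i)) = Re (w $ i) *\<^sub>R (0, axis i 1) + Im (w $ i) *\<^sub>R (0, axis i \<i>)"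
        by (simp add: scaleR_prod_def vec_eq_iff axis_def complex_eq_iff)
      then have "T (0, axis i (w $ i)) = of_real (Re (w $ i)) * c1 i - of_real (Im (w $ i)) * (\<i> * c2 i)"
        by (simp only: linear_add[OF assms] linear_scale[OF assms])
          (simp add: scaleR_conv_of_real[where 'a = complex] c1_def c2_def mult.assoc[symmetric])
      also have "\<dots> = (c1 i - c2 i) / 2 * w $ i + (c1 i + c2 i) / 2 * cnj (w $ i)"
        by (simp add: complex_eq_iff field_simps)
      finally show ?thesis .
    qed
    have "y = (\<Sum>j\<in>UNIV. (axis j (v $ j), 0)) + (\<Sum>i\<in>UNIV. (0, axis i (w $ i)))"
      by (simp add: y sum_prod sum_axis vec_lambda_eta)
    then have "T y = (\<Sum>j\<in>UNIV. T (axis j (v $ j), 0)) + (\<Sum>i\<in>UNIV. T (0, axis i (w $ i)))"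
      by (simp add: linear_add[OF assms] linear_sum[OF assms])
    also have "\<dots> = (\<Sum>a\<in>UNIV. c a * OT_coord y $ a)"
      by (simp add: r z c_def y sum_UNIV_Plus sum.distrib mult.commute)
    finally show ?thesis .
  qed
  then show ?thesis by blast
qed

section \<open>The field of a lattice of simple type\<close>

text \<open>Irreducibility is phrased for rational subspaces of the fibre space itself;
  \<open>irreducible_image\<close> passes to this form from the formal tensor product.\<close>

locale OT_simple_lattice = OT_lattice C \<Gamma>
  for C :: "complex^'s::finite^'t::finite" and \<Gamma> +
  fixes a0 :: "'s + 't + 't"
  assumes irreducible: "\<lbrakk>rat_real.subspace W; W \<subseteq> rat_real.span fibre;
    \<And>x. x \<in> base \<Longrightarrow> OT_phi C x ` W \<subseteq> W\<rbrakk> \<Longrightarrow> W = {0} \<or> W = rat_real.span fibre"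
begin

definition E where "E = rat_real.span fibre"

text \<open>The image of the rational group algebra of \<open>base\<close> among the diagonal
  operators.\<close>

definition R where "R = rat_real.span (OT_character C ` base)"

lemma subspace_E: "rat_real.subspace E" and subspace_R: "rat_real.subspace R"
  unfolding E_def R_def by (rule rat_real.subspace_span)+

lemma character_in_R: "x \<in> base \<Longrightarrow> OT_character C x \<in> R"
  unfolding R_def by (intro rat_real.span_base imageI)

lemma one_in_R: "1 \<in> R"
  using character_in_R[OF base.zero] by (simp add: OT_character_0)

lemma R_induct [consumes 1, case_names subspace character]:
  assumes "\<alpha> \<in> R" "rat_real.subspace {\<alpha>. Q \<alpha>}" "\<And>x. x \<in> base \<Longrightarrow> Q (OT_character C x)"
  shows "Q \<alpha>"
  using rat_real.span_induct[of \<alpha> "OT_character C ` base" Q] assms unfolding R_def by auto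

lemma mult_in_R:
  assumes "\<alpha> \<in> R" "\<beta> \<in> R"
  shows "\<alpha> * \<beta> \<in> R"
  using assms(1)
proof (induction rule: R_induct)
  case subspace
  then show ?case
    using subspace_R by (auto simp: rat_real.subspace_def distrib_right)
next
  case (character x)
  from assms(2) show ?case
  proof (induction rule: R_induct)
    case subspace
    then show ?case
      using subspace_R by (auto simp: rat_real.subspace_def distrib_left)
  next
    case (character x')
    with \<open>x \<in> base\<close> show ?case
      by (simp add: character_in_R base.add flip: OT_character_add)
  qed
qed

lemma subspace_coord_E: "rat_real.subspace (OT_coord ` E)"
proof (rule rat_real.subspaceI)
  show "0 \<in> OT_coord ` E"
    using rat_real.subspace_0[OF subspace_E] linear_0[OF linear_OT_coord] by (metis imageI)
next
  fix x y assume "x \<in> OT_coord ` E" "y \<in> OT_coord ` E"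
  then obtain v w where "v \<in> E" "w \<in> E" "x = OT_coord v" "y = OT_coord w" by blast
  then show "x + y \<in> OT_coord ` E"
    by (simp only: linear_add[OF linear_OT_coord, symmetric] rat_real.subspace_add[OF subspace_E] imageI)
next
  fix q x assume "x \<in> OT_coord ` E"
  then obtain v where "v \<in> E" "x = OT_coord v" by blast
  then show "(of_rat q :: real) *\<^sub>R x \<in> OT_coord ` E"
    by (simp only: linear_scale[OF linear_OT_coord, symmetric] rat_real.subspace_scale[OF subspace_E] imageI)
qed

lemma phi_E: "x \<in> base \<Longrightarrow> y \<in> E \<Longrightarrow> OT_phi C x y \<in> E"
  unfolding E_def
proof (erule rat_real.span_induct)
  show "rat_real.subspace {y. OT_phi C x y \<in> rat_real.span fibre}"
    using subspace_E unfolding E_def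
    by (auto simp: rat_real.subspace_def linear_0[OF linear_OT_phi] linear_add[OF linear_OT_phi] linear_scale[OF linear_OT_phi])
qed (intro rat_real.span_base phi_fibre)

lemma R_acts_on_E:
  assumes "\<alpha> \<in> R" "y \<in> E"
  shows "\<alpha> * OT_coord y \<in> OT_coord ` E"
  using assms(1)
proof (induction rule: R_induct)
  case subspace
  then show ?case
    using subspace_coord_E by (auto simp: rat_real.subspace_def distrib_right)
next
  case (character x)
  with assms(2) show ?case by (auto simp: phi_E simp flip: OT_coord_phi)
qed

text \<open>\<open>W\<close> is the cyclic submodule generated by \<open>y\<close>, written as a
  preimage under \<open>OT_coord\<close> so that irreducibility applies; it contains
  \<open>y\<close> because \<open>R\<close> contains 1.\<close>

lemma coord_E_eq:
  assumes "y \<in> E" "y \<noteq> 0"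
  shows "OT_coord ` E = (\<lambda>\<alpha>. \<alpha> * OT_coord y) ` R"
proof -
  define W where "W = {w. OT_coord w \<in> (\<lambda>\<alpha>. \<alpha> * OT_coord y) ` R}"
  have "rat_real.subspace W"
  proof (rule rat_real.subspaceI)
    show "0 \<in> W"
      using rat_real.subspace_0[OF subspace_R] by (force simp: W_def linear_0[OF linear_OT_coord])
    show "v + w \<in> W" if "v \<in> W" "w \<in> W" for v w
      using that rat_real.subspace_add[OF subspace_R]
      by (fastforce simp: W_def linear_add[OF linear_OT_coord] simp flip: distrib_right)
    show "(of_rat q :: real) *\<^sub>R w \<in> W" if "w \<in> W" for w q
      using that rat_real.subspace_scale[OF subspace_R, of _ q]
      by (fastforce simp: W_def linear_scale[OF linear_OT_coord] simp flip: mult_scaleR_left)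
  qed
  moreover have "W \<subseteq> E"
    using R_acts_on_E[OF _ assms(1)] by (force simp: W_def inj_OT_coord)
  moreover have "OT_phi C x ` W \<subseteq> W" if "x \<in> base" for x
    using mult_in_R[OF character_in_R[OF that]] by (auto simp: W_def OT_coord_phi mult.assoc[symmetric])
  moreover have "y \<in> W" using one_in_R by (force simp: W_def)
  ultimately have "W = E"
    using irreducible[of W] assms(2) by (auto simp: E_def)
  then show ?thesis
    using R_acts_on_E[OF _ assms(1)] by (auto simp: W_def)
qed

text \<open>A coordinate that vanishes at \<open>y\<close> vanishes at all products
  \<open>\<alpha> * OT_coord y\<close>, hence on the whole fibre lattice, against the independence
  of the coordinates.\<close>

lemma coord_E_nonzero:
  assumes "y \<in> E" "y \<noteq> 0"
  shows "OT_coord y $ a \<noteq> 0"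
proof
  assume 0: "OT_coord y $ a = 0"
  have "(\<Sum>b\<in>UNIV. (if b = a then 1 else 0) * OT_coord z $ b) = 0" if "z \<in> fibre" for z
  proof -
    have "OT_coord z \<in> OT_coord ` E" using that by (simp add: E_def rat_real.span_base)
    then obtain \<alpha> where "OT_coord z = \<alpha> * OT_coord y"
      unfolding coord_E_eq[OF assms] by blast
    then have "OT_coord z $ a = 0" using 0 by simp
    then show ?thesis by (simp add: if_distrib[where f = "\<lambda>x. x * _"] cong: if_cong)
  qed
  from OT_coord_functional_eq_0[OF span_fibre_eq this, of a] show False by simp
qed

lemma fibre_nonzero: "\<exists>y\<in>fibre. y \<noteq> 0"
proof -
  have "(axis undefined 1, 0) \<in> span fibre" by (simp add: span_fibre_eq)
  moreover have "(axis undefined 1 :: real^'s, 0 :: complex^'t) \<noteq> 0" by (simp add: zero_prod_def axis_eq_0_iff)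
  ultimately have "\<not> fibre \<subseteq> {0}"
    using span_mono[of fibre "{0}"] by auto
  then show ?thesis by blast
qed

text \<open>A base point: dividing by \<open>OT_coord gen\<close> turns the module \<open>E\<close>
  into the field.\<close>

definition gen where "gen = (SOME y. y \<in> E \<and> y \<noteq> 0)"

lemma gen: "gen \<in> E" "gen \<noteq> 0" "OT_coord gen $ a \<noteq> 0"
proof -
  show *: "gen \<in> E" "gen \<noteq> 0"
    unfolding gen_def E_def using someI_ex[of "\<lambda>y. y \<in> rat_real.span fibre \<and> y \<noteq> 0"]
      fibre_nonzero rat_real.span_base by blast+
  show "OT_coord gen $ a \<noteq> 0" using * by (rule coord_E_nonzero)
qed

text \<open>Multiplication by \<open>\<alpha>\<close> sends \<open>gen\<close> to a nonzero
  \<open>y\<close>, which generates \<open>E\<close> again; the coefficient that brings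
  \<open>gen\<close> back is the inverse of \<open>\<alpha>\<close>.\<close>

lemma R_nonzero:
  assumes "\<alpha> \<in> R" "\<alpha> \<noteq> 0"
  shows "\<alpha> $ a \<noteq> 0" and "\<exists>\<beta>\<in>R. \<alpha> * \<beta> = 1"
proof -
  obtain y where y: "y \<in> E" "\<alpha> * OT_coord gen = OT_coord y"
    using R_acts_on_E[OF assms(1) gen(1)] by blast
  obtain b where "\<alpha> $ b \<noteq> 0" using assms(2) by (auto simp: vec_eq_iff)
  then have "OT_coord y $ b \<noteq> 0" using gen(3) by (simp flip: y(2))
  then have "y \<noteq> 0" using linear_0[OF linear_OT_coord] by (metis zero_index)
  then show "\<alpha> $ a \<noteq> 0"
    using coord_E_nonzero[OF y(1), of a] by (auto simp flip: y(2))
  have "OT_coord gen \<in> (\<lambda>\<beta>. \<beta> * OT_coord y) ` R"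
    using gen(1) coord_E_eq[OF y(1) \<open>y \<noteq> 0\<close>] by blast
  then obtain \<beta> where \<beta>: "\<beta> \<in> R" "OT_coord gen = \<beta> * (\<alpha> * OT_coord gen)"
    by (auto simp: y(2))
  have "\<alpha> $ b * \<beta> $ b = 1" for b
    using arg_cong[OF \<beta>(2), of "\<lambda>v. v $ b"] gen(3)[of b] by (simp add: mult.commute)
  then show "\<exists>\<beta>\<in>R. \<alpha> * \<beta> = 1"
    using \<beta>(1) by (intro bexI[of _ \<beta>]) (simp_all add: vec_eq_iff)
qed

lemma inj_on_R: "inj_on (\<lambda>\<alpha>. \<alpha> $ a) R"
proof (rule inj_onI)
  fix \<alpha> \<beta> assume *: "\<alpha> \<in> R" "\<beta> \<in> R" "\<alpha> $ a = \<beta> $ a"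
  then have "\<alpha> - \<beta> \<in> R" by (simp add: rat_real.subspace_diff[OF subspace_R])
  from R_nonzero(1)[OF this, of a] * show "\<alpha> = \<beta>" by auto
qed

text \<open>The choice of the coordinate \<open>a0\<close> that realises the field inside the complex numbers is immaterial.\<close>

definition K where "K = (\<lambda>\<alpha>. \<alpha> $ a0) ` R"

definition U where "U = (\<lambda>x. OT_character C x $ a0) ` base"

text \<open>The value \<open>undefined\<close> outside \<open>K\<close> makes each
  \<open>\<sigma> a\<close> extensional, as \<open>embeddings\<close> demands.\<close>

definition \<sigma> where "\<sigma> a k = (if k \<in> K then inv_into R (\<lambda>\<alpha>. \<alpha> $ a0) k $ a else undefined)"

lemma KI: "\<alpha> \<in> R \<Longrightarrow> \<alpha> $ a0 \<in> K"
  by (simp add: K_def)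

lemma KE:
  assumes "k \<in> K"
  obtains \<alpha> where "\<alpha> \<in> R" "k = \<alpha> $ a0"
  using assms by (auto simp: K_def)

lemma \<sigma>_nth: "\<alpha> \<in> R \<Longrightarrow> \<sigma> a (\<alpha> $ a0) = \<alpha> $ a"
  by (simp add: \<sigma>_def KI inv_into_f_f[OF inj_on_R])

lemma \<sigma>_character: "x \<in> base \<Longrightarrow> \<sigma> a (OT_character C x $ a0) = OT_character C x $ a"
  by (intro \<sigma>_nth character_in_R)

lemma of_rat_in_K: "of_rat q \<in> K"
proof -
  have "(of_rat q :: real) *\<^sub>R (1 :: complex^('s + 't + 't)) \<in> R"
    by (intro rat_real.subspace_scale subspace_R one_in_R)
  from KI[OF this] show ?thesis by (simp add: scaleR_of_rat_complex)
qed

lemma complex_subfield_K: "complex_subfield K"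
  unfolding complex_subfield_def
proof (intro conjI ballI)
  show "0 \<in> K" "1 \<in> K" using of_rat_in_K[of 0] of_rat_in_K[of 1] by simp_all
next
  fix x y assume "x \<in> K" "y \<in> K"
  then obtain \<alpha> \<beta> where *: "\<alpha> \<in> R" "x = \<alpha> $ a0" "\<beta> \<in> R" "y = \<beta> $ a0" by (meson KE)
  show "x + y \<in> K" using KI[OF rat_real.subspace_add[OF subspace_R *(1,3)]] * by simp
  show "x * y \<in> K" using KI[OF mult_in_R[OF *(1,3)]] * by simp
next
  fix x assume "x \<in> K"
  then obtain \<alpha> where *: "\<alpha> \<in> R" "x = \<alpha> $ a0" by (rule KE)
  show "- x \<in> K" using KI[OF rat_real.subspace_neg[OF subspace_R *(1)]] * by simp
  show "inverse x \<in> K"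
  proof (cases "\<alpha> = 0")
    case True then show ?thesis using * \<open>x \<in> K\<close> by simp
  next
    case False
    then obtain \<beta> where \<beta>: "\<beta> \<in> R" "\<alpha> * \<beta> = 1" using R_nonzero(2)[OF *(1)] by blast
    have "(\<alpha> * \<beta>) $ a0 = 1" unfolding \<beta>(2) by simp
    then have "x * \<beta> $ a0 = 1" using *(2) by simp
    then have "inverse x = \<beta> $ a0" by (rule inverse_unique)
    then show ?thesis using KI[OF \<beta>(1)] by simp
  qed
qed

lemma field_adjoin_rat_U: "field_adjoin_rat U = K"
proof
  have "U \<subseteq> K" unfolding U_def using character_in_R by (auto intro: KI)
  then show "field_adjoin_rat U \<subseteq> K"
    unfolding field_adjoin_rat_def using complex_subfield_K by blast
  show "K \<subseteq> field_adjoin_rat U"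
    unfolding field_adjoin_rat_def
  proof (intro subsetI InterI)
    fix k L assume "k \<in> K" and "L \<in> {L. complex_subfield L \<and> U \<subseteq> L}"
    then have L: "complex_subfield L" "U \<subseteq> L" by auto
    have nat: "of_nat n \<in> L" for n
      using L(1) by (induction n) (auto simp: complex_subfield_def)
    have int: "of_int n \<in> L" for n
      using nat L(1) by (cases n) (auto simp: complex_subfield_def simp del: of_nat_Suc)
    have rat: "of_rat q \<in> L" for q
      using int L(1) by (cases q) (auto simp: of_rat_rat divide_inverse complex_subfield_def)
    obtain \<alpha> where "\<alpha> \<in> R" "k = \<alpha> $ a0" using \<open>k \<in> K\<close> by (rule KE)
    from this(1) have "\<alpha> $ a0 \<in> L"
    proof (induction rule: R_induct)
      case subspace
      show ?case
        using L(1) rat by (auto intro!: rat_real.subspaceI simp: complex_subfield_def scaleR_of_rat_complex)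
    next
      case (character x)
      then show ?case using L(2) by (auto simp: U_def)
    qed
    then show "k \<in> L" using \<open>k = \<alpha> $ a0\<close> by simp
  qed
qed

end

section \<open>The degree and the embeddings of the field\<close>

context OT_simple_lattice
begin

lemma \<sigma>_add: "x \<in> K \<Longrightarrow> y \<in> K \<Longrightarrow> \<sigma> a (x + y) = \<sigma> a x + \<sigma> a y"
  using \<sigma>_nth[OF rat_real.subspace_add[OF subspace_R]] by (auto elim!: KE simp: \<sigma>_nth)

lemma \<sigma>_mult: "x \<in> K \<Longrightarrow> y \<in> K \<Longrightarrow> \<sigma> a (x * y) = \<sigma> a x * \<sigma> a y"
  using \<sigma>_nth[OF mult_in_R] by (auto elim!: KE simp: \<sigma>_nth)

lemma \<sigma>_embedding: "\<sigma> a \<in> embeddings K"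
  unfolding embeddings_def
  using \<sigma>_nth[OF one_in_R, of a] by (auto simp: \<sigma>_add \<sigma>_mult) (simp add: \<sigma>_def extensional_def)

text \<open>Dividing the coefficients by the coordinates of \<open>gen\<close> moves a relation on
  \<open>R\<close> to one on the fibre, where the coordinates are independent.\<close>

lemma R_functional_eq_0:
  assumes "\<And>\<alpha>. \<alpha> \<in> R \<Longrightarrow> (\<Sum>a\<in>UNIV. d a * \<alpha> $ a) = 0"
  shows "d a = 0"
proof -
  have "(\<Sum>a\<in>UNIV. d a / OT_coord gen $ a * OT_coord y $ a) = 0" if "y \<in> fibre" for y
  proof -
    have "OT_coord y \<in> OT_coord ` E" using that by (simp add: E_def rat_real.span_base)
    then obtain \<alpha> where "\<alpha> \<in> R" "OT_coord y = \<alpha> * OT_coord gen"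
      unfolding coord_E_eq[OF gen(1,2)] by blast
    then show ?thesis using assms[of \<alpha>] gen(3) by simp
  qed
  from OT_coord_functional_eq_0[OF span_fibre_eq this, of a] show ?thesis using gen(3) by simp
qed

lemma inj_\<sigma>: "inj \<sigma>"
proof (rule injI, rule ccontr)
  fix a b assume eq: "\<sigma> a = \<sigma> b" and "a \<noteq> b"
  have "\<alpha> $ a = \<alpha> $ b" if "\<alpha> \<in> R" for \<alpha>
    using \<sigma>_nth[OF that, of a] \<sigma>_nth[OF that, of b] eq by simp
  \<comment> \<open>The relation says that coordinate \<open>a\<close> minus coordinate
    \<open>b\<close> vanishes; its coefficient at \<open>a\<close> is 1.\<close>
  then have "(\<Sum>c\<in>UNIV. ((if c = a then 1 else 0) - (if c = b then 1 else 0)) * \<alpha> $ c) = 0" if "\<alpha> \<in> R" for \<alpha>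
    using that by (simp add: left_diff_distrib sum_subtractf if_distrib[where f = "\<lambda>x. x * _"] cong: if_cong)
  from R_functional_eq_0[OF this, of a] show False using \<open>a \<noteq> b\<close> by simp
qed

text \<open>The rational isomorphism from \<open>E\<close> onto \<open>K\<close>: divide by
  \<open>gen\<close> and read off coordinate \<open>a0\<close>.\<close>

definition \<kappa> where "\<kappa> y = OT_coord y $ a0 / OT_coord gen $ a0"

lemma \<kappa>_E:
  assumes "y \<in> E"
  obtains \<alpha> where "\<alpha> \<in> R" "\<kappa> y = \<alpha> $ a0" "OT_coord y = \<alpha> * OT_coord gen"
proof -
  have "OT_coord y \<in> OT_coord ` E" using assms by simp
  then obtain \<alpha> where "\<alpha> \<in> R" "OT_coord y = \<alpha> * OT_coord gen"
    unfolding coord_E_eq[OF gen(1,2)] by blast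
  then show ?thesis using gen(3) that by (simp add: \<kappa>_def)
qed

lemma K_eq: "K = \<kappa> ` E"
proof
  show "K \<subseteq> \<kappa> ` E"
  proof
    fix k assume "k \<in> K"
    then obtain \<alpha> where "\<alpha> \<in> R" "k = \<alpha> $ a0" by (rule KE)
    moreover from this(1) obtain y where "y \<in> E" "\<alpha> * OT_coord gen = OT_coord y"
      using R_acts_on_E[OF _ gen(1)] by blast
    ultimately have "k = \<kappa> y" using gen(3) by (simp add: \<kappa>_def flip: \<open>\<alpha> * OT_coord gen = OT_coord y\<close>)
    then show "k \<in> \<kappa> ` E" using \<open>y \<in> E\<close> by blast
  qed
  show "\<kappa> ` E \<subseteq> K" by (auto elim!: \<kappa>_E simp: KI)
qed

lemma \<kappa>_add: "\<kappa> (x + y) = \<kappa> x + \<kappa> y"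
  by (simp add: \<kappa>_def linear_add[OF linear_OT_coord] add_divide_distrib)

lemma \<kappa>_scale: "\<kappa> ((of_rat q :: real) *\<^sub>R y) = of_rat q * \<kappa> y"
  by (simp add: \<kappa>_def linear_scale[OF linear_OT_coord] scaleR_of_rat_complex)

lemma \<kappa>_0: "\<kappa> 0 = 0"
  by (simp add: \<kappa>_def linear_0[OF linear_OT_coord])

lemma \<kappa>_sum: "\<kappa> (\<Sum>b\<in>A. f b) = (\<Sum>b\<in>A. \<kappa> (f b))"
  by (induction A rule: infinite_finite_induct) (simp_all add: \<kappa>_0 \<kappa>_add)

lemma \<kappa>_eq_0: "y \<in> E \<Longrightarrow> \<kappa> y = 0 \<Longrightarrow> y = 0"
  using coord_E_nonzero[of y a0] gen(3)[of a0] by (auto simp: \<kappa>_def)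

text \<open>Discreteness is what ties the two scalar fields together: some positive multiple of each
  lattice vector is an integer combination of \<open>B\<close>, so a real basis taken from
  \<open>fibre\<close> also spans \<open>E\<close> over the rationals.\<close>

lemma fibre_basis_exists:
  obtains B where "B \<subseteq> fibre" "independent B" "span B = UNIV" "finite B" "E = rat_real.span B"
proof -
  obtain B where B: "B \<subseteq> fibre" "independent B" "fibre \<subseteq> span B"
    using maximal_independent_subset by blast
  have fin: "finite B" using B(2) independent_imp_finite by blast
  have "span B = UNIV"
    using B(1,3) span_fibre_eq by (metis span_mono span_span top.extremum_uniqueI)
  moreover have "fibre \<subseteq> rat_real.span B"
  proof
    fix y assume "y \<in> fibre"
    then obtain m :: nat and n :: "_ \<Rightarrow> int" where m: "0 < m" "of_nat m *\<^sub>R y = (\<Sum>b\<in>B. of_int (n b) *\<^sub>R b)"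
      using fibre.multiple_int_comb[OF fin B(2,1)] B(3) by blast
    then have "y = inverse (of_nat m) *\<^sub>R (\<Sum>b\<in>B. of_int (n b) *\<^sub>R b)" by (simp flip: m(2))
    also have "\<dots> = (of_rat (inverse (of_nat m)) :: real) *\<^sub>R (\<Sum>b\<in>B. (of_rat (of_int (n b)) :: real) *\<^sub>R b)"
      by (simp add: of_rat_inverse)
    also have "\<dots> \<in> rat_real.span B"
      by (intro rat_real.span_scale rat_real.span_sum rat_real.span_base)
    finally show "y \<in> rat_real.span B" .
  qed
  then have "E = rat_real.span B"
    unfolding E_def by (metis B(1) rat_real.span_mono rat_real.span_span subset_antisym)
  ultimately show ?thesis using that B(1,2) fin by blast
qed

lemma rat_span_E:
  assumes "finite B" "y \<in> rat_real.span B"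
  obtains q where "y = (\<Sum>b\<in>B. (of_rat (q b) :: real) *\<^sub>R b)"
  using assms unfolding rat_real.span_finite[OF assms(1)] by auto

text \<open>\<open>\<kappa>\<close> maps \<open>B\<close> to a rational basis of \<open>K\<close>,
  so the degree is the real dimension of the fibre space.\<close>

lemma number_field_K: "number_field K" and dim_K: "rat_complex.dim K = CARD('s) + 2 * CARD('t)"
proof -
  obtain B where B: "B \<subseteq> fibre" "independent B" "span B = UNIV" "finite B" "E = rat_real.span B"
    by (rule fibre_basis_exists)
  have BE: "B \<subseteq> E" using B(5) rat_real.span_superset by blast
  have comb: "(\<Sum>b\<in>B. (of_rat (q b) :: real) *\<^sub>R b) \<in> E" for q
    unfolding B(5) by (intro rat_real.span_sum rat_real.span_scale rat_real.span_base)
  have \<kappa>_comb: "\<kappa> (\<Sum>b\<in>B. (of_rat (q b) :: real) *\<^sub>R b) = (\<Sum>b\<in>B. of_rat (q b) * \<kappa> b)" for q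
    by (simp add: \<kappa>_sum \<kappa>_scale)
  have inj: "inj_on \<kappa> B"
  proof (rule inj_onI)
    fix x y assume *: "x \<in> B" "y \<in> B" "\<kappa> x = \<kappa> y"
    have "\<kappa> (x - y) = 0" using * \<kappa>_add[of "x - y" y] by simp
    moreover have "x - y \<in> E" using * BE by (intro rat_real.subspace_diff[OF subspace_E]) auto
    ultimately show "x = y" using \<kappa>_eq_0[of "x - y"] by simp
  qed
  have span: "K \<subseteq> rat_complex.span (\<kappa> ` B)"
  proof
    fix k assume "k \<in> K"
    then obtain y where "y \<in> E" "k = \<kappa> y" by (auto simp: K_eq)
    moreover obtain q where "y = (\<Sum>b\<in>B. (of_rat (q b) :: real) *\<^sub>R b)"
      using rat_span_E[OF B(4), of y] \<open>y \<in> E\<close> B(5) by blast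
    ultimately have "k = (\<Sum>b\<in>B. of_rat (q b) * \<kappa> b)" by (simp add: \<kappa>_comb)
    also have "\<dots> \<in> rat_complex.span (\<kappa> ` B)"
      by (intro rat_complex.span_sum rat_complex.span_scale rat_complex.span_base) auto
    finally show "k \<in> rat_complex.span (\<kappa> ` B)" .
  qed
  then show "number_field K"
    unfolding number_field_def using complex_subfield_K B(4) by blast
  \<comment> \<open>A rational relation among the values of \<open>\<kappa>\<close> lifts to
    \<open>E\<close>, where the real independence of \<open>B\<close> forbids it; \<open>q\<close>
    extends the coefficients by 0 to all of \<open>B\<close>.\<close>
  have ind: "rat_complex.independent (\<kappa> ` B)"
  proof (subst rat_complex.independent_explicit_finite_subsets, intro allI impI ballI)
    fix A u v assume A: "A \<subseteq> \<kappa> ` B" "finite A" "(\<Sum>v\<in>A. of_rat (u v) * v) = 0" "v \<in> A"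
    define q where "q b = (if \<kappa> b \<in> A then u (\<kappa> b) else 0)" for b
    have "(\<Sum>b\<in>B. of_rat (q b) * \<kappa> b) = (\<Sum>v\<in>\<kappa> ` B. of_rat (if v \<in> A then u v else 0) * v)"
      by (simp add: sum.reindex[OF inj] q_def)
    also have "\<dots> = (\<Sum>v\<in>A. of_rat (u v) * v)"
      using A(1) B(4) by (intro sum.mono_neutral_cong_right) auto
    finally have "\<kappa> (\<Sum>b\<in>B. (of_rat (q b) :: real) *\<^sub>R b) = 0" using A(3) by (simp add: \<kappa>_comb)
    then have "(\<Sum>b\<in>B. (of_rat (q b) :: real) *\<^sub>R b) = 0" using comb \<kappa>_eq_0 by blast
    then have "\<forall>b\<in>B. (of_rat (q b) :: real) = 0"
      using B(2)[unfolded independent_explicit, THEN conjunct2, THEN spec[of _ "\<lambda>b. of_rat (q b)"]] by simp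
    then show "u v = 0" using A(1,4) by (auto simp: q_def split: if_splits)
  qed
  have "\<kappa> ` B \<subseteq> K" using BE by (auto simp: K_eq)
  then have "rat_complex.span (\<kappa> ` B) = rat_complex.span K"
    using span by (metis rat_complex.span_mono rat_complex.span_span subset_antisym)
  then have "rat_complex.dim K = card (\<kappa> ` B)"
    using rat_complex.dim_eq_card[OF _ ind] by simp
  also have "\<dots> = card B" using inj by (rule card_image)
  also have "\<dots> = DIM((real^'s) \<times> (complex^'t))"
    using B(2,3) by (metis basis_card_eq_dim dim_UNIV subset_UNIV)
  also have "\<dots> = CARD('s) + 2 * CARD('t)" by simp
  finally show "rat_complex.dim K = CARD('s) + 2 * CARD('t)" .
qed

lemma embedding_of_rat:
  assumes "\<tau> \<in> embeddings K"
  shows "\<tau> (of_rat q) = of_rat q"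
proof -
  have add: "\<tau> (x + y) = \<tau> x + \<tau> y" and mult: "\<tau> (x * y) = \<tau> x * \<tau> y" if "x \<in> K" "y \<in> K" for x y
    using assms that by (auto simp: embeddings_def)
  have 1: "\<tau> 1 = 1" using assms by (simp add: embeddings_def)
  have int: "of_int n \<in> K" for n using of_rat_in_K[of "of_int n"] by simp
  then have nat: "of_nat n \<in> K" for n by (metis of_int_of_nat_eq)
  have 0: "\<tau> 0 = 0" using add[of 0 0] int[of 0] by simp
  have tnat: "\<tau> (of_nat n) = of_nat n" for n
    by (induction n) (use add[OF int[of 1] nat] 0 1 in simp_all)
  have tint: "\<tau> (of_int n) = of_int n" for n
  proof (cases n)
    case (nonneg m) then show ?thesis using tnat by simp
  next
    case (neg m)
    have "\<tau> (of_int n + of_nat (Suc m)) = \<tau> (of_int n) + of_nat (Suc m)"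
      using add[OF int nat] tnat by metis
    moreover have n: "of_int n = - (of_nat (Suc m) :: complex)" using neg by simp
    ultimately have "\<tau> (of_int n) + of_nat (Suc m) = 0" using 0 by simp
    then show ?thesis unfolding n by (simp only: eq_neg_iff_add_eq_0)
  qed
  obtain a b where q: "q = Fract a b" "b > 0" by (cases q) auto
  have "of_rat q * of_int b = (of_int a :: complex)" using q by (simp add: of_rat_rat)
  then have "\<tau> (of_rat q) * of_int b = of_int a" using mult[OF of_rat_in_K int] tint by metis
  then show ?thesis using q by (simp add: of_rat_rat field_simps)
qed

text \<open>An embedding \<open>\<tau>\<close> extends to a real-linear map on the fibre and is therefore a linear combination
  of the coordinates \<open>\<sigma> a\<close>. Comparing coefficients in \<open>\<tau> (x * y) = \<tau> x * \<tau> y\<close> gives \<open>\<tau> = \<sigma> a\<close>.\<close>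

lemma embeddings_K: "embeddings K = range \<sigma>"
proof
  show "range \<sigma> \<subseteq> embeddings K" using \<sigma>_embedding by blast
  show "embeddings K \<subseteq> range \<sigma>"
  proof
    fix \<tau> assume \<tau>: "\<tau> \<in> embeddings K"
    then have add: "\<tau> (x + y) = \<tau> x + \<tau> y" and mult: "\<tau> (x * y) = \<tau> x * \<tau> y" if "x \<in> K" "y \<in> K" for x y
      using that by (auto simp: embeddings_def)
    obtain B where B: "B \<subseteq> fibre" "independent B" "span B = UNIV" "finite B" "E = rat_real.span B"
      by (rule fibre_basis_exists)
    \<comment> \<open>\<open>T\<close> extends the composite of \<open>\<kappa>\<close> and
      \<open>\<tau>\<close> from the real basis \<open>B\<close>. Since \<open>B\<close> spans
      \<open>E\<close> over the rationals and \<open>\<tau>\<close> fixes these, the two agree on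
      all of \<open>E\<close>.\<close>
    obtain T where T: "linear T" "\<And>b. b \<in> B \<Longrightarrow> T b = \<tau> (\<kappa> b)"
      using linear_independent_extend[OF B(2), of "\<lambda>b. \<tau> (\<kappa> b)"] by blast
    have \<kappa>K: "\<kappa> y \<in> K" if "y \<in> E" for y using that by (simp add: K_eq)
    have "y \<in> E \<and> T y = \<tau> (\<kappa> y)" if "y \<in> rat_real.span B" for y
      using that
    proof (rule rat_real.span_induct)
      have "\<tau> 0 = 0" using embedding_of_rat[OF \<tau>, of 0] by simp
      then show "rat_real.subspace {y. y \<in> E \<and> T y = \<tau> (\<kappa> y)}"
        using embedding_of_rat[OF \<tau>]
        by (auto intro!: rat_real.subspaceI rat_real.subspace_0[OF subspace_E] rat_real.subspace_add[OF subspace_E]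
            rat_real.subspace_scale[OF subspace_E]
            simp del: add_Pair scaleR_Pair
            simp: linear_0[OF T(1)] \<kappa>_0 linear_add[OF T(1)] \<kappa>_add add \<kappa>K linear_scale[OF T(1)] \<kappa>_scale mult of_rat_in_K
              scaleR_of_rat_complex)
      show "x \<in> E \<and> T x = \<tau> (\<kappa> x)" if "x \<in> B" for x
        using that T(2) B(5) rat_real.span_base by auto
    qed
    then have T_eq: "T y = \<tau> (\<kappa> y)" if "y \<in> E" for y using that B(5) by blast
    obtain c where c: "\<And>y. T y = (\<Sum>a\<in>UNIV. c a * OT_coord y $ a)"
      using real_linear_in_OT_coord[OF T(1)] by blast
    define d where "d a = c a * OT_coord gen $ a" for a
    have d: "\<tau> (\<alpha> $ a0) = (\<Sum>a\<in>UNIV. d a * \<alpha> $ a)" if \<alpha>: "\<alpha> \<in> R" for \<alpha>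
    proof -
      obtain y where y: "y \<in> E" "\<alpha> * OT_coord gen = OT_coord y"
        using R_acts_on_E[OF \<alpha> gen(1)] by blast
      have "\<alpha> $ a0 = \<kappa> y" using gen(3) by (simp add: \<kappa>_def flip: y(2))
      then have "\<tau> (\<alpha> $ a0) = (\<Sum>a\<in>UNIV. c a * OT_coord y $ a)"
        using T_eq[OF y(1)] c by simp
      then show ?thesis by (simp add: d_def mult_ac flip: y(2))
    qed
    have "\<exists>a. d a \<noteq> 0"
    proof (rule ccontr)
      assume "\<nexists>a. d a \<noteq> 0"
      then have "\<tau> 1 = 0" using d[OF one_in_R] by simp
      then show False using \<tau> by (simp add: embeddings_def)
    qed
    then obtain a where a: "d a \<noteq> 0" by blast
    have "\<tau> (\<alpha> $ a0) = \<sigma> a (\<alpha> $ a0)" if \<alpha>: "\<alpha> \<in> R" for \<alpha>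
    proof -
      \<comment> \<open>For fixed \<open>\<alpha>\<close>, multiplicativity is a linear relation in
        \<open>\<beta>\<close>, and independence kills its coefficient at \<open>a\<close>, where
        \<open>d a\<close> is nonzero. As \<open>a\<close> was chosen before
        \<open>\<alpha>\<close>, one index serves all of \<open>R\<close>.\<close>
      have "(\<Sum>b\<in>UNIV. (d b * (\<alpha> $ b - \<tau> (\<alpha> $ a0))) * \<beta> $ b) = 0" if "\<beta> \<in> R" for \<beta>
      proof -
        have "(\<Sum>b\<in>UNIV. d b * (\<alpha> $ b * \<beta> $ b)) = \<tau> (\<alpha> $ a0 * \<beta> $ a0)"
          using d[OF mult_in_R[OF \<alpha> that]] by simp
        also have "\<dots> = \<tau> (\<alpha> $ a0) * (\<Sum>b\<in>UNIV. d b * \<beta> $ b)"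
          using d[OF that] KI \<alpha> that by (simp add: mult)
        finally show ?thesis
          by (simp add: algebra_simps sum_subtractf sum_distrib_left)
      qed
      from R_functional_eq_0[OF this, of a] show ?thesis using a \<sigma>_nth[OF \<alpha>] by simp
    qed
    then have "\<tau> k = \<sigma> a k" if "k \<in> K" for k using that by (auto elim: KE)
    moreover have "\<tau> k = \<sigma> a k" if "k \<notin> K" for k
      using that \<tau> by (simp add: \<sigma>_def embeddings_def extensional_def)
    ultimately have "\<tau> = \<sigma> a" by blast
    then show "\<tau> \<in> range \<sigma>" by blast
  qed
qed

lemma R_real: "\<alpha> \<in> R \<Longrightarrow> \<alpha> $ Inl j \<in> \<real>"
proof (induction rule: R_induct)
  case subspace
  then show ?case
    by (auto intro!: rat_real.subspaceI simp: scaleR_conv_of_real[where 'a = complex])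
qed simp

lemma R_conj: "\<alpha> \<in> R \<Longrightarrow> \<alpha> $ Inr (Inl i) = cnj (\<alpha> $ Inr (Inr i))"
proof (induction rule: R_induct)
  case subspace
  then show ?case
    by (auto intro!: rat_real.subspaceI)
qed simp

lemma embedding_labelling_\<sigma>: "embedding_labelling K \<sigma>"
  unfolding embedding_labelling_def
proof (intro conjI allI ballI)
  show "bij_betw \<sigma> UNIV (embeddings K)"
    using inj_\<sigma> by (simp add: bij_betw_def embeddings_K)
  show "\<sigma> (Inl j) ` K \<subseteq> \<real>" for j
    by (auto elim!: KE simp: \<sigma>_nth R_real)
  show conj: "\<sigma> (Inr (Inl i)) x = cnj (\<sigma> (Inr (Inr i)) x)" if "x \<in> K" for i x
    using that by (auto elim!: KE simp: \<sigma>_nth R_conj)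
  show "\<not> \<sigma> (Inr b) ` K \<subseteq> \<real>" for b
  proof
    assume real: "\<sigma> (Inr b) ` K \<subseteq> \<real>"
    obtain i where i: "b = Inl i \<or> b = Inr i" by (metis sumE)
    \<comment> \<open>A real-valued member of a conjugate pair would coincide with its partner,
      against the injectivity of the labelling.\<close>
    have "\<sigma> (Inr (Inl i)) x = \<sigma> (Inr (Inr i)) x" for x
    proof (cases "x \<in> K")
      case True
      then have "\<sigma> (Inr b) x \<in> \<real>" using real by blast
      then show ?thesis using conj[OF True, of i] i by (metis Reals_cnj_iff complex_cnj_cnj)
    next
      case False then show ?thesis by (simp add: \<sigma>_def)
    qed
    then have "\<sigma> (Inr (Inl i)) = \<sigma> (Inr (Inr i))" by blast
    then show False using injD[OF inj_\<sigma>] by blast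
  qed
qed

end

section \<open>The units of a lattice of simple type\<close>

lemma OT_character_nonzero: "OT_character C x $ a \<noteq> 0"
  by (cases a; cases "projr a") auto

lemma OT_character_minus: "OT_character C (- x) $ a = inverse (OT_character C x $ a)"
proof -
  have "OT_character C x $ a * OT_character C (- x) $ a = 1"
    using arg_cong[OF OT_character_add[of C x "- x"], of "\<lambda>v. v $ a"] by (simp add: OT_character_0)
  then show ?thesis by (rule inverse_unique[symmetric])
qed

lemma OT_character_of_int_scaleR: "OT_character C (of_int n *\<^sub>R x) $ a = OT_character C x $ a powi n"
proof -
  have nat: "OT_character C (of_nat m *\<^sub>R x) $ a = (OT_character C x $ a) ^ m" for m
    by (induction m) (simp_all add: OT_character_0 scaleR_left_distrib OT_character_add)
  show ?thesis
  proof (cases n)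
    case (nonneg m) then show ?thesis using nat[of m] by simp
  next
    case (neg m)
    then show ?thesis
      using nat[of "Suc m"] OT_character_minus[of C "real (Suc m) *\<^sub>R x" a]
      by (simp add: power_int_minus del: of_nat_Suc power_Suc)
  qed
qed

lemma OT_character_sum: "OT_character C (\<Sum>k\<in>A. f k) $ a = (\<Prod>k\<in>A. OT_character C (f k) $ a)"
  by (induction A rule: infinite_finite_induct) (simp_all add: OT_character_0 OT_character_add)

text \<open>All other exponents lie below \<open>k\<close>, so collecting terms gives a monic
  polynomial with integer coefficients. The hypotheses have the shape of the relation that the
  pigeonhole argument supplies.\<close>

lemma algebraic_int_monic:
  fixes u :: "'a::field_char_0"
  assumes "finite B" "l < k" "\<And>b. b \<in> B \<Longrightarrow> i b < k"
    and eq: "u ^ k = u ^ l + (\<Sum>b\<in>B. of_int (n b) * u ^ i b)"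
  shows "algebraic_int u"
proof -
  define q where "q = monom 1 l + (\<Sum>b\<in>B. monom (of_int (n b) :: 'a) (i b))"
  have "degree (\<Sum>b\<in>B. monom (of_int (n b) :: 'a) (i b)) < k"
    using assms(2,3) by (intro degree_sum_less) (auto intro: le_less_trans[OF degree_monom_le])
  then have "degree q < k"
    unfolding q_def using assms(2) by (intro degree_add_less) (auto simp: degree_monom_eq)
  then have "lead_coeff (- q + monom 1 k) = lead_coeff (monom (1::'a) k)"
    by (intro lead_coeff_add_le) (simp add: degree_monom_eq)
  then have "lead_coeff (- q + monom 1 k) = 1" by (simp add: degree_monom_eq)
  moreover have "coeff (- q + monom 1 k) j \<in> \<int>" for j
    by (auto simp: q_def coeff_sum intro!: Ints_add Ints_diff Ints_minus Ints_sum)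
  moreover have "poly (- q + monom 1 k) u = 0"
    by (simp add: q_def poly_sum poly_monom eq)
  ultimately show ?thesis using algebraic_int.intros by blast
qed

lemma group_additive_group: "group (additive_group :: 'a::ab_group_add monoid)"
  by (rule groupI) (auto simp: additive_group_def add.assoc intro: exI[of _ "- _"])

lemma inv_additive_group: "inv\<^bsub>additive_group\<^esub> x = - (x :: 'a::ab_group_add)"
  by (rule group.inv_equality[OF group_additive_group]) (simp_all add: additive_group_def)

text \<open>The closed ball of radius \<open>r\<close> meets every coset, so its image, which is
  compact, is the whole quotient.\<close>

lemma (in discrete_subgroup) is_lattice_additive_group:
  assumes r: "\<And>v. \<exists>x\<in>S. norm (v - x) \<le> r"
  shows "is_lattice additive_group euclidean S"
  unfolding is_lattice_def
proof (intro conjI)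
  show "subgroup S additive_group"
    by (rule subgroup.intro) (auto simp: inv_additive_group minus, auto simp: additive_group_def zero add)
  obtain e where e: "e > 0" "\<And>x. x \<in> S \<Longrightarrow> norm x < e \<Longrightarrow> x = 0" using discrete by blast
  have "openin (subtopology euclidean S) {x}" if "x \<in> S" for x
  proof -
    have "{x} = ball x e \<inter> S"
      using that e diff by (force simp: dist_norm)
    then show ?thesis by (metis open_ball openin_open Int_commute)
  qed
  then show "subtopology euclidean S = discrete_topology S"
    by (metis discrete_topology_unique topspace_euclidean_subtopology)
  define q where "q g = S #>\<^bsub>additive_group\<^esub> g" for g :: 'a
  have "q g \<in> q ` cball 0 r" for g
  proof -
    obtain x where x: "x \<in> S" "norm (g - x) \<le> r" using r by blast
    have "q g = q (g - x)"
      unfolding q_def r_coset_def additive_group_def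
    proof (intro equalityI subsetI)
      fix z assume "z \<in> (\<Union>h\<in>S. {h \<otimes>\<^bsub>\<lparr>carrier = UNIV, monoid.mult = (+), one = 0\<rparr>\<^esub> g})"
      then obtain h where "h \<in> S" "z = (h + x) + (g - x)" by auto
      then show "z \<in> (\<Union>h\<in>S. {h \<otimes>\<^bsub>\<lparr>carrier = UNIV, monoid.mult = (+), one = 0\<rparr>\<^esub> (g - x)})"
        using add[of h x] x(1) by (intro UN_I[of "h + x"]) auto
    next
      fix z assume "z \<in> (\<Union>h\<in>S. {h \<otimes>\<^bsub>\<lparr>carrier = UNIV, monoid.mult = (+), one = 0\<rparr>\<^esub> (g - x)})"
      then obtain h where "h \<in> S" "z = (h - x) + g" by auto
      then show "z \<in> (\<Union>h\<in>S. {h \<otimes>\<^bsub>\<lparr>carrier = UNIV, monoid.mult = (+), one = 0\<rparr>\<^esub> g})"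
        using diff[of h x] x(1) by (intro UN_I[of "h - x"]) auto
    qed
    with x(2) show ?thesis by auto
  qed
  then have "q ` UNIV = q ` cball 0 r" by blast
  moreover have "compactin (quotient_topology euclidean q) (q ` cball 0 r)"
    using quotient_imp_continuous_map[OF quotient_map_quotient_topology]
    by (intro image_compactin[of euclidean]) (auto simp: compactin_euclidean_iff)
  ultimately show "compact_space (quotient_topology euclidean (\<lambda>g. S #>\<^bsub>additive_group\<^esub> g))"
    by (simp add: compact_space_def topspace_quotient_topology flip: q_def[abs_def])
qed

context OT_simple_lattice
begin

text \<open>By the pigeonhole principle an integral relation holds between the powers of \<open>OT_phi C x\<close>
  applied to an element of the fibre, and it is monic in the largest power.\<close>

lemma algebraic_int_character:
  assumes "x \<in> base"
  shows "algebraic_int (OT_character C x $ a)"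
proof -
  obtain g where g: "g \<in> fibre" "g \<noteq> 0"
    using fibre_nonzero by blast
  then have g0: "OT_coord g $ a \<noteq> 0"
    by (intro coord_E_nonzero) (simp_all add: E_def rat_real.span_base)
  define v where "v k = (OT_phi C x ^^ k) g" for k
  define u where "u = OT_character C x $ a"
  have v: "v k \<in> fibre" for k
    by (induction k) (simp_all add: v_def g phi_fibre assms)
  have coord: "OT_coord (v k) $ a = u ^ k * OT_coord g $ a" for k
    by (induction k) (simp_all add: v_def OT_coord_phi u_def)
  \<comment> \<open>With \<open>B\<close> chosen inside the orbit, each of its vectors is an iterate
    \<open>v (i b)\<close>, and a relation over \<open>B\<close> becomes a polynomial relation for
    \<open>u\<close>.\<close>
  obtain B where B: "B \<subseteq> range v" "independent B" "range v \<subseteq> span B"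
    using maximal_independent_subset by blast
  have fin: "finite B" using B(2) independent_imp_finite by blast
  have "\<forall>b\<in>B. \<exists>i. v i = b" using B(1) by blast
  from bchoice[OF this] obtain i where i: "\<And>b. b \<in> B \<Longrightarrow> v (i b) = b" by blast
  \<comment> \<open>Indices beyond \<open>m\<close> exceed every exponent \<open>i b\<close>;
    inserting 0 keeps the maximum well defined without a case split.\<close>
  define m where "m = Max (insert 0 (i ` B))"
  have m: "i b \<le> m" if "b \<in> B" for b using that fin by (auto simp: m_def)
  obtain k l n where kl: "m < l" "l < k" "v k - v l = (\<Sum>b\<in>B. of_int (n b :: int) *\<^sub>R b)"
    using fibre.pigeonhole[OF fin B(2), of v m] B(1,3) v by blast
  have "OT_coord (v k) = OT_coord (v l) + (\<Sum>b\<in>B. of_int (n b) *\<^sub>R OT_coord (v (i b)))"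
    using arg_cong[OF kl(3), of OT_coord] i
    by (simp add: linear_diff[OF linear_OT_coord] linear_sum[OF linear_OT_coord] linear_scale[OF linear_OT_coord] algebra_simps)
  from arg_cong[OF this, of "\<lambda>v. v $ a"]
  have "u ^ k * OT_coord g $ a = (u ^ l + (\<Sum>b\<in>B. of_int (n b) * u ^ i b)) * OT_coord g $ a"
    by (simp add: coord scaleR_conv_of_real[where 'a = complex] sum_distrib_right distrib_right mult.assoc)
  then have "u ^ k = u ^ l + (\<Sum>b\<in>B. of_int (n b) * u ^ i b)" using g0 by simp
  then show ?thesis
    unfolding u_def[symmetric] using fin kl m by (intro algebraic_int_monic[of B l k i u n]) force+
qed

text \<open>Coordinate \<open>a0\<close> determines the whole character, by injectivity on
  \<open>R\<close>, and the real coordinates \<open>exp (x $ j)\<close> determine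
  \<open>x\<close>.\<close>

lemma character_inj: "x \<in> base \<Longrightarrow> y \<in> base \<Longrightarrow> OT_character C x $ a0 = OT_character C y $ a0 \<Longrightarrow> x = y"
proof -
  assume *: "x \<in> base" "y \<in> base" "OT_character C x $ a0 = OT_character C y $ a0"
  then have "OT_character C x = OT_character C y"
    using inj_on_R[of a0] character_in_R by (auto simp: inj_on_def)
  then have "OT_character C x $ Inl j = OT_character C y $ Inl j" for j by simp
  then show "x = y" by (simp add: vec_eq_iff)
qed

lemma UE:
  assumes "u \<in> U"
  obtains x where "x \<in> base" "u = OT_character C x $ a0"
  using assms by (auto simp: U_def)

lemma mult_subgroup_U: "mult_subgroup U"
proof -
  have "1 \<in> U" using base.zero by (force simp: U_def OT_character_0)
  moreover have "x * y \<in> U" if "x \<in> U" "y \<in> U" for x y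
    using that base.add by (auto simp: U_def simp flip: OT_character_add vector_mult_component)
  moreover have "inverse x \<in> U" if "x \<in> U" for x
    using that base.minus by (auto simp: U_def simp flip: OT_character_minus)
  moreover have "0 \<notin> U" using OT_character_nonzero by (fastforce simp: U_def)
  ultimately show ?thesis by (simp add: mult_subgroup_def)
qed

lemma U_positive_units: "U \<subseteq> positive_units K \<sigma>"
proof
  have int: "u \<in> ring_of_integers K" if "u \<in> U" for u
    using that by (auto simp: ring_of_integers_def algebraic_int_character character_in_R KI elim!: UE)
  fix u assume u: "u \<in> U"
  then have "inverse u \<in> U" "u \<noteq> 0" using mult_subgroup_U by (auto simp: mult_subgroup_def)
  moreover have "Re (\<sigma> (Inl j) u) > 0" for j
    using u by (auto simp: \<sigma>_character elim!: UE)
  ultimately show "u \<in> positive_units K \<sigma>"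
    using int u by (simp add: positive_units_def)
qed

lemma log_U: "(\<lambda>u. \<chi> j. ln (Re (\<sigma> (Inl j) u))) ` U = base"
proof -
  have "(\<chi> j. ln (Re (\<sigma> (Inl j) (OT_character C x $ a0)))) = x" if "x \<in> base" for x
    using that by (simp add: \<sigma>_character vec_eq_iff)
  then show ?thesis by (force simp: U_def image_image)
qed

text \<open>An integral basis of \<open>base\<close> becomes a multiplicative one of
  \<open>U\<close>, because characters turn sums into products and are injective on
  \<open>base\<close>.\<close>

lemma mult_basis_U_exists:
  obtains c where "range c \<subseteq> base" "mult_basis U (\<lambda>k::'s. OT_character C (c k) $ a0)"
proof -
  obtain c :: "'s \<Rightarrow> real^'s" where c: "range c \<subseteq> base" "det (\<chi> k. c k) \<noteq> 0"
      "\<And>x. x \<in> base \<Longrightarrow> \<exists>e :: 's \<Rightarrow> int. x = (\<Sum>k\<in>UNIV. of_int (e k) *\<^sub>R c k)"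
    using lattice_basis_exists[OF base.discrete_subgroup_axioms span_base_eq] by blast
  define s where "s e = (\<Sum>k\<in>UNIV. of_int (e k) *\<^sub>R c k)" for e :: "'s \<Rightarrow> int"
  have char_s: "(\<Prod>k\<in>UNIV. OT_character C (c k) $ a0 powi e k) = OT_character C (s e) $ a0" for e
    by (simp add: s_def OT_character_sum OT_character_of_int_scaleR)
  have s: "s e \<in> base" for e
  proof -
    have "(\<Sum>k\<in>A. of_int (e k) *\<^sub>R c k) \<in> base" for A
      using c(1) by (induction A rule: infinite_finite_induct) (auto intro: base.zero base.add base.of_int_scaleR)
    then show ?thesis by (simp add: s_def)
  qed
  have "e k = e' k" if "s e = s e'" for e e' k
  proof -
    have "(\<Sum>k\<in>UNIV. of_int (e k - e' k) *\<^sub>R c k) = 0"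
      using that by (simp add: s_def scaleR_left_diff_distrib sum_subtractf)
    from combinations_of_rows_det_neq_0(2)[OF c(2) this, of k] show ?thesis by simp
  qed
  then have inj: "inj s" by (intro injI ext)
  have surj: "range s = base"
  proof
    show "base \<subseteq> range s" using c(3) unfolding s_def by blast
  qed (use s in blast)
  have "bij_betw (\<lambda>x. OT_character C x $ a0) base U"
    by (auto simp: bij_betw_def U_def inj_on_def intro: character_inj)
  then have "bij_betw ((\<lambda>x. OT_character C x $ a0) \<circ> s) UNIV U"
    by (rule bij_betw_trans[rotated]) (simp add: bij_betw_def inj surj)
  then have "mult_basis U (\<lambda>k. OT_character C (c k) $ a0)"
    by (simp add: mult_basis_def char_s o_def)
  then show ?thesis using that c(1) by blast
qed

end

section \<open>The rank of a group with a multiplicative basis\<close>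

lemma mult_basis_has_rank:
  fixes a :: "'s::finite \<Rightarrow> complex"
  assumes a: "mult_basis V a" and "mult_subgroup V"
  shows "has_rank V CARD('s)"
proof -
  define p where "p e = (\<Prod>k\<in>UNIV. a k powi e k)" for e :: "'s \<Rightarrow> int"
  have inj: "p e = p e' \<Longrightarrow> e = e'" and surj: "range p = V" for e e'
    using a by (auto simp: mult_basis_def bij_betw_def p_def inj_on_def)
  have unit: "p (\<lambda>k. if k = l then 1 else 0) = a l" for l
    by (simp add: p_def if_distrib[where f = "\<lambda>e. _ powi e"] cong: if_cong)
  have p0: "p (\<lambda>_. 0) = 1" by (simp add: p_def)
  have "inj a"
  proof (rule injI)
    fix k l assume "a k = a l"
    then have "(\<lambda>i. if i = k then 1 else 0 :: int) = (\<lambda>i. if i = l then 1 else 0)"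
      by (intro inj) (simp add: unit)
    from fun_cong[OF this, of k] show "k = l" by (simp split: if_splits)
  qed
  have ra: "range a \<subseteq> V" using unit surj by (metis image_subsetI rangeI)
  have p_range: "p (\<lambda>k. e (a k)) = (\<Prod>x\<in>range a. x powi e x)" for e
    by (simp add: p_def prod.reindex[OF \<open>inj a\<close>])
  have "mult_independent (range a)"
    unfolding mult_independent_def
  proof (intro allI impI, elim conjE, intro ballI)
    fix F e x assume F: "finite F" "F \<subseteq> range a" "(\<Prod>x\<in>F. x powi e x) = 1" "x \<in> F"
    define e' where "e' x = (if x \<in> F then e x else 0)" for x
    have "p (\<lambda>k. e' (a k)) = (\<Prod>x\<in>F. x powi e x)"
      unfolding p_range using F(1,2) by (intro prod.mono_neutral_cong_right) (auto simp: e'_def)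
    then have "(\<lambda>k. e' (a k)) = (\<lambda>_. 0)" by (intro inj) (simp add: F(3) p0)
    moreover obtain k where "x = a k" using F(2,4) by blast
    ultimately show "e x = 0" using F(4) by (metis e'_def)
  qed
  moreover have "B = range a" if B: "B \<subseteq> V" "range a \<subseteq> B" "mult_independent B" for B
  proof (rule ccontr)
    assume "B \<noteq> range a"
    then obtain u where u: "u \<in> B" "u \<notin> range a" using B(2) by blast
    then obtain e where e: "u = p e" using B(1) surj by blast
    \<comment> \<open>Exponent -1 at \<open>u\<close> cancels the expansion of \<open>u\<close> in
      the basis, which gives a relation with a nonzero exponent.\<close>
    define e' where "e' x = (if x = u then - 1 else e (inv_into UNIV a x))" for x
    have "u \<noteq> 0" using u(1) B(1) assms(2) by (auto simp: mult_subgroup_def)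
    have "(\<Prod>x\<in>range a. x powi e' x) = p (\<lambda>k. e' (a k))" by (simp add: p_range)
    also have "(\<lambda>k. e' (a k)) = e"
      using u(2) \<open>inj a\<close> by (auto simp: e'_def fun_eq_iff)
    finally have "(\<Prod>x\<in>insert u (range a). x powi e' x) = 1"
      using u(2) \<open>u \<noteq> 0\<close> by (simp add: e'_def e power_int_minus)
    moreover have "finite (insert u (range a))" "insert u (range a) \<subseteq> B" using u(1) B(2) by auto
    ultimately have "\<forall>x\<in>insert u (range a). e' x = 0"
      using B(3)[unfolded mult_independent_def, rule_format, of "insert u (range a)" e'] by blast
    then show False by (simp add: e'_def)
  qed
  ultimately show ?thesis
    unfolding has_rank_def using ra \<open>inj a\<close> by (intro exI[of _ "range a"]) (auto simp: card_image)
qed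

context OT_simple_lattice
begin

lemma admissible_U: "admissible K \<sigma> U"
proof -
  obtain r where r: "\<And>v. \<exists>x\<in>base. norm (v - x) \<le> r" using base_cocompact by blast
  obtain c where "mult_basis U (\<lambda>k::'s. OT_character C (c k) $ a0)"
    by (rule mult_basis_U_exists)
  from mult_basis_has_rank[OF this mult_subgroup_U] show ?thesis
    unfolding admissible_def log_U
    using mult_subgroup_U U_positive_units base.is_lattice_additive_group[OF r] by simp
qed

lemma OT_manifold_K_U: "OT_manifold K U (OT_quotient K \<sigma> U)"
  unfolding OT_manifold_def
  using number_field_K dim_K embedding_labelling_\<sigma> admissible_U by blast

text \<open>The exponential relation holds by construction: the coordinates \<open>Inl j\<close> of
  a character are \<open>exp (x $ j)\<close>, so their logarithms recover \<open>x\<close>, and the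
  coordinate \<open>Inr (Inl i)\<close> is the prescribed exponential.\<close>

lemma associated_to_OT_K_U:
  assumes "lie_isomorphic G (OT_group C)"
  shows "associated_to_OT TYPE('s) TYPE('t) G K U"
proof -
  obtain c where c: "range c \<subseteq> base" "mult_basis U (\<lambda>k::'s. OT_character C (c k) $ a0)"
    by (rule mult_basis_U_exists)
  have "\<sigma> a (OT_character C (c k) $ a0) = OT_character C (c k) $ a" for a k
    using c(1) by (intro \<sigma>_character) auto
  then show ?thesis
    unfolding associated_to_OT_def using embedding_labelling_\<sigma> c(2) assms
    by (intro exI[of _ \<sigma>] exI[of _ "\<lambda>k. OT_character C (c k) $ a0"] exI[of _ C]) simp
qed

end

section \<open>Evaluating the rational tensor product\<close>

lemma comm_group_additive_group: "comm_group (additive_group :: 'a::ab_group_add monoid)"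
  by (rule group.group_comm_groupI[OF group_additive_group]) (simp add: additive_group_def add.commute)

locale tensor_evaluation =
  fixes A :: "('a, 'b) monoid_scheme" and w :: "'a \<Rightarrow> 'v::real_vector"
  assumes mult_closed: "a \<in> carrier A \<Longrightarrow> b \<in> carrier A \<Longrightarrow> a \<otimes>\<^bsub>A\<^esub> b \<in> carrier A"
    and w_mult: "a \<in> carrier A \<Longrightarrow> b \<in> carrier A \<Longrightarrow> w (a \<otimes>\<^bsub>A\<^esub> b) = w a + w b"
begin

abbreviation F where "F \<equiv> tensor_free A"

abbreviation Rel where "Rel \<equiv> tensor_relations A"

text \<open>The balanced map that multiplies \<open>w a\<close> by \<open>q\<close>, extended
  additively to the free group. The universal property yields existence, hence the choice
  operator.\<close>

definition ev where
  "ev = (SOME h. h \<in> hom F additive_group \<and>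
     (\<forall>a\<in>carrier A. \<forall>q. h (frag_of (a, q)) = (of_rat q :: real) *\<^sub>R w a))"

lemma ev: "ev \<in> hom F additive_group"
  and ev_frag_of: "a \<in> carrier A \<Longrightarrow> ev (frag_of (a, q)) = (of_rat q :: real) *\<^sub>R w a"
proof -
  obtain h where "h \<in> hom F (additive_group :: 'v monoid)"
      "\<And>x. x \<in> carrier A \<times> UNIV \<Longrightarrow> h (frag_of x) = (case x of (a, q) \<Rightarrow> (of_rat q :: real) *\<^sub>R w a)"
    using comm_group.free_Abelian_group_universal[OF comm_group_additive_group,
        of "\<lambda>(a, q). (of_rat q :: real) *\<^sub>R w a" "carrier A \<times> UNIV"]
    unfolding tensor_free_def by (auto simp: additive_group_def)
  then have "\<exists>h. h \<in> hom F additive_group \<and>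
     (\<forall>a\<in>carrier A. \<forall>q. h (frag_of (a, q)) = (of_rat q :: real) *\<^sub>R w a)" by auto
  from someI_ex[OF this] show "ev \<in> hom F additive_group"
    "a \<in> carrier A \<Longrightarrow> ev (frag_of (a, q)) = (of_rat q :: real) *\<^sub>R w a"
    unfolding ev_def by blast+
qed

lemma group_F: "group F"
  by (simp add: tensor_free_def)

lemma F_simps [simp]: "x \<otimes>\<^bsub>F\<^esub> y = x + y" "\<one>\<^bsub>F\<^esub> = 0"
  "x \<in> carrier F \<Longrightarrow> inv\<^bsub>F\<^esub> x = - x" "frag_of (a, q) \<in> carrier F \<longleftrightarrow> a \<in> carrier A"
  by (simp_all add: tensor_free_def)

lemma F_add: "x \<in> carrier F \<Longrightarrow> y \<in> carrier F \<Longrightarrow> x + y \<in> carrier F"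
  using group.is_monoid[OF group_F] monoid.m_closed by fastforce

lemma F_minus: "x \<in> carrier F \<Longrightarrow> - x \<in> carrier F"
  using group.inv_closed[OF group_F] by fastforce

lemma F_diff: "x \<in> carrier F \<Longrightarrow> y \<in> carrier F \<Longrightarrow> x - y \<in> carrier F"
  using F_add[OF _ F_minus] by fastforce

lemma F_zero: "0 \<in> carrier F"
  using monoid.one_closed[OF group.is_monoid[OF group_F]] by simp

lemma F_induct [consumes 1, case_names zero diff frag_of]:
  assumes "x \<in> carrier F" "P 0"
    "\<And>x y. x \<in> carrier F \<Longrightarrow> y \<in> carrier F \<Longrightarrow> P x \<Longrightarrow> P y \<Longrightarrow> P (x - y)"
    "\<And>a q. a \<in> carrier A \<Longrightarrow> P (frag_of (a, q))"
  shows "P x"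
  using assms free_Abelian_group_induct[of x "carrier A \<times> UNIV" P] by (auto simp: tensor_free_def)

lemma ev_add: "x \<in> carrier F \<Longrightarrow> y \<in> carrier F \<Longrightarrow> ev (x + y) = ev x + ev y"
  using hom_mult[OF ev] by (simp add: additive_group_def)

lemma ev_diff: "x \<in> carrier F \<Longrightarrow> y \<in> carrier F \<Longrightarrow> ev (x - y) = ev x - ev y"
  using ev_add[of "x - y" y] F_diff by (simp add: algebra_simps)

lemma ev_zero: "ev 0 = 0"
  using ev_diff[of 0 0] F_zero by simp

lemma Rel_induct [consumes 1, case_names zero left right minus add]:
  assumes "x \<in> Rel" "P 0"
    "\<And>a b q. a \<in> carrier A \<Longrightarrow> b \<in> carrier A \<Longrightarrow>
       P (frag_of (a \<otimes>\<^bsub>A\<^esub> b, q) - frag_of (a, q) - frag_of (b, q))"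
    "\<And>a q r. a \<in> carrier A \<Longrightarrow> P (frag_of (a, q + r) - frag_of (a, q) - frag_of (a, r))"
    "\<And>x. x \<in> carrier F \<Longrightarrow> P x \<Longrightarrow> P (- x)"
    "\<And>x y. x \<in> Rel \<Longrightarrow> y \<in> Rel \<Longrightarrow> P x \<Longrightarrow> P y \<Longrightarrow> P (x + y)"
  shows "P x"
proof -
  have gen: "h \<in> carrier F \<and> P h" if
    "h \<in> {frag_of (a \<otimes>\<^bsub>A\<^esub> b, q) - frag_of (a, q) - frag_of (b, q) | a b q.
         a \<in> carrier A \<and> b \<in> carrier A} \<union>
      {frag_of (a, q + r) - frag_of (a, q) - frag_of (a, r) | a q r. a \<in> carrier A}" for h
    using that assms(3,4) by (auto intro!: F_diff simp: mult_closed)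
  have "x \<in> generate F ({frag_of (a \<otimes>\<^bsub>A\<^esub> b, q) - frag_of (a, q) - frag_of (b, q) | a b q.
         a \<in> carrier A \<and> b \<in> carrier A} \<union>
      {frag_of (a, q + r) - frag_of (a, q) - frag_of (a, r) | a q r. a \<in> carrier A})"
    using assms(1) by (simp add: tensor_relations_def)
  then show ?thesis
  proof induction
    case one then show ?case using assms(2) by simp
  next
    case (incl h) then show ?case using gen by blast
  next
    case (inv h)
    with gen[OF this] assms(5) show ?case by simp
  next
    case (eng h1 h2) then show ?case using assms(6) by (simp add: tensor_relations_def)
  qed
qed

lemma Rel_subset: "Rel \<subseteq> carrier F"
proof
  fix x assume "x \<in> Rel"
  then show "x \<in> carrier F"
    by (induction rule: Rel_induct) (auto intro!: F_zero F_diff F_minus F_add simp: mult_closed)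
qed

lemma ev_Rel: "x \<in> Rel \<Longrightarrow> ev x = 0"
proof (induction rule: Rel_induct)
  case (minus x)
  then show ?case using ev_diff[OF F_zero, of x] by (simp add: ev_zero)
next
  case (add x y)
  then show ?case using Rel_subset by (simp add: ev_add subset_iff)
qed (simp_all add: ev_zero ev_diff ev_frag_of F_diff mult_closed w_mult scaleR_right_distrib
    scaleR_left_distrib of_rat_add)

lemma subgroup_Rel: "subgroup Rel F"
  unfolding tensor_relations_def
  by (rule group.generate_is_subgroup[OF group_F]) (auto intro!: F_diff simp: mult_closed)

lemma normal_Rel: "Rel \<lhd> F"
proof (rule comm_group.subgroup_imp_normal[OF _ subgroup_Rel])
  show "comm_group F" by (simp add: tensor_free_def abelian_free_Abelian_group)
qed

lemma Rel_zero: "0 \<in> Rel"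
  using subgroup.one_closed[OF subgroup_Rel] by simp

lemma Rel_add: "x \<in> Rel \<Longrightarrow> y \<in> Rel \<Longrightarrow> x + y \<in> Rel"
  using subgroup.m_closed[OF subgroup_Rel] by fastforce

lemma Rel_minus: "x \<in> Rel \<Longrightarrow> - x \<in> Rel"
  using subgroup.m_inv_closed[OF subgroup_Rel, of x] Rel_subset by auto

lemma coset_eq: "Rel #>\<^bsub>F\<^esub> c = {r + c | r. r \<in> Rel}"
  by (auto simp: r_coset_def)

lemma self_in_coset: "c \<in> Rel #>\<^bsub>F\<^esub> c"
  using Rel_zero by (force simp: coset_eq)

lemma coset_Rel_add:
  assumes "r \<in> Rel"
  shows "Rel #>\<^bsub>F\<^esub> (r + c) = Rel #>\<^bsub>F\<^esub> c"
proof (intro equalityI subsetI)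
  fix x assume "x \<in> Rel #>\<^bsub>F\<^esub> (r + c)"
  then obtain r' where "r' \<in> Rel" "x = (r' + r) + c" by (auto simp: coset_eq add.assoc)
  then show "x \<in> Rel #>\<^bsub>F\<^esub> c" unfolding coset_eq using Rel_add[OF _ assms] by blast
next
  fix x assume "x \<in> Rel #>\<^bsub>F\<^esub> c"
  then obtain r' where "r' \<in> Rel" "x = (r' + - r) + (r + c)" by (auto simp: coset_eq)
  then show "x \<in> Rel #>\<^bsub>F\<^esub> (r + c)" unfolding coset_eq using Rel_add[OF _ Rel_minus[OF assms]] by blast
qed

lemma ev_coset_eq:
  assumes "Rel #>\<^bsub>F\<^esub> c = Rel #>\<^bsub>F\<^esub> d" "d \<in> carrier F"
  shows "ev c = ev d"
proof -
  obtain r where "r \<in> Rel" "c = r + d"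
    using self_in_coset[of c] unfolding assms(1) by (auto simp: coset_eq)
  then show ?thesis using assms(2) Rel_subset by (auto simp: ev_add ev_Rel subset_iff)
qed

section \<open>Maps induced on the tensor product\<close>

context
  fixes \<alpha> :: "'a \<Rightarrow> 'a" and \<beta> :: "rat \<Rightarrow> rat"
  assumes \<alpha>: "\<And>a. a \<in> carrier A \<Longrightarrow> \<alpha> a \<in> carrier A"
      "\<And>a b. a \<in> carrier A \<Longrightarrow> b \<in> carrier A \<Longrightarrow> \<alpha> (a \<otimes>\<^bsub>A\<^esub> b) = \<alpha> a \<otimes>\<^bsub>A\<^esub> \<alpha> b"
    and \<beta>: "\<And>q r. \<beta> (q + r) = \<beta> q + \<beta> r"
begin

text \<open>Scalar multiplication arises with the identity as \<open>\<alpha>\<close>, the group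
  action with the identity as \<open>\<beta>\<close>.\<close>

definition lift where "lift = frag_extend (frag_of \<circ> (\<lambda>(a, q). (\<alpha> a, \<beta> q)))"

lemma lift_carrier: "c \<in> carrier F \<Longrightarrow> lift c \<in> carrier F"
  by (induction rule: F_induct) (auto simp: lift_def frag_extend_diff F_zero F_diff \<alpha>)

lemma lift_Rel: "c \<in> Rel \<Longrightarrow> lift c \<in> Rel"
proof (induction rule: Rel_induct)
  case (left a b q)
  then have "lift (frag_of (a \<otimes>\<^bsub>A\<^esub> b, q) - frag_of (a, q) - frag_of (b, q)) =
      frag_of (\<alpha> a \<otimes>\<^bsub>A\<^esub> \<alpha> b, \<beta> q) - frag_of (\<alpha> a, \<beta> q) - frag_of (\<alpha> b, \<beta> q)"
    by (simp add: lift_def frag_extend_diff \<alpha>)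
  then show ?case
    unfolding tensor_relations_def using left \<alpha>(1) by (intro generate.incl UnI1) blast
next
  case (right a q r)
  then have "lift (frag_of (a, q + r) - frag_of (a, q) - frag_of (a, r)) =
      frag_of (\<alpha> a, \<beta> q + \<beta> r) - frag_of (\<alpha> a, \<beta> q) - frag_of (\<alpha> a, \<beta> r)"
    by (simp add: lift_def frag_extend_diff \<beta>)
  then show ?case
    unfolding tensor_relations_def using right \<alpha>(1) by (intro generate.incl UnI2) blast
qed (auto simp: lift_def frag_extend_add frag_extend_minus Rel_zero Rel_add Rel_minus)

text \<open>\<open>lift\<close> preserves the relations, so all representatives of a coset yield the
  same coset and the union in \<open>tensor_map\<close> collapses to one.\<close>

lemma tensor_map_coset: "tensor_map A (\<lambda>(a, q). (\<alpha> a, \<beta> q)) (Rel #>\<^bsub>F\<^esub> c) = Rel #>\<^bsub>F\<^esub> lift c"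
proof -
  have "Rel #>\<^bsub>F\<^esub> lift d = Rel #>\<^bsub>F\<^esub> lift c" if d: "d \<in> Rel #>\<^bsub>F\<^esub> c" for d
  proof -
    obtain r where r: "r \<in> Rel" "d = r + c" using d by (auto simp: coset_eq)
    have "lift d = lift r + lift c" by (simp add: lift_def r frag_extend_add)
    then show ?thesis using coset_Rel_add[OF lift_Rel[OF r(1)]] by simp
  qed
  then show ?thesis
    unfolding tensor_map_def lift_def[symmetric] using self_in_coset[of c] by blast
qed

lemma ev_lift:
  assumes "linear T" "\<And>a q. a \<in> carrier A \<Longrightarrow> (of_rat (\<beta> q) :: real) *\<^sub>R w (\<alpha> a) = T ((of_rat q :: real) *\<^sub>R w a)"
    and "c \<in> carrier F"
  shows "ev (lift c) = T (ev c)"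
  using assms(3)
proof (induction rule: F_induct)
  case (diff x y)
  have "lift (x - y) = lift x - lift y" by (simp add: lift_def frag_extend_diff)
  then show ?case using diff by (simp add: ev_diff lift_carrier linear_diff[OF assms(1)])
next
  case (frag_of a q)
  then show ?case using assms(2) by (simp add: lift_def ev_frag_of \<alpha>)
qed (simp add: lift_def ev_zero linear_0[OF assms(1)])

end

lemma ev_lift_scale:
  assumes "c \<in> carrier F"
  shows "ev (lift (\<lambda>a. a) (\<lambda>r. q * r) c) = (of_rat q :: real) *\<^sub>R ev c"
  using assms by (intro ev_lift linear_scaleR) (auto simp: distrib_left of_rat_mult)

lemma range_ev: "ev ` carrier F = rat_real.span (w ` carrier A)"
proof
  have "ev c \<in> rat_real.span (w ` carrier A)" if "c \<in> carrier F" for c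
    using that
    by (induction rule: F_induct)
      (auto simp: ev_zero ev_diff ev_frag_of intro: rat_real.span_zero rat_real.span_diff
        rat_real.span_scale[OF rat_real.span_base[OF imageI]])
  then show "ev ` carrier F \<subseteq> rat_real.span (w ` carrier A)" by blast
  have "rat_real.subspace (ev ` carrier F)"
  proof (rule rat_real.subspaceI)
    show "0 \<in> ev ` carrier F" using F_zero ev_zero by (metis imageI)
    show "x + y \<in> ev ` carrier F" if "x \<in> ev ` carrier F" "y \<in> ev ` carrier F" for x y
      using that F_add by (auto simp flip: ev_add)
    show "(of_rat q :: real) *\<^sub>R x \<in> ev ` carrier F" if x: "x \<in> ev ` carrier F" for x q
    proof -
      obtain c where c: "c \<in> carrier F" "x = ev c" using x by blast
      have "lift (\<lambda>a. a) (\<lambda>r. q * r) c \<in> carrier F"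
        by (rule lift_carrier) (auto simp: distrib_left c)
      then show ?thesis using c ev_lift_scale[OF c(1), of q] by (metis imageI)
    qed
  qed
  moreover have "w ` carrier A \<subseteq> ev ` carrier F"
  proof
    fix x assume "x \<in> w ` carrier A"
    then obtain a where a: "a \<in> carrier A" "x = w a" by blast
    then have "x = ev (frag_of (a, 1))" by (simp add: ev_frag_of)
    then show "x \<in> ev ` carrier F" using a by (intro image_eqI) auto
  qed
  ultimately show "rat_real.span (w ` carrier A) \<subseteq> ev ` carrier F"
    by (intro rat_real.span_minimal)
qed

text \<open>\<open>W\<close> is pulled back along \<open>ev\<close> and pushed into the quotient,
  which gives an invariant submodule \<open>W'\<close>. Either outcome for \<open>W'\<close> is read
  back through \<open>ev\<close>, which vanishes on the relations and maps onto the rational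
  span.\<close>

lemma irreducible_image:
  assumes irr: "irreducible_rep rat_ring (tensor_rat A) \<Gamma> (\<lambda>\<gamma>. tensor_map A (\<lambda>(a, q). (\<alpha> \<gamma> a, q)))"
    and \<alpha>: "\<And>\<gamma> a. \<gamma> \<in> \<Gamma> \<Longrightarrow> a \<in> carrier A \<Longrightarrow> \<alpha> \<gamma> a \<in> carrier A"
      "\<And>\<gamma> a b. \<gamma> \<in> \<Gamma> \<Longrightarrow> a \<in> carrier A \<Longrightarrow> b \<in> carrier A \<Longrightarrow> \<alpha> \<gamma> (a \<otimes>\<^bsub>A\<^esub> b) = \<alpha> \<gamma> a \<otimes>\<^bsub>A\<^esub> \<alpha> \<gamma> b"
    and T: "\<And>\<gamma>. \<gamma> \<in> \<Gamma> \<Longrightarrow> linear (T \<gamma>)" "\<And>\<gamma> a. \<gamma> \<in> \<Gamma> \<Longrightarrow> a \<in> carrier A \<Longrightarrow> w (\<alpha> \<gamma> a) = T \<gamma> (w a)"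
    and W: "rat_real.subspace W" "W \<subseteq> rat_real.span (w ` carrier A)" "\<And>\<gamma>. \<gamma> \<in> \<Gamma> \<Longrightarrow> T \<gamma> ` W \<subseteq> W"
  shows "W = {0} \<or> W = rat_real.span (w ` carrier A)"
proof -
  define S where "S = {c \<in> carrier F. ev c \<in> W}"
  define W' where "W' = (\<lambda>c. Rel #>\<^bsub>F\<^esub> c) ` S"
  have car: "carrier (tensor_rat A) = carrier (F Mod Rel)" and zero: "\<zero>\<^bsub>tensor_rat A\<^esub> = Rel"
    by (simp_all add: tensor_rat_def FactGroup_def)
  have "subgroup S F"
    using rat_real.subspace_0[OF W(1)] rat_real.subspace_add[OF W(1)] rat_real.subspace_neg[OF W(1)]
      ev_diff[OF F_zero]
    by (intro subgroup.intro) (auto simp: S_def F_add F_zero F_minus ev_add ev_zero)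
  moreover have "group_hom F (F Mod Rel) (\<lambda>c. Rel #>\<^bsub>F\<^esub> c)"
    using normal.r_coset_hom_Mod[OF normal_Rel] normal.factorgroup_is_group[OF normal_Rel] group_F
    by (simp add: group_hom_def group_hom_axioms_def)
  ultimately have sub: "subgroup W' (F Mod Rel)"
    unfolding W'_def by (rule group_hom.subgroup_img_is_subgroup[rotated])
  have submod: "submodule W' rat_ring (tensor_rat A)"
  proof (intro submodule.intro submodule_axioms.intro)
    show "subgroup W' (add_monoid (tensor_rat A))" using sub by (simp add: subgroup_def m_inv_def tensor_rat_def)
    fix q X assume "X \<in> W'"
    then obtain c where c: "c \<in> carrier F" "ev c \<in> W" "X = Rel #>\<^bsub>F\<^esub> c" by (auto simp: W'_def S_def)
    have "tensor_map A (\<lambda>(a, r). (a, q * r)) X = Rel #>\<^bsub>F\<^esub> lift (\<lambda>a. a) (\<lambda>r. q * r) c"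
      unfolding c(3) by (rule tensor_map_coset) (auto simp: distrib_left)
    moreover have "lift (\<lambda>a. a) (\<lambda>r. q * r) c \<in> S"
      unfolding S_def using c ev_lift_scale[OF c(1), of q] rat_real.subspace_scale[OF W(1), of "ev c" q]
      by (auto intro!: lift_carrier simp: distrib_left)
    ultimately show "q \<odot>\<^bsub>tensor_rat A\<^esub> X \<in> W'" by (simp add: tensor_rat_def W'_def)
  qed
  have inv: "tensor_map A (\<lambda>(a, q). (\<alpha> \<gamma> a, q)) ` W' \<subseteq> W'" if g: "\<gamma> \<in> \<Gamma>" for \<gamma>
  proof
    fix Y assume "Y \<in> tensor_map A (\<lambda>(a, q). (\<alpha> \<gamma> a, q)) ` W'"
    then obtain c where c: "c \<in> carrier F" "ev c \<in> W"
        "Y = tensor_map A (\<lambda>(a, q). (\<alpha> \<gamma> a, q)) (Rel #>\<^bsub>F\<^esub> c)" by (auto simp: W'_def S_def)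
    have "Y = Rel #>\<^bsub>F\<^esub> lift (\<alpha> \<gamma>) (\<lambda>q. q) c"
      unfolding c(3) using \<alpha>[OF g] by (intro tensor_map_coset) auto
    moreover have "ev (lift (\<alpha> \<gamma>) (\<lambda>q. q) c) = T \<gamma> (ev c)"
      using \<alpha>[OF g] T[OF g] c(1) by (intro ev_lift) (auto simp: linear_scale)
    moreover have "lift (\<alpha> \<gamma>) (\<lambda>q. q) c \<in> carrier F"
      using \<alpha>[OF g] c(1) by (intro lift_carrier) auto
    ultimately show "Y \<in> W'" using W(3)[OF g] c(2) by (auto simp: W'_def S_def)
  qed
  have "W' = {Rel} \<or> W' = carrier (F Mod Rel)"
    using irr[unfolded irreducible_rep_def car zero, THEN conjunct2, THEN spec[of _ W']] submod inv by blast
  then consider "W' = {Rel}" | "W' = carrier (F Mod Rel)" by blast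
  then show ?thesis
  proof cases
    case 1
    have "x = 0" if "x \<in> W" for x
    proof -
      have "x \<in> ev ` carrier F" using \<open>x \<in> W\<close> W(2) by (auto simp: range_ev)
      then obtain c where c: "c \<in> carrier F" "x = ev c" by blast
      then have "Rel #>\<^bsub>F\<^esub> c \<in> W'" using \<open>x \<in> W\<close> by (auto simp: W'_def S_def)
      then have "c \<in> Rel" using 1 self_in_coset[of c] by auto
      then show ?thesis using c(2) ev_Rel by simp
    qed
    then show ?thesis using rat_real.subspace_0[OF W(1)] by blast
  next
    case 2
    have "x \<in> W" if "x \<in> rat_real.span (w ` carrier A)" for x
    proof -
      have "x \<in> ev ` carrier F" using that by (simp add: range_ev)
      then obtain c where c: "c \<in> carrier F" "x = ev c" by blast
      then have "Rel #>\<^bsub>F\<^esub> c \<in> W'" unfolding 2 by (auto simp: FactGroup_def RCOSETS_def)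
      then obtain d where d: "d \<in> carrier F" "ev d \<in> W" "Rel #>\<^bsub>F\<^esub> c = Rel #>\<^bsub>F\<^esub> d"
        by (auto simp: W'_def S_def)
      have "ev c = ev d" by (rule ev_coset_eq[OF d(3,1)])
      then show ?thesis using c(2) d(2) by simp
    qed
    then show ?thesis using W(2) by blast
  qed
qed

end

section \<open>Lie groups isomorphic to an OT-like group\<close>

lemma OT_group_mult: "(x, y) \<otimes>\<^bsub>OT_group C\<^esub> (x', y') = (x + x', y + OT_phi C x y')"
  by (simp add: OT_group_def)

lemma OT_group_conj:
  "p \<otimes>\<^bsub>OT_group C\<^esub> (0, v) \<otimes>\<^bsub>OT_group C\<^esub> inv\<^bsub>OT_group C\<^esub> p = (0, OT_phi C (fst p) v)"
proof -
  obtain x y where p: "p = (x, y)" by (rule prod.exhaust)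
  have "OT_phi C x (OT_phi C (- x) (- y)) = - y" by (simp add: OT_phi_0 flip: OT_phi_add)
  then show ?thesis by (simp add: p inv_OT_group OT_group_mult)
qed

lemma fst_OT_group_mult: "fst (p \<otimes>\<^bsub>OT_group C\<^esub> q) = fst p + fst q"
  and snd_OT_group_mult: "snd (p \<otimes>\<^bsub>OT_group C\<^esub> q) = snd p + OT_phi C (fst p) (snd q)"
  by (simp_all add: OT_group_def case_prod_unfold)

lemma OT_group_carrier: "carrier (OT_group C) = UNIV" and OT_group_one: "\<one>\<^bsub>OT_group C\<^esub> = 0"
  by (simp_all add: OT_group_def)

text \<open>Lattices and the nilradical depend on the group and its topology, so a group isomorphism
  that is a homeomorphism transports them.\<close>

locale OT_lie_iso =
  fixes G :: "('g, 'e::euclidean_space) lie_group"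
    and C :: "complex^'s::finite^'t::finite"
    and f :: "'g \<Rightarrow> (real^'s) \<times> (real^'s) \<times> (complex^'t)"
  assumes group_G: "group G" and iso: "f \<in> iso G (OT_group C)"
    and topspace_G: "topspace (mtop (mfd G)) = carrier G"
    and continuous: "continuous_map (mtop (mfd G)) euclidean f"
    and continuous_inv: "continuous_map euclidean (mtop (mfd G)) (inv_into (carrier G) f)"
begin

sublocale group_hom G "OT_group C" f
  using iso group_G group_OT_group by (simp add: group_hom_def group_hom_axioms_def iso_def)

abbreviation finv where "finv \<equiv> inv_into (carrier G) f"

lemma f_bij: "bij_betw f (carrier G) UNIV"
  using iso by (simp add: iso_def OT_group_carrier)

lemma f_finv [simp]: "f (finv p) = p"
  using f_bij by (simp add: bij_betw_def f_inv_into_f)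

lemma finv_carrier [simp]: "finv p \<in> carrier G"
  using f_bij by (simp add: bij_betw_def inv_into_into)

lemma finv_f [simp]: "g \<in> carrier G \<Longrightarrow> finv (f g) = g"
  using f_bij by (simp add: bij_betw_def inv_into_f_f)

lemma f_eq_iff: "g \<in> carrier G \<Longrightarrow> h \<in> carrier G \<Longrightarrow> f g = f h \<longleftrightarrow> g = h"
  by (metis finv_f)

definition N where "N = {g \<in> carrier G. fst (f g) = 0}"

lemma normal_N: "N \<lhd> G"
proof -
  have "group_hom G additive_group (\<lambda>g. fst (f g))"
    using group_G group_additive_group
    by (auto simp: group_hom_def group_hom_axioms_def hom_def fst_OT_group_mult)
      (simp_all add: additive_group_def)
  from group_hom.normal_kernel[OF this] show ?thesis
    by (simp add: kernel_def N_def additive_group_def)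
qed

lemma connectedin_N: "connectedin (mtop (mfd G)) N"
proof -
  have "connected ({0 :: real^'s} \<times> (UNIV :: ((real^'s) \<times> (complex^'t)) set))"
    by (intro connected_Times) (auto simp: connected_UNIV)
  then have "connectedin (mtop (mfd G)) (finv ` ({0} \<times> UNIV))"
    using connectedin_continuous_map_image[OF continuous_inv] by (simp add: connectedin_iff_connected)
  moreover have "finv ` ({0} \<times> UNIV) = N"
  proof
    show "N \<subseteq> finv ` ({0} \<times> UNIV)"
    proof
      fix g assume g: "g \<in> N"
      then have "f g \<in> {0} \<times> UNIV" by (auto simp: N_def mem_Times_iff)
      then show "g \<in> finv ` ({0} \<times> UNIV)" using g by (metis (lifting) N_def finv_f image_eqI mem_Collect_eq)
    qed
  qed (auto simp: N_def)
  ultimately show ?thesis by simp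
qed

text \<open>At base component 0 the twist is the identity, so \<open>N\<close> is abelian and its
  lower central series is trivial from index 1 on.\<close>

lemma nilpotent_N: "nilpotent (G\<lparr>carrier := N\<rparr>)"
proof -
  let ?N = "G\<lparr>carrier := N\<rparr>"
  have sub: "subgroup N G" using normal_N by (rule normal_imp_subgroup)
  have grp: "group ?N" using sub group_G by (rule subgroup.subgroup_is_group)
  have N: "g \<in> carrier G" "fst (f g) = 0" if "g \<in> N" for g using that by (auto simp: N_def)
  have comm: "g \<otimes>\<^bsub>G\<^esub> h = h \<otimes>\<^bsub>G\<^esub> g" if "g \<in> N" "h \<in> N" for g h
  proof -
    have "f (g \<otimes>\<^bsub>G\<^esub> h) = f (h \<otimes>\<^bsub>G\<^esub> g)"
      using N[OF that(1)] N[OF that(2)]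
      by (intro prod_eqI) (simp_all add: fst_OT_group_mult snd_OT_group_mult OT_phi_0)
    then show ?thesis
      by (subst (asm) f_eq_iff) (simp_all add: N(1)[OF that(1)] N(1)[OF that(2)])
  qed
  have "g \<otimes>\<^bsub>?N\<^esub> h \<otimes>\<^bsub>?N\<^esub> inv\<^bsub>?N\<^esub> g \<otimes>\<^bsub>?N\<^esub> inv\<^bsub>?N\<^esub> h = \<one>\<^bsub>?N\<^esub>" if gh: "g \<in> N" "h \<in> N" for g h
  proof -
    interpret A: group ?N by (rule grp)
    have c: "g \<in> carrier ?N" "h \<in> carrier ?N" using gh by simp_all
    have "g \<otimes>\<^bsub>?N\<^esub> h = h \<otimes>\<^bsub>?N\<^esub> g" using comm[OF gh] by simp
    then have "g \<otimes>\<^bsub>?N\<^esub> h \<otimes>\<^bsub>?N\<^esub> inv\<^bsub>?N\<^esub> g = h"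
      using c by (metis A.inv_closed A.m_assoc A.r_inv A.r_one)
    then show ?thesis using c(2) by (metis A.r_inv)
  qed
  then have "{g \<otimes>\<^bsub>?N\<^esub> h \<otimes>\<^bsub>?N\<^esub> inv\<^bsub>?N\<^esub> g \<otimes>\<^bsub>?N\<^esub> inv\<^bsub>?N\<^esub> h | g h.
       g \<in> carrier ?N \<and> h \<in> lower_central ?N 0} \<subseteq> {\<one>\<^bsub>?N\<^esub>}" by auto
  then have "lower_central ?N (Suc 0) \<subseteq> generate ?N {\<one>\<^bsub>?N\<^esub>}"
    unfolding lower_central.simps by (rule group.mono_generate[OF grp])
  also have "\<dots> = {\<one>\<^bsub>?N\<^esub>}" by (rule group.generate_one[OF grp])
  finally have "lower_central ?N (Suc 0) \<subseteq> {\<one>\<^bsub>?N\<^esub>}" .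
  moreover have "\<one>\<^bsub>?N\<^esub> \<in> lower_central ?N (Suc 0)"
    unfolding lower_central.simps by (rule generate.one)
  ultimately have "lower_central ?N (Suc 0) = {\<one>\<^bsub>?N\<^esub>}" by blast
  then show ?thesis unfolding nilpotent_def using grp by blast
qed

text \<open>If \<open>x $ j \<noteq> 0\<close> for the base component \<open>x\<close> of an element of \<open>M\<close>, then iterated commutators with this
  element multiply the \<open>j\<close>-th unit vector of the fibre by powers of \<open>exp (x $ j) - 1\<close>.\<close>

lemma nilpotent_subset_N:
  assumes M: "M \<lhd> G" and nil: "nilpotent (G\<lparr>carrier := M\<rparr>)"
  shows "M \<subseteq> N"
proof
  fix g assume g: "g \<in> M"
  have sub: "subgroup M G" using M by (rule normal_imp_subgroup)
  have gc: "g \<in> carrier G" using subgroup.mem_carrier[OF sub g] .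
  have "fst (f g) $ j = 0" for j
  proof (rule ccontr)
    assume j: "fst (f g) $ j \<noteq> 0"
    let ?M = "G\<lparr>carrier := M\<rparr>"
    define x where "x = fst (f g)"
    define c where "c = exp (x $ j) - 1"
    define v where "v n = c ^ n *\<^sub>R (axis j 1 :: real^'s, 0 :: complex^'t)" for n
    define z where "z n = finv (0, v n)" for n
    have zc: "z n \<in> carrier G" for n by (simp add: z_def)
    have "c \<noteq> 0" using j by (simp add: c_def x_def)
    have phi_v: "OT_phi C x (v n) - v n = v (Suc n)" for n
      by (simp add: v_def c_def OT_phi_apply vec_eq_iff axis_def scaleR_prod_def algebra_simps)
    have comm: "z (Suc n) = g \<otimes>\<^bsub>G\<^esub> z n \<otimes>\<^bsub>G\<^esub> inv\<^bsub>G\<^esub> g \<otimes>\<^bsub>G\<^esub> inv\<^bsub>G\<^esub> z n" for n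
    proof -
      have "f (g \<otimes>\<^bsub>G\<^esub> z n \<otimes>\<^bsub>G\<^esub> inv\<^bsub>G\<^esub> g \<otimes>\<^bsub>G\<^esub> inv\<^bsub>G\<^esub> z n) =
          (0, OT_phi C x (v n)) \<otimes>\<^bsub>OT_group C\<^esub> inv\<^bsub>OT_group C\<^esub> (0, v n)"
        using gc by (simp add: z_def OT_group_conj x_def)
      also have "\<dots> = (0, v (Suc n))"
        using phi_v[of n] by (simp add: inv_OT_group OT_group_mult OT_phi_0)
      finally have "f (z (Suc n)) = f (g \<otimes>\<^bsub>G\<^esub> z n \<otimes>\<^bsub>G\<^esub> inv\<^bsub>G\<^esub> g \<otimes>\<^bsub>G\<^esub> inv\<^bsub>G\<^esub> z n)"
        by (simp add: z_def)
      then show ?thesis using gc by (subst (asm) f_eq_iff) (simp_all add: z_def)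
    qed
    \<comment> \<open>Bracketed as \<open>g\<close> times a conjugate of its inverse, the commutator
      lies in \<open>M\<close> by normality, although \<open>z 0\<close> itself need not.\<close>
    have zM: "z (Suc n) \<in> M" for n
    proof -
      have "z (Suc n) = g \<otimes>\<^bsub>G\<^esub> (z n \<otimes>\<^bsub>G\<^esub> inv\<^bsub>G\<^esub> g \<otimes>\<^bsub>G\<^esub> inv\<^bsub>G\<^esub> z n)"
        unfolding comm[of n] using gc zc by (simp add: G.m_assoc)
      moreover have "z n \<otimes>\<^bsub>G\<^esub> inv\<^bsub>G\<^esub> g \<otimes>\<^bsub>G\<^esub> inv\<^bsub>G\<^esub> z n \<in> M"
        by (intro normal.inv_op_closed2[OF M] subgroup.m_inv_closed[OF sub g]) (simp add: z_def)
      ultimately show ?thesis using subgroup.m_closed[OF sub g] by simp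
    qed
    \<comment> \<open>The index is shifted by one because membership in \<open>M\<close> is
      guaranteed only from \<open>z 1\<close> on.\<close>
    have "z (Suc n) \<in> lower_central ?M n" for n
    proof (induction n)
      case 0 then show ?case using zM by simp
    next
      case (Suc n)
      have "z (Suc (Suc n)) = g \<otimes>\<^bsub>?M\<^esub> z (Suc n) \<otimes>\<^bsub>?M\<^esub> inv\<^bsub>?M\<^esub> g \<otimes>\<^bsub>?M\<^esub> inv\<^bsub>?M\<^esub> z (Suc n)"
        using comm[of "Suc n"] G.m_inv_consistent[OF sub] g zM by simp
      then show ?case
        unfolding lower_central.simps using Suc g by (intro generate.incl) auto
    qed
    moreover obtain n where "lower_central ?M n = {\<one>\<^bsub>?M\<^esub>}" using nil by (auto simp: nilpotent_def)
    ultimately have "z (Suc n) = \<one>\<^bsub>G\<^esub>" by auto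
    then have "f (z (Suc n)) = 0" by (simp add: OT_group_one)
    then have "v (Suc n) = 0" by (simp add: z_def zero_prod_def)
    then show False using \<open>c \<noteq> 0\<close> by (simp add: v_def zero_prod_def axis_eq_0_iff)
  qed
  then show "g \<in> N" using gc by (simp add: N_def vec_eq_iff)
qed

lemma nilradical_eq: "nilradical G = N"
  unfolding nilradical_def
  by (rule Greatest_equality) (use normal_N connectedin_N nilpotent_N nilpotent_subset_N in auto)

section \<open>Transport of the lattice properties along the isomorphism\<close>

lemma discrete_image:
  assumes \<Gamma>: "subgroup \<Gamma> G" and "subtopology (mtop (mfd G)) \<Gamma> = discrete_topology \<Gamma>"
  shows "\<exists>e>0. \<forall>g\<in>f ` \<Gamma>. norm g < e \<longrightarrow> g = 0"
proof -
  have "openin (subtopology (mtop (mfd G)) \<Gamma>) {\<one>\<^bsub>G\<^esub>}"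
    using assms subgroup.one_closed[OF \<Gamma>] by simp
  then obtain V where V: "openin (mtop (mfd G)) V" "{\<one>\<^bsub>G\<^esub>} = V \<inter> \<Gamma>"
    by (auto simp: openin_subtopology)
  have "open {p. finv p \<in> V}"
    using openin_continuous_map_preimage[OF continuous_inv V(1)] by simp
  moreover have "finv 0 = \<one>\<^bsub>G\<^esub>" using finv_f[OF G.one_closed] by (simp add: OT_group_one)
  then have "0 \<in> {p. finv p \<in> V}" using V(2) by auto
  ultimately obtain e where e: "e > 0" "ball 0 e \<subseteq> {p. finv p \<in> V}"
    using open_contains_ball by blast
  have "f \<gamma> = 0" if "\<gamma> \<in> \<Gamma>" "norm (f \<gamma>) < e" for \<gamma>
  proof -
    have "finv (f \<gamma>) \<in> V" using e(2) that(2) by auto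
    then have "\<gamma> \<in> V \<inter> \<Gamma>" using that(1) subgroup.mem_carrier[OF \<Gamma>] by simp
    then have "\<gamma> = \<one>\<^bsub>G\<^esub>" using V(2) by blast
    then show ?thesis by (simp add: OT_group_one)
  qed
  then show ?thesis using e(1) by blast
qed

text \<open>The sets \<open>V n\<close> exhaust the quotient and are open, because the saturation of
  a ball is a union of left translates of it. Finitely many of them cover, and the largest index
  bounds all representatives.\<close>

lemma cocompact_image:
  assumes \<Gamma>: "subgroup \<Gamma> G"
    and compact: "compact_space (quotient_topology (mtop (mfd G)) (\<lambda>g. \<Gamma> #>\<^bsub>G\<^esub> g))"
  shows "\<exists>r. \<forall>p. \<exists>\<gamma>\<in>f ` \<Gamma>. \<exists>k. norm k \<le> r \<and> p = \<gamma> \<otimes>\<^bsub>OT_group C\<^esub> k"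
proof -
  define q where "q g = \<Gamma> #>\<^bsub>G\<^esub> g" for g
  define V where "V n = q ` {g \<in> carrier G. norm (f g) < real n}" for n :: nat
  let ?Q = "quotient_topology (mtop (mfd G)) q"
  have sub: "\<Gamma> \<subseteq> carrier G" using \<Gamma> by (rule subgroup.subset)
  have q_eq: "\<exists>\<gamma>\<in>\<Gamma>. g = \<gamma> \<otimes>\<^bsub>G\<^esub> k" if "q g = q k" "g \<in> carrier G" for g k
  proof -
    have "g \<in> q g" unfolding q_def using G.rcos_self[OF that(2) \<Gamma>] .
    then show ?thesis unfolding that(1) by (auto simp: q_def r_coset_def)
  qed
  have q_mult: "q (\<gamma> \<otimes>\<^bsub>G\<^esub> k) = q k" if "\<gamma> \<in> \<Gamma>" "k \<in> carrier G" for \<gamma> k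
    unfolding q_def
    using that sub G.coset_mult_assoc[OF sub, of \<gamma> k] G.coset_join2[of \<gamma> \<Gamma>] \<Gamma> by auto
  have "openin ?Q (V n)" for n
  proof -
    have open_translate: "openin (mtop (mfd G)) {x \<in> carrier G. norm (f (\<gamma> \<otimes>\<^bsub>G\<^esub> x)) < real n}" if "\<gamma> \<in> \<Gamma>" for \<gamma>
    proof -
      obtain a b where ab: "f \<gamma> = (a, b)" by (cases "f \<gamma>")
      have "open {p. norm ((a, b) \<otimes>\<^bsub>OT_group C\<^esub> p) < real n}"
      proof -
        have "continuous_on UNIV (\<lambda>p. norm (a + fst p, b + OT_phi C a (snd p)))"
          by (intro continuous_intros continuous_on_OT_phi)
        then have "open {p. norm (a + fst p, b + OT_phi C a (snd p)) < real n}"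
          by (intro open_Collect_less) auto
        then show ?thesis by (simp add: OT_group_def case_prod_unfold)
      qed
      then have "openin (mtop (mfd G)) {x \<in> topspace (mtop (mfd G)). f x \<in> {p. norm ((a, b) \<otimes>\<^bsub>OT_group C\<^esub> p) < real n}}"
        by (rule openin_continuous_map_preimage[OF continuous open_openin[THEN iffD1]])
      moreover have "f (\<gamma> \<otimes>\<^bsub>G\<^esub> x) = (a, b) \<otimes>\<^bsub>OT_group C\<^esub> f x" if "x \<in> carrier G" for x
        using \<open>\<gamma> \<in> \<Gamma>\<close> that sub by (auto simp flip: ab)
      then have "{x \<in> topspace (mtop (mfd G)). f x \<in> {p. norm ((a, b) \<otimes>\<^bsub>OT_group C\<^esub> p) < real n}} =
          {x \<in> carrier G. norm (f (\<gamma> \<otimes>\<^bsub>G\<^esub> x)) < real n}"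
        unfolding topspace_G by auto
      ultimately show ?thesis by simp
    qed
    have "{x \<in> topspace (mtop (mfd G)). q x \<in> V n} = (\<Union>\<gamma>\<in>\<Gamma>. {x \<in> carrier G. norm (f (\<gamma> \<otimes>\<^bsub>G\<^esub> x)) < real n})"
    proof (intro equalityI subsetI)
      fix x assume "x \<in> {x \<in> topspace (mtop (mfd G)). q x \<in> V n}"
      then obtain k where k: "x \<in> carrier G" "k \<in> carrier G" "norm (f k) < real n" "q k = q x"
        by (auto simp: V_def topspace_G)
      then obtain \<gamma> where "\<gamma> \<in> \<Gamma>" "k = \<gamma> \<otimes>\<^bsub>G\<^esub> x" using q_eq by blast
      then show "x \<in> (\<Union>\<gamma>\<in>\<Gamma>. {x \<in> carrier G. norm (f (\<gamma> \<otimes>\<^bsub>G\<^esub> x)) < real n})" using k by blast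
    next
      fix x assume "x \<in> (\<Union>\<gamma>\<in>\<Gamma>. {x \<in> carrier G. norm (f (\<gamma> \<otimes>\<^bsub>G\<^esub> x)) < real n})"
      then obtain \<gamma> where g: "\<gamma> \<in> \<Gamma>" "x \<in> carrier G" "norm (f (\<gamma> \<otimes>\<^bsub>G\<^esub> x)) < real n" by blast
      then have "q x \<in> V n"
        unfolding V_def using sub by (intro image_eqI[of _ _ "\<gamma> \<otimes>\<^bsub>G\<^esub> x"]) (auto simp: q_mult)
      then show "x \<in> {x \<in> topspace (mtop (mfd G)). q x \<in> V n}" using g(2) by (simp add: topspace_G)
    qed
    then show ?thesis
      unfolding openin_quotient_topology using open_translate by (auto simp: V_def topspace_G)
  qed
  moreover have "topspace ?Q \<subseteq> \<Union>(range V)"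
  proof
    fix X assume "X \<in> topspace ?Q"
    then obtain g where g: "g \<in> carrier G" "X = q g" by (auto simp: topspace_quotient_topology topspace_G)
    obtain n :: nat where "norm (f g) < real n" using reals_Archimedean2 by blast
    then have "X \<in> V n" using g by (auto simp: V_def)
    then show "X \<in> \<Union>(range V)" by blast
  qed
  moreover have "compact_space ?Q" using compact by (simp add: q_def[abs_def])
  ultimately obtain \<F> where "finite \<F>" "\<F> \<subseteq> range V" "topspace ?Q \<subseteq> \<Union>\<F>"
    unfolding compact_space_alt by (metis (no_types, lifting) imageE)
  then obtain I where I: "finite I" "topspace ?Q \<subseteq> \<Union>(V ` I)"
    by (metis finite_subset_image)
  have "\<exists>\<gamma>\<in>f ` \<Gamma>. \<exists>k. norm k \<le> real (Max (insert 0 I)) \<and> p = \<gamma> \<otimes>\<^bsub>OT_group C\<^esub> k" for p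
  proof -
    have "q (finv p) \<in> topspace ?Q" by (simp add: topspace_quotient_topology topspace_G)
    then obtain n where n: "n \<in> I" "q (finv p) \<in> V n" using I(2) by blast
    then obtain k where k: "k \<in> carrier G" "norm (f k) < real n" "q (finv p) = q k"
      by (auto simp: V_def)
    obtain \<gamma> where \<gamma>: "\<gamma> \<in> \<Gamma>" "finv p = \<gamma> \<otimes>\<^bsub>G\<^esub> k" using q_eq[OF k(3)] by auto
    have "p = f \<gamma> \<otimes>\<^bsub>OT_group C\<^esub> f k"
      using arg_cong[OF \<gamma>(2), of f] \<gamma>(1) k(1) sub by auto
    moreover have "n \<le> Max (insert 0 I)" using I(1) n(1) by simp
    then have "norm (f k) \<le> real (Max (insert 0 I))" using k(2) by linarith
    ultimately show ?thesis using \<gamma>(1) by blast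
  qed
  then show ?thesis by blast
qed

text \<open>As the fibre is abelian, conjugation by \<open>\<gamma>\<close> acts on it through the
  base component of \<open>f \<gamma>\<close> alone, so invariance under \<open>base\<close> and
  invariance under \<open>\<Gamma>\<close> are the same condition.\<close>

lemma OT_simple_lattice_image:
  assumes "lattice_of_simple_type G \<Gamma>"
  shows "OT_simple_lattice C (f ` \<Gamma>)"
proof -
  have lat: "is_lattice G (mtop (mfd G)) \<Gamma>"
    using assms by (simp add: lattice_of_simple_type_def)
  then have \<Gamma>: "subgroup \<Gamma> G" by (simp add: is_lattice_def)
  have sub: "\<Gamma> \<subseteq> carrier G" using \<Gamma> by (rule subgroup.subset)
  have OT: "OT_lattice C (f ` \<Gamma>)"
    using lat discrete_image cocompact_image subgroup_img_is_subgroup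
    by (intro OT_lattice.intro) (auto simp: is_lattice_def)
  define A where "A = G\<lparr>carrier := \<Gamma> \<inter> N\<rparr>"
  define w where "w a = snd (f a)" for a
  have irr: "irreducible_rep rat_ring (tensor_rat A) \<Gamma>
      (\<lambda>\<gamma>. tensor_map A (\<lambda>(a, q). (\<gamma> \<otimes>\<^bsub>G\<^esub> a \<otimes>\<^bsub>G\<^esub> inv\<^bsub>G\<^esub> \<gamma>, q)))"
    using assms by (simp add: lattice_of_simple_type_def Let_def nilradical_eq A_def)
  have A: "a \<in> \<Gamma>" "a \<in> carrier G" "f a = (0, w a)" if "a \<in> carrier A" for a
    using that sub by (auto simp: A_def N_def w_def prod_eq_iff)
  have AI: "a \<in> carrier A" if "a \<in> \<Gamma>" "fst (f a) = 0" for a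
    using that sub by (auto simp: A_def N_def)
  interpret T: tensor_evaluation A w
  proof
    fix a b assume ab: "a \<in> carrier A" "b \<in> carrier A"
    note a = A[OF ab(1)] and b = A[OF ab(2)]
    show "a \<otimes>\<^bsub>A\<^esub> b \<in> carrier A"
      using subgroup.m_closed[OF \<Gamma> a(1) b(1)] a b AI[of "a \<otimes>\<^bsub>G\<^esub> b"] by (simp add: fst_OT_group_mult A_def)
    show "w (a \<otimes>\<^bsub>A\<^esub> b) = w a + w b"
      using a(2) b(2) arg_cong[OF a(3), of fst] by (simp add: A_def w_def snd_OT_group_mult OT_phi_0)
  qed
  have f_conj: "f (\<gamma> \<otimes>\<^bsub>G\<^esub> a \<otimes>\<^bsub>G\<^esub> inv\<^bsub>G\<^esub> \<gamma>) = (0, OT_phi C (fst (f \<gamma>)) (w a))"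
    if "\<gamma> \<in> \<Gamma>" "a \<in> carrier A" for \<gamma> a
    using that(1) sub A[OF that(2)] by (auto simp: OT_group_conj subset_iff)
  have fibre: "w ` carrier A = OT_lattice.fibre (f ` \<Gamma>)"
  proof -
    have "y \<in> w ` carrier A" if "(0, y) \<in> f ` \<Gamma>" for y
    proof -
      obtain a where a: "(0, y) = f a" "a \<in> \<Gamma>"
        using \<open>(0, y) \<in> f ` \<Gamma>\<close> by (rule imageE)
      have "fst (f a) = 0" "snd (f a) = y" by (simp_all flip: a(1))
      then have "a \<in> carrier A" "y = w a" using AI[OF a(2)] by (simp_all add: w_def)
      then show ?thesis by blast
    qed
    moreover have "(0, w a) \<in> f ` \<Gamma>" if "a \<in> carrier A" for a
      using A(1,3)[OF that] by (intro image_eqI[of _ f a]) simp_all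
    ultimately show ?thesis by (auto simp: OT_lattice.fibre_def[OF OT])
  qed
  show ?thesis
  proof (intro OT_simple_lattice.intro[OF OT] OT_simple_lattice_axioms.intro)
    fix W assume W: "rat_real.subspace W" "W \<subseteq> rat_real.span (OT_lattice.fibre (f ` \<Gamma>))"
      "\<And>x. x \<in> OT_lattice.base (f ` \<Gamma>) \<Longrightarrow> OT_phi C x ` W \<subseteq> W"
    have "W = {0} \<or> W = rat_real.span (w ` carrier A)"
    proof (rule T.irreducible_image[OF irr _ _ _ _ W(1), where T = "\<lambda>\<gamma>. OT_phi C (fst (f \<gamma>))"])
      fix \<gamma> assume g: "\<gamma> \<in> \<Gamma>"
      then have gc: "\<gamma> \<in> carrier G" using sub by blast
      show "linear (OT_phi C (fst (f \<gamma>)))" by (rule linear_OT_phi)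
      show "OT_phi C (fst (f \<gamma>)) ` W \<subseteq> W"
        using g by (intro W(3)) (auto simp: OT_lattice.base_def[OF OT])
      fix a assume a: "a \<in> carrier A"
      show "\<gamma> \<otimes>\<^bsub>G\<^esub> a \<otimes>\<^bsub>G\<^esub> inv\<^bsub>G\<^esub> \<gamma> \<in> carrier A"
        using f_conj[OF g a] g A(1)[OF a] \<Gamma>
        by (intro AI subgroup.m_closed[OF \<Gamma>] subgroup.m_inv_closed[OF \<Gamma>]) simp_all
      show "w (\<gamma> \<otimes>\<^bsub>G\<^esub> a \<otimes>\<^bsub>G\<^esub> inv\<^bsub>G\<^esub> \<gamma>) = OT_phi C (fst (f \<gamma>)) (w a)"
        using f_conj[OF g a] by (simp add: w_def)
      fix b assume b: "b \<in> carrier A"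
      have "inv\<^bsub>G\<^esub> \<gamma> \<otimes>\<^bsub>G\<^esub> (\<gamma> \<otimes>\<^bsub>G\<^esub> (b \<otimes>\<^bsub>G\<^esub> inv\<^bsub>G\<^esub> \<gamma>)) = b \<otimes>\<^bsub>G\<^esub> inv\<^bsub>G\<^esub> \<gamma>"
        using gc A(2)[OF b] by (simp flip: G.m_assoc)
      then show "\<gamma> \<otimes>\<^bsub>G\<^esub> (a \<otimes>\<^bsub>A\<^esub> b) \<otimes>\<^bsub>G\<^esub> inv\<^bsub>G\<^esub> \<gamma> =
          \<gamma> \<otimes>\<^bsub>G\<^esub> a \<otimes>\<^bsub>G\<^esub> inv\<^bsub>G\<^esub> \<gamma> \<otimes>\<^bsub>A\<^esub> (\<gamma> \<otimes>\<^bsub>G\<^esub> b \<otimes>\<^bsub>G\<^esub> inv\<^bsub>G\<^esub> \<gamma>)"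
        using gc A(2)[OF a] A(2)[OF b] by (simp add: A_def G.m_assoc)
    next
      show "W \<subseteq> rat_real.span (w ` carrier A)" using W(2) by (simp add: fibre)
    qed
    then show "W = {0} \<or> W = rat_real.span (OT_lattice.fibre (f ` \<Gamma>))" by (simp add: fibre)
  qed
qed

end

theorem theorem1p3:
  fixes G :: "('g, 'e::euclidean_space) lie_group"
  assumes "OT_like TYPE('s::finite) TYPE('t::finite) G"
    and "\<exists>\<Gamma>. lattice_of_simple_type G \<Gamma>"
  shows "\<exists>K U. \<exists>X :: ((complex^'s) \<times> (complex^'t)) set topology.
    OT_manifold K U X \<and> OT_simple_type K U \<and> associated_to_OT TYPE('s) TYPE('t) G K U"
proof -
  obtain C :: "complex^'s^'t" where G: "is_lie_group G" and C: "lie_isomorphic G (OT_group C)"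
    using assms(1) unfolding OT_like_def by blast
  obtain \<Gamma> where \<Gamma>: "lattice_of_simple_type G \<Gamma>" using assms(2) by blast
  obtain f where f: "f \<in> iso G (OT_group C)" "smooth_map (mfd G) (mfd (OT_group C)) f"
      "smooth_map (mfd (OT_group C)) (mfd G) (inv_into (carrier G) f)"
    using C unfolding lie_isomorphic_def by blast
  have mtop: "mtop (mfd (OT_group C)) = euclidean"
    by (simp add: OT_group_def euclidean_manifold_def)
  interpret OT_lie_iso G C f
    by (rule OT_lie_iso.intro) (use G f in \<open>simp_all add: is_lie_group_def smooth_map_def mtop\<close>)
  \<comment> \<open>\<open>undefined\<close> stands for an arbitrary choice of the coordinate
    \<open>a0\<close>.\<close>
  interpret L: OT_simple_lattice C "f ` \<Gamma>" undefined
    using \<Gamma> by (rule OT_simple_lattice_image)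
  show ?thesis
    using L.OT_manifold_K_U L.field_adjoin_rat_U L.associated_to_OT_K_U[OF C]
    unfolding OT_simple_type_def by blast
qed

end
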